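(* Let $\chi$ be a primitive non-principal Dirichlet character modulo $q$. Assume that $L(s,\chi)$ has a real zero at $\beta_1 \in (0,1)$. Let $(r,\phi,E)$ be any one of the following four triples: $$\left(\tfrac{1.6}{10\log 10},\ 0.22675,\ 1.1614\right),\quad \left(\tfrac{1.3}{10\log 10},\ 0.23083,\ 1.1805\right),$$ $$\left(\tfrac{1.2}{10\log 10},\ 0.23222,\ 1.1870\right),\quad \left(\tfrac{1.1}{10\log 10},\ 0.23362,\ 1.1936\right),$$ and set $\sigma = 1+r$ and $R = r + 7/8$. Then $$\sum_{n=1}^\infty \Lambda(n)\,\frac{1+\Re\{\chi(n)\}}{n^\sigma} \le \frac{1}{r} - \frac{1}{\sigma-\beta_1} + \frac{\sigma-\beta_1}{R^2} + \phi\log q + E.$$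
   Context: $\Lambda$ is the von Mangoldt function, $L(s,\chi)$ is the Dirichlet $L$-function of $\chi$, and $\log$ is the natural logarithm. Here $\frac{a}{10\log 10}$ means $a/(10\cdot\log 10)=a/\log(10^{10})$. *)

theory Defs
  imports
    "HOL-Number_Theory.Prime_Powers"
    "HOL-Complex_Analysis.Complex_Analysis"
begin

definition dirichlet_character :: "nat \<Rightarrow> (int \<Rightarrow> complex) \<Rightarrow> bool" where
  "dirichlet_character q chi \<longleftrightarrow>
     q > 0 \<and>
     (\<forall>n. chi (n + int q) = chi n) \<and>
     (\<forall>m n. chi (m * n) = chi m * chi n) \<and>
     (\<forall>n. chi n \<noteq> 0 \<longleftrightarrow> coprime n (int q))"

definition principal_character :: "nat \<Rightarrow> int \<Rightarrow> complex" where
  "principal_character q n = (if coprime n (int q) then 1 else 0)"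

text \<open>A character modulo \<open>q\<close> is primitive if it is not induced by a character whose modulus is a
  proper divisor of \<open>q\<close>. The character modulo 1 is both primitive and principal.\<close>

definition primitive_character :: "nat \<Rightarrow> (int \<Rightarrow> complex) \<Rightarrow> bool" where
  "primitive_character q chi \<longleftrightarrow>
     dirichlet_character q chi \<and>
     \<not> (\<exists>d \<psi>. d dvd q \<and> d < q \<and> dirichlet_character d \<psi> \<and>
           (\<forall>n. coprime n (int q) \<longrightarrow> chi n = \<psi> n))"

definition dirichlet_series :: "(int \<Rightarrow> complex) \<Rightarrow> complex \<Rightarrow> complex" where
  "dirichlet_series chi s = (\<Sum>\<^sub>\<infinity>n\<in>{1::nat..}. chi (int n) / of_nat n powr s)"

text \<open>\<open>L(s, chi)\<close> is the analytic continuation of the Dirichlet series, which converges absolutely for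
  \<open>Re s > 1\<close>. It suffices to continue to some punctured half-plane \<open>{z. Re z > c} - {1}\<close> that has \<open>s\<close>
  in its interior or, for \<open>s = 1\<close>, as the puncture; this set is connected, so the value does not
  depend on the choice of \<open>c\<close> and \<open>f\<close>. Taking the limit at \<open>s\<close> gives \<open>f s\<close> for \<open>s \<noteq> 1\<close>, and removes
  the singularity at \<open>s = 1\<close> if \<open>chi\<close> is not principal. For principal \<open>chi\<close> there is a pole at \<open>s = 1\<close>,
  and the value there is unspecified.\<close>

definition L_value :: "(int \<Rightarrow> complex) \<Rightarrow> complex \<Rightarrow> complex \<Rightarrow> bool" where
  "L_value chi s w \<longleftrightarrow>
     (\<exists>c f. c < Re s \<and> f holomorphic_on ({z. Re z > c} - {1}) \<and>
        (\<forall>z. Re z > 1 \<longrightarrow> f z = dirichlet_series chi z) \<and> (f \<longlongrightarrow> w) (at s))"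

definition dirichlet_L :: "complex \<Rightarrow> (int \<Rightarrow> complex) \<Rightarrow> complex" where
  "dirichlet_L s chi = (THE w. L_value chi s w)"

lemma L_value_unique:
  assumes "L_value chi s v" and "L_value chi s w"
  shows "v = w"
proof -
  obtain a f where a: "a < Re s" and f: "f holomorphic_on ({z. Re z > a} - {1})"
    "\<And>z. Re z > 1 \<Longrightarrow> f z = dirichlet_series chi z" and fv: "(f \<longlongrightarrow> v) (at s)"
    using assms(1) unfolding L_value_def by blast
  obtain b g where b: "b < Re s" and g: "g holomorphic_on ({z. Re z > b} - {1})"
    "\<And>z. Re z > 1 \<Longrightarrow> g z = dirichlet_series chi z" and gw: "(g \<longlongrightarrow> w) (at s)"
    using assms(2) unfolding L_value_def by blast
  define c where "c = max a b"
  define D :: "complex set" where "D = {z. Re z > c} - {1}"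
  have eq: "f z = g z" if "z \<in> D" for z
  proof (rule analytic_continuation_open[of "{z. Re z > max 1 c}" D f g])
    show "connected D" unfolding D_def
      by (intro connected_open_delete open_halfspace_Re_gt convex_connected convex_halfspace_Re_gt) simp
    have "complex_of_real (max 1 c + 1) \<in> {z. Re z > max 1 c}" by (simp add: max_def)
    then show "{z. Re z > max 1 c} \<noteq> {}" by blast
    show "open {z. Re z > max 1 c}" by (rule open_halfspace_Re_gt)
    show "open D" unfolding D_def by (intro open_delete open_halfspace_Re_gt)
    show "f holomorphic_on D" "g holomorphic_on D"
      by (rule holomorphic_on_subset[OF f(1)] holomorphic_on_subset[OF g(1)], auto simp: D_def c_def)+
  qed (use that f(2) g(2) in \<open>auto simp: D_def\<close>)
  have "eventually (\<lambda>z. z \<in> {z. Re z > c} - {1}) (at s)"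
  proof -
    have "eventually (\<lambda>z. z \<in> {z. Re z > c}) (at s)"
      using a b by (intro eventually_at_in_open' open_halfspace_Re_gt) (auto simp: c_def)
    moreover have "eventually (\<lambda>z. z \<noteq> 1) (at s)"
      by (rule eventually_neq_at_within)
    ultimately show ?thesis by eventually_elim auto
  qed
  then have "eventually (\<lambda>z. f z = g z) (at s)"
    by eventually_elim (use eq in \<open>auto simp: D_def\<close>)
  with fv have "(g \<longlongrightarrow> v) (at s)" by (simp add: tendsto_cong)
  with gw show ?thesis using tendsto_unique[of "at s"] by auto
qed

lemma dirichlet_L_eqI: "L_value chi s w \<Longrightarrow> dirichlet_L s chi = w"
  unfolding dirichlet_L_def using L_value_unique by blast

end

theory Submission
  imports Defs "HOL-Number_Theory.Residues" "HOL-Computational_Algebra.Squarefree" "HOL-Real_Asymp.Real_Asymp"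
begin

text \<open>
  Weighting the character by \<open>n\<close> and expanding it in additive characters turns
  \<open>\<Sum>n. n chi(n) z^n\<close> into a combination of rotated Koebe functions \<open>z / (1 - z)^2\<close>. Their
  absolute values are Poisson kernels, whose sum over the residues is known in closed form, so the
  series is at most \<open>sqrt q / (2 v)\<close> at \<open>z = exp (- v)\<close>, besides being trivially at most \<open>1 / v^2\<close>.
  Its Mellin transform is \<open>\<Gamma>(s + 1) L(s)\<close>; cutting the integral where the two bounds
  agree gives \<open>\<bar>L(s)\<bar> \<le> (sqrt q / 2)^(1 - x) / (x (1 - x) \<bar>\<Gamma>(s + 1)\<bar>)\<close> for \<open>0 < x = Re s < 1\<close>,
  without any logarithm of the modulus.

  A Jensen formula weighted by \<open>cos \<theta>\<close> on the circle with centre \<open>1 + r\<close> and radius \<open>\<rho>\<close>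
  slightly below \<open>R\<close> expresses \<open>- Re (L'/L)(1 + r)\<close> by the values of \<open>ln \<bar>L\<bar>\<close> on the circle and
  by the zeros inside, each of which helps; only \<open>\<beta>\<^sub>1\<close> is kept. The points
  \<open>1 + r - \<rho> e^(i \<theta>)\<close> and \<open>1 + r + \<rho> e^(i \<theta>)\<close> are treated together, by the bound above and by
  \<open>\<bar>ln \<bar>L\<bar>\<bar> \<le> ln \<zeta>\<close> respectively. Their logarithmic singularities at the line \<open>Re s = 1\<close> combine
  to \<open>ln \<bar>sin^2 \<theta> - a^2\<bar>\<close>, and after estimating the remaining terms by polynomials in \<open>cos \<theta>\<close>
  every integral is elementary. The sum in question is \<open>- \<zeta>'/\<zeta> - Re L'/L\<close> at \<open>1 + r\<close>.
\<close>

section \<open>Dirichlet characters\<close>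

text \<open>The weight \<open>n\<close> is what avoids the logarithm: without it the pieces have
  size \<open>1 / |1 - w|\<close>, and summing these over the residues costs a factor
  \<open>ln q\<close>. With squared denominators Parseval evaluates the sum, and its dominant
  kernel, at residue 0, is absent because \<open>chi 0 = 0\<close>. The factor
  \<open>cos \<theta>\<close> has opposite signs on the two halves of the circle, so
  \<open>ln |L|\<close> is needed from above on the left and from below on the right; a lower bound
  is available there because the right half lies in \<open>Re s > 1\<close>. The term
  \<open>ln q / 2\<close> occurs only left of \<open>Re s = 1\<close>, with weight
  \<open>1 - Re s\<close>. Its mean against \<open>cos \<theta>\<close> is about
  \<open>1/4 - r / (pi R)\<close>; this is the origin of \<phi>, with \<open>1 / pi\<close> lowered
  to 0.317. The radius \<open>r + 7/8\<close> keeps the circle in \<open>Re s > 1/8\<close>, away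
  from the pole of the bound at 0. The obstacle is numerical: the last comparison with
  \<open>E\<close> has a margin below 0.0005, so all estimates are fitted to
  \<open>0.0477 <= r <= 0.0695\<close>, an interval that contains the four values of
  \<open>r\<close>.\<close>

context
  fixes q :: nat and chi :: "int \<Rightarrow> complex"
  assumes char: "dirichlet_character q chi"
begin

lemma character_modulus_pos: "q > 0"
  using char by (simp add: dirichlet_character_def)

lemma character_mult: "chi (m * n) = chi m * chi n"
  using char by (simp add: dirichlet_character_def)

lemma character_eq_0_iff: "chi n = 0 \<longleftrightarrow> \<not> coprime n (int q)"
  using char by (auto simp: dirichlet_character_def)

lemma character_1: "chi 1 = 1"
proof -
  have "chi 1 * chi 1 = chi 1" using character_mult[of 1 1] by simp
  moreover have "chi 1 \<noteq> 0" by (simp add: character_eq_0_iff)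
  ultimately show ?thesis by simp
qed

lemma character_power: "chi (n ^ k) = chi n ^ k"
  by (induction k) (simp_all add: character_1 character_mult)

lemma character_cong:
  assumes "[m = n] (mod int q)"
  shows "chi m = chi n"
proof -
  have shift: "chi (a + int q * int k) = chi a" for a k
  proof (induction k)
    case (Suc k)
    have "chi (a + int q * int (Suc k)) = chi ((a + int q * int k) + int q)"
      by (simp add: algebra_simps)
    also have "\<dots> = chi (a + int q * int k)"
      using char by (simp add: dirichlet_character_def)
    finally show ?case using Suc by simp
  qed simp
  obtain k where k: "m = n + int q * k"
    using assms by (metis cong_iff_lin cong_sym)
  show ?thesis
  proof (cases "k \<ge> 0")
    case True
    then show ?thesis using shift[of n "nat k"] k by simp
  next
    case False
    then show ?thesis using shift[of m "nat (- k)"] k by simp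
  qed
qed

lemma norm_character_eq_1:
  assumes "coprime n (int q)"
  shows "norm (chi n) = 1"
proof -
  have "[n ^ totient q = 1] (mod int q)"
  proof -
    define m where "m = nat (n mod int q)"
    have m: "int m = n mod int q" using character_modulus_pos by (simp add: m_def)
    have "coprime (int m) (int q)" unfolding m using assms character_modulus_pos by simp
    then have "coprime m q" by simp
    then have "[m ^ totient q = 1] (mod q)" by (rule euler_theorem)
    then have "[int m ^ totient q = 1] (mod int q)"
      by (metis cong_int_iff of_nat_1 of_nat_power)
    moreover have "[n = int m] (mod int q)" unfolding m by (simp add: cong_def)
    ultimately show ?thesis by (meson cong_pow cong_trans)
  qed
  then have "chi n ^ totient q = 1"
    using character_cong character_1 by (metis character_power)
  moreover have "totient q > 0" using character_modulus_pos by simp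
  ultimately show ?thesis
    by (metis norm_one norm_power norm_ge_zero power_eq_1_iff less_irrefl)
qed

lemma norm_character_le_1: "norm (chi n) \<le> 1"
  using norm_character_eq_1[of n] character_eq_0_iff[of n] by (cases "coprime n (int q)") auto

lemma character_eq_principal:
  assumes "q = 1"
  shows "chi = principal_character q"
proof
  fix n
  have "chi n = chi 1" by (rule character_cong) (simp add: assms cong_def)
  then show "chi n = principal_character q n"
    by (simp add: principal_character_def assms character_1)
qed

end

text \<open>For \<open>d\<close> dividing \<open>q\<close> this is surjectivity of the reduction
  from units modulo \<open>q\<close> to units modulo \<open>d\<close>; it lets a character be pushed
  down to modulus \<open>d\<close>.\<close>

lemma coprime_lift:
  fixes n :: int and d q :: nat
  assumes "coprime n (int d)" "q > 0"
  obtains m where "coprime m (int q)" "[m = n] (mod int d)"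
proof -
  \<comment> \<open>every prime factor of \<open>q\<close> divides exactly one of \<open>n\<close> and \<open>k d\<close>\<close>
  define k where "k = (\<Prod>p\<in>{p\<in>prime_factors q. \<not> int p dvd n}. p)"
  have "coprime (n + int k * int d) (int q)"
  proof (rule ccontr)
    assume "\<not> coprime (n + int k * int d) (int q)"
    then have "\<bar>gcd (n + int k * int d) (int q)\<bar> \<noteq> 1" by (simp add: coprime_iff_gcd_eq_1)
    then obtain p where "prime p" "p dvd gcd (n + int k * int d) (int q)"
      using prime_factor_int by blast
    then have p: "prime p" "p dvd n + int k * int d" "p dvd int q" by simp_all
    define r where "r = nat p"
    have r: "p = int r" "prime r" "r dvd q"
      using p prime_ge_0_int[of p] by (auto simp: r_def)
        (metis int_dvd_int_iff nat_0_le prime_ge_0_int)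
    have rq: "r \<in> prime_factors q" using r assms by (auto simp: in_prime_factors_iff)
    show False
    proof (cases "p dvd n")
      case True
      have "p dvd int k * int d" using p(2) True by (simp add: dvd_add_right_iff)
      then have "r dvd k * d" using r by (metis int_dvd_int_iff of_nat_mult)
      moreover have "\<not> r dvd d"
      proof
        assume "r dvd d"
        then have "p dvd int d" using r by simp
        then have "is_unit p" using assms True by (meson coprime_common_divisor)
        then show False using p by (simp add: prime_int_iff)
      qed
      moreover have "\<not> r dvd k"
      proof
        assume "r dvd k"
        then obtain s where s: "s \<in> prime_factors q" "\<not> int s dvd n" "r dvd s"
          unfolding k_def using r by (auto simp: prime_dvd_prod_iff)
        then have "r = s" using r by (meson in_prime_factors_iff primes_dvd_imp_eq)
        then show False using s True r by simp
      qed
      ultimately show False using r by (simp add: prime_dvd_mult_iff)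
    next
      case False
      then have "r dvd k" unfolding k_def using rq r by (intro dvd_prodI) auto
      then have "p dvd int k * int d" using r by simp
      then have "p dvd n" using p(2) by (simp add: dvd_add_left_iff)
      then show False using False by simp
    qed
  qed
  moreover have "[n + int k * int d = n] (mod int d)" by (simp add: cong_def)
  ultimately show ?thesis using that by blast
qed

lemma primitive_imp_character: "primitive_character q chi \<Longrightarrow> dirichlet_character q chi"
  by (simp add: primitive_character_def)

text \<open>If \<open>chi\<close> were 1 on every unit congruent to 1 modulo \<open>d\<close>, it
  would depend only on the class modulo \<open>d\<close>, and evaluating it at unit lifts would give
  a character \<psi> modulo \<open>d\<close> that induces it, against primitivity.\<close>

lemma primitive_character_nontrivial:
  assumes prim: "primitive_character q chi" and d: "d dvd q" "d < q"
  obtains c where "coprime c (int q)" "[c = 1] (mod int d)" "chi c \<noteq> 1"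
proof -
  note char = primitive_imp_character[OF prim]
  note cmult = character_mult[OF char]
  have qpos: "q > 0" using d by simp
  have dpos: "d > 0" using d by (cases d) auto
  have False if triv: "\<And>c. coprime c (int q) \<Longrightarrow> [c = 1] (mod int d) \<Longrightarrow> chi c = 1"
  proof -
    have wd: "chi m = chi m'" if m: "coprime m (int q)" "coprime m' (int q)" "[m = m'] (mod int d)" for m m'
    proof -
      obtain u where u: "[m' * u = 1] (mod int q)"
        using m(2) cong_solve_coprime_int by blast
      have cu: "coprime u (int q)"
        using u by (metis cong_imp_coprime cong_sym coprime_1_left coprime_mult_left_iff)
      have ud: "[m' * u = 1] (mod int d)"
        using u d by (meson cong_dvd_modulus int_dvd_int_iff)
      have "[m * u = 1] (mod int d)"
        using ud m(3) by (meson cong_scalar_right cong_trans)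
      then have "chi (m * u) = 1" "chi (m' * u) = 1"
        using triv ud m cu by (auto simp: coprime_mult_left_iff)
      then have "chi m * chi u = chi m' * chi u" by (simp add: cmult)
      moreover have "chi u \<noteq> 0" using cu character_eq_0_iff[OF char] by simp
      ultimately show ?thesis by simp
    qed
    define lift where "lift n = (SOME m. coprime m (int q) \<and> [m = n] (mod int d))" for n
    have lift: "coprime (lift n) (int q)" "[lift n = n] (mod int d)" if "coprime n (int d)" for n
    proof -
      have "\<exists>m. coprime m (int q) \<and> [m = n] (mod int d)"
        using coprime_lift[OF that qpos] by blast
      from someI_ex[OF this] show "coprime (lift n) (int q)" "[lift n = n] (mod int d)"
        by (auto simp: lift_def)
    qed
    define \<psi> where "\<psi> n = (if coprime n (int d) then chi (lift n) else 0)" for n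
    have psi_eq: "\<psi> n = chi m" if "coprime n (int d)" "coprime m (int q)" "[m = n] (mod int d)" for n m
    proof -
      have "[lift n = m] (mod int d)" using lift(2)[OF that(1)] that(3) by (meson cong_sym cong_trans)
      then show ?thesis using wd[OF lift(1)[OF that(1)] that(2)] that(1) by (simp add: \<psi>_def)
    qed
    have "dirichlet_character d \<psi>"
      unfolding dirichlet_character_def
    proof (intro conjI allI)
      show "d > 0" by fact
    next
      fix n
      have iff: "coprime (n + int d) (int d) \<longleftrightarrow> coprime n (int d)"
        by (simp add: coprime_iff_gcd_eq_1)
      show "\<psi> (n + int d) = \<psi> n"
      proof (cases "coprime n (int d)")
        case True
        then have "coprime (n + int d) (int d)" using iff by simp
        moreover have "[lift n = n + int d] (mod int d)" using lift(2)[OF True] by (simp add: cong_def)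
        ultimately have "\<psi> (n + int d) = chi (lift n)" using psi_eq lift(1)[OF True] by blast
        then show ?thesis using True by (simp add: \<psi>_def)
      next
        case False
        then show ?thesis using iff by (simp add: \<psi>_def)
      qed
    next
      fix m n
      show "\<psi> (m * n) = \<psi> m * \<psi> n"
      proof (cases "coprime m (int d) \<and> coprime n (int d)")
        case True
        then have "\<psi> (m * n) = chi (lift m * lift n)"
          using lift[of m] lift[of n] by (intro psi_eq) (auto simp: coprime_mult_left_iff intro: cong_mult)
        then show ?thesis using True by (simp add: \<psi>_def cmult)
      next
        case False
        then show ?thesis by (auto simp: \<psi>_def coprime_mult_left_iff)
      qed
    next
      fix n
      show "\<psi> n \<noteq> 0 \<longleftrightarrow> coprime n (int d)"
        using lift(1) character_eq_0_iff[OF char] by (auto simp: \<psi>_def)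
    qed
    moreover have "\<forall>n. coprime n (int q) \<longrightarrow> chi n = \<psi> n"
    proof (intro allI impI)
      fix n assume n: "coprime n (int q)"
      then have "coprime n (int d)" using d by (meson coprime_divisors dvd_refl int_dvd_int_iff)
      then show "chi n = \<psi> n" using psi_eq[of n n] n by simp
    qed
    ultimately show False using prim d unfolding primitive_character_def by blast
  qed
  then show ?thesis using that by blast
qed

section \<open>Gauss sums\<close>

definition add_char :: "nat \<Rightarrow> int \<Rightarrow> complex" where
  "add_char q n = cis (2 * pi * (of_int n / of_nat q))"

lemma add_char_0 [simp]: "add_char q 0 = 1"
  by (simp add: add_char_def)

lemma norm_add_char [simp]: "norm (add_char q n) = 1"
  by (simp add: add_char_def)

lemma add_char_add: "add_char q (m + n) = add_char q m * add_char q n"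
  by (simp add: add_char_def cis_mult add_divide_distrib algebra_simps)

lemma cnj_add_char: "cnj (add_char q n) = add_char q (- n)"
  by (simp add: add_char_def cis_cnj)

lemma add_char_power: "add_char q n ^ k = add_char q (int k * n)"
proof -
  have "real k * (2 * pi * (of_int n / of_nat q)) = 2 * pi * (of_int (int k * n) / of_nat q)" by simp
  then show ?thesis by (simp only: add_char_def Complex.DeMoivre)
qed

lemma add_char_eq_1_iff:
  assumes "q > 0"
  shows "add_char q n = 1 \<longleftrightarrow> int q dvd n"
proof
  assume "int q dvd n"
  then obtain k where "n = int q * k" by blast
  then have "2 * pi * (of_int n / of_nat q) = 2 * pi * of_int k" using assms by simp
  then show "add_char q n = 1" unfolding add_char_def by simp
next
  assume "add_char q n = 1"
  then have "cos (2 * pi * (of_int n / of_nat q)) = 1"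
    unfolding add_char_def by (metis cis.sel(1) one_complex.sel(1))
  then obtain k :: int where k: "2 * pi * (of_int n / of_nat q) = of_int k * 2 * pi"
    by (auto simp: cos_one_2pi_int)
  then have "2 * pi * (of_int n / of_nat q) = 2 * pi * of_int k" by (simp only: mult_ac)
  then have "real_of_int n / of_nat q = of_int k"
    by (rule mult_left_cancel[THEN iffD1, rotated]) simp
  then have "real_of_int n = of_int (int q * k)" using assms by (simp add: field_simps)
  then have "n = int q * k" by (metis of_int_eq_iff)
  then show "int q dvd n" by simp
qed

lemma add_char_cong:
  assumes "q > 0" "[m = n] (mod int q)"
  shows "add_char q m = add_char q n"
proof -
  have "add_char q (m - n) = 1"
    using assms by (simp add: add_char_eq_1_iff cong_iff_dvd_diff)
  then show ?thesis using add_char_add[of q "m - n" n] by simp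
qed

lemma add_char_orthogonality:
  assumes "q > 0"
  shows "(\<Sum>m<q. add_char q (int m * d)) = (if int q dvd d then of_nat q else 0)"
proof -
  have eq: "(\<Sum>m<q. add_char q (int m * d)) = (\<Sum>m<q. add_char q d ^ m)"
    by (simp add: add_char_power)
  show ?thesis
  proof (cases "int q dvd d")
    case True
    then have "add_char q d = 1" using assms by (simp add: add_char_eq_1_iff)
    then show ?thesis using True eq by simp
  next
    case False
    then have ne: "add_char q d \<noteq> 1" using assms by (simp add: add_char_eq_1_iff)
    have "add_char q d ^ q = 1" using assms by (simp add: add_char_power add_char_eq_1_iff)
    then have "(\<Sum>m<q. add_char q d ^ m) = 0"
      using ne by (simp add: geometric_sum)
    then show ?thesis using False eq by simp
  qed
qed

lemma add_char_parseval:
  fixes c :: "nat \<Rightarrow> complex"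
  assumes "q > 0"
  shows "(\<Sum>m<q. (norm (\<Sum>b<q. c b * add_char q (int m * int b)))\<^sup>2) = q * (\<Sum>b<q. (norm (c b))\<^sup>2)"
proof -
  have "complex_of_real (\<Sum>m<q. (norm (\<Sum>b<q. c b * add_char q (int m * int b)))\<^sup>2) =
      (\<Sum>m<q. (\<Sum>b<q. c b * add_char q (int m * int b)) * cnj (\<Sum>b<q. c b * add_char q (int m * int b)))"
    by (simp only: of_real_sum complex_norm_square)
  also have "\<dots> = (\<Sum>m<q. \<Sum>b<q. \<Sum>b'<q. c b * cnj (c b') * add_char q (int m * (int b - int b')))"
    by (simp add: sum_product cnj_add_char add_char_add[symmetric] algebra_simps flip: add_char_add)
  also have "\<dots> = (\<Sum>b<q. \<Sum>b'<q. \<Sum>m<q. c b * cnj (c b') * add_char q (int m * (int b - int b')))"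
    by (subst sum.swap) (intro sum.cong refl sum.swap)
  also have "\<dots> = (\<Sum>b<q. \<Sum>b'<q. c b * cnj (c b') * (if int q dvd int b - int b' then of_nat q else 0))"
    by (simp only: add_char_orthogonality[OF assms] flip: sum_distrib_left)
  also have "\<dots> = (\<Sum>b<q. \<Sum>b'<q. if b' = b then c b * cnj (c b) * of_nat q else 0)"
  proof (intro sum.cong refl)
    fix b b' assume "b \<in> {..<q}" "b' \<in> {..<q}"
    then have "int q dvd int b - int b' \<longleftrightarrow> b' = b"
      using dvd_imp_le_int[of "int b - int b'" "int q"] by force
    then show "c b * cnj (c b') * (if int q dvd int b - int b' then of_nat q else 0) =
        (if b' = b then c b * cnj (c b) * of_nat q else 0)" by auto
  qed
  also have "\<dots> = (\<Sum>b<q. c b * cnj (c b) * of_nat q)"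
    by simp
  also have "\<dots> = complex_of_real (q * (\<Sum>b<q. (norm (c b))\<^sup>2))"
    by (simp add: complex_norm_square sum_distrib_left mult_ac flip: of_real_power)
  finally show ?thesis by (simp only: of_real_eq_iff)
qed

lemma sum_residues_mult_unit:
  fixes f :: "int \<Rightarrow> 'a :: comm_monoid_add"
  assumes "q > 0" "coprime c (int q)" and per: "\<And>m n. [m = n] (mod int q) \<Longrightarrow> f m = f n"
  shows "(\<Sum>n<q. f (c * int n)) = (\<Sum>n<q. f (int n))"
proof -
  define g where "g n = nat ((c * int n) mod int q)" for n :: nat
  have g: "int (g n) = (c * int n) mod int q" for n using assms(1) by (simp add: g_def)
  have img: "g ` {..<q} \<subseteq> {..<q}"
  proof
    fix y assume "y \<in> g ` {..<q}"
    then obtain n where "y = g n" by blast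
    then have "int y < int q" using g assms(1) by simp
    then show "y \<in> {..<q}" by simp
  qed
  have inj: "inj_on g {..<q}"
  proof (rule inj_onI)
    fix m n assume mn: "m \<in> {..<q}" "n \<in> {..<q}" "g m = g n"
    then have "[c * int m = c * int n] (mod int q)" using g by (metis cong_def)
    then have "[int m = int n] (mod int q)" using assms(2) by (simp add: cong_mult_lcancel)
    then have "[m = n] (mod q)" by (simp add: cong_int_iff)
    then show "m = n" using mn by (simp add: cong_def)
  qed
  have "g ` {..<q} = {..<q}" using img inj by (simp add: endo_inj_surj)
  then have "(\<Sum>n<q. f (int n)) = (\<Sum>n<q. f (int (g n)))"
    using inj by (metis (mono_tags, lifting) sum.reindex_cong)
  also have "\<dots> = (\<Sum>n<q. f (c * int n))"
    by (intro sum.cong refl per) (simp add: g cong_def)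
  finally show ?thesis ..
qed

definition gauss_sum :: "nat \<Rightarrow> (int \<Rightarrow> complex) \<Rightarrow> int \<Rightarrow> complex" where
  "gauss_sum q chi a = (\<Sum>n<q. chi (int n) * add_char q (a * int n))"

text \<open>For a unit \<open>a\<close> this is a change of variable. Primitivity enters for the
  other \<open>a\<close>: with \<open>g = gcd a q\<close> and \<open>q = g d\<close>, some unit
  \<open>c\<close> congruent to 1 modulo \<open>d\<close> has \<open>chi c \<noteq> 1\<close>, while
  \<open>a c\<close> and \<open>a\<close> agree modulo \<open>q\<close>; so the sum equals
  \<open>chi c\<close> times itself and vanishes.\<close>

lemma gauss_sum_separable:
  assumes prim: "primitive_character q chi"
  shows "gauss_sum q chi a = cnj (chi a) * gauss_sum q chi 1"
proof -
  note char = primitive_imp_character[OF prim]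
  note q = character_modulus_pos[OF char]
  have shift: "chi c * gauss_sum q chi (a * c) = gauss_sum q chi a" if "coprime c (int q)" for a c
  proof -
    have "(\<Sum>n<q. chi (c * int n) * add_char q (a * (c * int n))) = (\<Sum>n<q. chi (int n) * add_char q (a * int n))"
    proof (rule sum_residues_mult_unit[OF q that, of "\<lambda>n. chi n * add_char q (a * n)"])
      fix m n :: int assume "[m = n] (mod int q)"
      then show "chi m * add_char q (a * m) = chi n * add_char q (a * n)"
        using character_cong[OF char] add_char_cong[OF q] cong_scalar_left by metis
    qed
    then show ?thesis
      by (simp add: gauss_sum_def character_mult[OF char] sum_distrib_left mult_ac)
  qed
  show ?thesis
  proof (cases "coprime a (int q)")
    case True
    have "cnj (chi a) * chi a = 1"
      using norm_character_eq_1[OF char True] by (metis complex_norm_square mult.commute of_real_1 power_one)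
    then show ?thesis using shift[OF True, of 1] by (metis mult.assoc mult_1)
  next
    case False
    define g where "g = nat (gcd a (int q))"
    have g: "int g = gcd a (int q)" by (simp add: g_def)
    have "int g dvd int q" using g by simp
    then obtain d where d: "q = g * d" by auto
    have "g \<noteq> 1" using False g by (auto simp: coprime_iff_gcd_eq_1)
    moreover have "g > 0" using d q by (cases g) auto
    ultimately have "g > 1" by simp
    then have "d < q" "d dvd q" using d q by auto
    then obtain c where c: "coprime c (int q)" "[c = 1] (mod int d)" "chi c \<noteq> 1"
      using primitive_character_nontrivial[OF prim] by blast
    have "int q dvd a * (c - 1)"
    proof -
      have "int g dvd a" using g by simp
      moreover have "int d dvd c - 1" using c by (simp add: cong_iff_dvd_diff)
      ultimately show ?thesis unfolding d by (simp add: mult_dvd_mono)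
    qed
    then have "[a * c * int n = a * int n] (mod int q)" for n
      by (metis cong_iff_dvd_diff cong_scalar_right mult.right_neutral right_diff_distrib)
    then have "gauss_sum q chi (a * c) = gauss_sum q chi a"
      unfolding gauss_sum_def using add_char_cong[OF q] by (metis (no_types, lifting))
    then have "gauss_sum q chi a = 0"
      using shift[OF c(1), of a] c(3) by simp
    then show ?thesis using False character_eq_0_iff[OF char] by simp
  qed
qed

text \<open>The mean square over all \<open>a\<close> is computed twice: Parseval gives
  \<open>q S\<close>, separability gives \<open>S\<close> times the squared modulus at 1, and
  \<open>S > 0\<close> cancels.\<close>

lemma norm_gauss_sum:
  assumes prim: "primitive_character q chi"
  shows "norm (gauss_sum q chi 1) = sqrt q"
proof -
  note char = primitive_imp_character[OF prim]
  note q = character_modulus_pos[OF char]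
  define S where "S = (\<Sum>n<q. (norm (chi (int n)))\<^sup>2)"
  have "(\<Sum>m<q. (norm (gauss_sum q chi (int m)))\<^sup>2) = q * S"
    unfolding gauss_sum_def S_def by (rule add_char_parseval[OF q])
  moreover have "(\<Sum>m<q. (norm (gauss_sum q chi (int m)))\<^sup>2) = S * (norm (gauss_sum q chi 1))\<^sup>2"
    unfolding S_def sum_distrib_right
    by (intro sum.cong refl) (subst gauss_sum_separable[OF prim], simp add: norm_mult power_mult_distrib)
  moreover have "S > 0"
  proof -
    \<comment> \<open>\<open>1 mod q\<close> instead of 1 because for \<open>q = 1\<close> the only
      residue in the range is 0.\<close>
    have "chi (int (1 mod q)) = 1"
      using character_cong[OF char, of "int (1 mod q)" 1] character_1[OF char]
      by (simp add: cong_def of_nat_mod)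
    moreover have "1 mod q \<in> {..<q}" using q by simp
    ultimately show ?thesis unfolding S_def
      by (intro sum_pos2[of _ "1 mod q"]) auto
  qed
  ultimately have "(norm (gauss_sum q chi 1))\<^sup>2 = q" by simp
  then show ?thesis by (metis norm_ge_zero real_sqrt_unique)
qed

text \<open>This is the conjugate of separability, solved for \<open>chi n\<close>; conjugating
  moves the conjugate off \<open>chi n\<close> and puts the sign into the additive
  character.\<close>

lemma character_fourier_expansion:
  assumes prim: "primitive_character q chi"
  shows "chi n = (\<Sum>m<q. cnj (chi (int m)) * add_char q (- (int m) * n)) / cnj (gauss_sum q chi 1)"
proof -
  note char = primitive_imp_character[OF prim]
  have "gauss_sum q chi 1 \<noteq> 0"
    using norm_gauss_sum[OF prim] character_modulus_pos[OF char] by auto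
  moreover have "cnj (gauss_sum q chi n) = chi n * cnj (gauss_sum q chi 1)"
    by (subst gauss_sum_separable[OF prim]) simp
  moreover have "cnj (gauss_sum q chi n) = (\<Sum>m<q. cnj (chi (int m)) * add_char q (- (int m) * n))"
    by (simp add: gauss_sum_def cnj_add_char mult.commute)
  ultimately show ?thesis by (simp add: field_simps)
qed

section \<open>Poisson kernels and the twisted Koebe function\<close>

lemma of_nat_mult_power_sums:
  fixes w :: "'a :: {real_normed_field, banach}"
  assumes "norm w < 1"
  shows "(\<lambda>n. of_nat n * w ^ n) sums (w / (1 - w)\<^sup>2)"
proof (rule sums_Suc_imp)
  have "(\<lambda>n. w * (of_nat (Suc n) * w ^ n)) sums (w * (1 / (1 - w)\<^sup>2))"
    by (intro sums_mult geometric_deriv_sums assms)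
  then show "(\<lambda>n. of_nat (Suc n) * w ^ Suc n) sums (w / (1 - w)\<^sup>2)"
    by (simp add: mult_ac)
qed simp

text \<open>On the \<open>q\<close>-th roots of unity, \<open>1 / (1 - z w)\<close> is the finite Fourier transform of
  \<open>z ^ b / (1 - z ^ q)\<close>, so that this is an instance of Parseval's identity.\<close>

lemma poisson_kernel_residue_sum:
  fixes z :: real
  assumes q: "q > 0" and z: "0 < z" "z < 1"
  shows "(\<Sum>m<q. 1 / (norm (1 - z * add_char q (int m)))\<^sup>2) = q * (1 + z ^ q) / ((1 - z\<^sup>2) * (1 - z ^ q))"
proof -
  have zq: "z ^ q < 1" using z q by (simp add: power_less_one_iff)
  have z2: "z\<^sup>2 < 1" using z by (simp add: power_less_one_iff)
  define c where "c b = complex_of_real (z ^ b / (1 - z ^ q))" for b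
  have ge: "1 / (1 - z * add_char q (int m)) = (\<Sum>b<q. c b * add_char q (int m * int b))" for m
  proof -
    define w where "w = z * add_char q (int m)"
    have nw: "norm w = z" using z by (simp add: w_def norm_mult)
    then have w1: "w \<noteq> 1" using z by auto
    have "add_char q (int q * int m) = 1" using q by (simp add: add_char_eq_1_iff)
    then have wq: "w ^ q = of_real (z ^ q)"
      by (simp add: w_def power_mult_distrib add_char_power)
    have "(\<Sum>b<q. c b * add_char q (int m * int b)) = (\<Sum>b<q. w ^ b) / of_real (1 - z ^ q)"
      by (simp add: c_def w_def power_mult_distrib add_char_power sum_divide_distrib mult_ac)
    also have "\<dots> = ((w ^ q - 1) / (w - 1)) / of_real (1 - z ^ q)"
      using w1 by (simp add: geometric_sum)
    also have "\<dots> = 1 / (1 - w)"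
    proof -
      have "w ^ q - 1 = - of_real (1 - z ^ q)" by (simp add: wq)
      moreover have "complex_of_real (1 - z ^ q) \<noteq> 0" using zq by (simp only: of_real_eq_0_iff)
      moreover have "1 - w \<noteq> 0" "w - 1 \<noteq> 0" using w1 by auto
      ultimately show ?thesis by (simp add: divide_simps) (simp add: algebra_simps)
    qed
    finally show ?thesis by (simp add: w_def)
  qed
  have "(\<Sum>m<q. 1 / (norm (1 - z * add_char q (int m)))\<^sup>2) =
      (\<Sum>m<q. (norm (1 / (1 - z * add_char q (int m))))\<^sup>2)"
    by (simp add: norm_divide power_divide)
  also have "\<dots> = q * (\<Sum>b<q. (norm (c b))\<^sup>2)"
    unfolding ge by (rule add_char_parseval[OF q])
  also have "(\<Sum>b<q. (norm (c b))\<^sup>2) = (\<Sum>b<q. (z\<^sup>2) ^ b) / (1 - z ^ q)\<^sup>2"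
    by (simp add: c_def norm_divide norm_power power_divide sum_divide_distrib power_mult[symmetric] mult.commute
        del: of_real_divide of_real_power)
  also have "(\<Sum>b<q. (z\<^sup>2) ^ b) = (1 - (z ^ q)\<^sup>2) / (1 - z\<^sup>2)"
  proof -
    have "(z\<^sup>2) ^ q = (z ^ q)\<^sup>2" by (metis power_commutes power_mult mult.commute)
    then show ?thesis using z2 by (simp add: sum_gp_strict)
  qed
  also have "q * ((1 - (z ^ q)\<^sup>2) / (1 - z\<^sup>2) / (1 - z ^ q)\<^sup>2) = q * (1 + z ^ q) / ((1 - z\<^sup>2) * (1 - z ^ q))"
  proof -
    have "1 - (z ^ q)\<^sup>2 = (1 - z ^ q) * (1 + z ^ q)" by (simp add: power2_eq_square algebra_simps)
    then show ?thesis using zq z2 by (simp add: power2_eq_square divide_simps)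
  qed
  finally show ?thesis .
qed

text \<open>The full kernel sum exceeds \<open>q / (1 - z^2)\<close> by
  \<open>2 q u / ((1 - u) (1 - z^2))\<close>, and the kernel at residue 0 is at least as large as
  this excess. With \<open>T = 1 + z + ... + z^(q - 1)\<close> that amounts to
  \<open>2 q u <= (1 + z) T\<close>, which holds because \<open>u = z^q\<close> is below every term
  of \<open>T\<close> and of \<open>z T\<close>.\<close>

lemma poisson_kernel_punctured_sum_le:
  fixes z :: real
  assumes q: "q > 0" and z: "0 < z" "z < 1"
  shows "q * (1 + z ^ q) / ((1 - z\<^sup>2) * (1 - z ^ q)) - 1 / (1 - z)\<^sup>2 \<le> q / (1 - z\<^sup>2)"
proof -
  define u where "u = z ^ q"
  have u: "0 < u" "u < 1" using z q by (auto simp: power_less_one_iff u_def)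
  have z2: "z\<^sup>2 < 1" using z by (simp add: power_less_one_iff)
  define T where "T = (1 - u) / (1 - z)"
  have "real q * u = (\<Sum>b<q. u)" by simp
  also have "\<dots> \<le> (\<Sum>b<q. z ^ b)"
    unfolding u_def using z by (intro sum_mono power_decreasing) auto
  also have "\<dots> = T" using z by (simp add: sum_gp_strict u_def T_def)
  finally have 1: "q * u \<le> T" .
  have "real q * u = (\<Sum>b<q. u)" by simp
  also have "\<dots> \<le> (\<Sum>b<q. z * z ^ b)"
    unfolding u_def power_Suc[symmetric] using z by (intro sum_mono power_decreasing) auto
  also have "\<dots> = z * T" using z by (simp add: sum_gp_strict u_def T_def flip: sum_distrib_left)
  finally have "2 * (q * u) \<le> (1 + z) * T" using 1 by (simp add: distrib_right)
  then have "2 * (q * u) / ((1 - u) * (1 - z\<^sup>2)) \<le> (1 + z) * T / ((1 - u) * (1 - z\<^sup>2))"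
    using u z2 by (intro divide_right_mono) auto
  also have "\<dots> = 1 / (1 - z)\<^sup>2"
  proof -
    have "1 - z\<^sup>2 = (1 - z) * (1 + z)" by (simp add: power2_eq_square algebra_simps)
    then show ?thesis using u z by (simp add: T_def power2_eq_square divide_simps)
  qed
  finally have "2 * (q * u) / ((1 - u) * (1 - z\<^sup>2)) \<le> 1 / (1 - z)\<^sup>2" .
  moreover have "q * (1 + u) / ((1 - z\<^sup>2) * (1 - u)) = q / (1 - z\<^sup>2) + 2 * (q * u) / ((1 - u) * (1 - z\<^sup>2))"
    using u z2 by (simp add: divide_simps) (simp add: algebra_simps)
  ultimately show ?thesis unfolding u_def by linarith
qed

definition char_power_series :: "(int \<Rightarrow> complex) \<Rightarrow> real \<Rightarrow> complex" where
  "char_power_series chi z = (\<Sum>n. of_nat n * chi (int n) * of_real z ^ n)"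

definition koebe_term :: "nat \<Rightarrow> real \<Rightarrow> nat \<Rightarrow> complex" where
  "koebe_term q z m = z * add_char q (- int m) / (1 - z * add_char q (- int m))\<^sup>2"

lemma char_power_series_sums:
  assumes prim: "primitive_character q chi" and z: "0 < z" "z < 1"
  shows "(\<lambda>n. of_nat n * chi (int n) * of_real z ^ n) sums
    ((\<Sum>m<q. cnj (chi (int m)) * koebe_term q z m)
      / cnj (gauss_sum q chi 1))"
proof -
  have "(\<lambda>n. (\<Sum>m<q. cnj (chi (int m)) * (of_nat n * (z * add_char q (- int m)) ^ n)) / cnj (gauss_sum q chi 1)) sums
    ((\<Sum>m<q. cnj (chi (int m)) * koebe_term q z m)
      / cnj (gauss_sum q chi 1))"
    unfolding koebe_term_def using z by (intro sums_divide sums_sum sums_mult of_nat_mult_power_sums) (simp add: norm_mult)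
  moreover have "(\<Sum>m<q. cnj (chi (int m)) * (of_nat n * (z * add_char q (- int m)) ^ n)) / cnj (gauss_sum q chi 1) =
      of_nat n * chi (int n) * of_real z ^ n" for n
    by (subst (2) character_fourier_expansion[OF prim])
       (simp add: power_mult_distrib add_char_power sum_distrib_left sum_divide_distrib sum_distrib_right mult_ac)
  ultimately show ?thesis by simp
qed

text \<open>Each Koebe term has modulus \<open>z\<close> times a Poisson kernel. Since
  \<open>q > 1\<close> forces \<open>chi 0 = 0\<close>, the kernel at residue 0, the only one that
  blows up as \<open>z\<close> tends to 1, is missing; division by the Gauss sum turns the factor
  \<open>q\<close> of the remaining sum into \<open>sqrt q\<close>.\<close>

lemma norm_char_power_series_le:
  assumes prim: "primitive_character q chi" and q: "q > 1" and z: "0 < z" "z < 1"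
  shows "norm (char_power_series chi z) \<le> sqrt q * (z / (1 - z\<^sup>2))"
proof -
  note char = primitive_imp_character[OF prim]
  define k where "k m = 1 / (norm (1 - z * add_char q (int m)))\<^sup>2" for m
  have k: "norm (koebe_term q z m) = z * k m" for m
  proof -
    have "norm (cnj (1 - z * add_char q (int m))) = norm (1 - z * add_char q (int m))"
      by (rule complex_mod_cnj)
    then have "norm (1 - z * add_char q (- int m)) = norm (1 - z * add_char q (int m))"
      by (simp add: cnj_add_char)
    then show ?thesis using z by (simp add: koebe_term_def k_def norm_divide norm_mult norm_power)
  qed
  have "chi 0 = 0" using q by (simp add: character_eq_0_iff[OF char])
  have "norm (\<Sum>m<q. cnj (chi (int m)) * koebe_term q z m) =
      norm (\<Sum>m\<in>{..<q} - {0}. cnj (chi (int m)) * koebe_term q z m)"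
    using \<open>chi 0 = 0\<close> q by (subst sum.remove[of _ 0]) auto
  also have "\<dots> \<le> (\<Sum>m\<in>{..<q} - {0}. 1 * (z * k m))"
    using z norm_character_le_1[OF char]
    by (intro order.trans[OF norm_sum sum_mono]) (subst norm_mult, subst k, intro mult_right_mono, auto simp: k_def)
  also have "\<dots> = z * ((\<Sum>m<q. k m) - k 0)"
    using q by (subst sum.remove[of "{..<q}" 0]) (auto simp: sum_distrib_left)
  also have "(\<Sum>m<q. k m) = q * (1 + z ^ q) / ((1 - z\<^sup>2) * (1 - z ^ q))"
    unfolding k_def using q z by (intro poisson_kernel_residue_sum) auto
  also have "k 0 = 1 / (1 - z)\<^sup>2"
  proof -
    have "1 - complex_of_real z = of_real (1 - z)" by simp
    then show ?thesis unfolding k_def using z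
      by (simp only: of_nat_0 add_char_0 mult_1_right norm_of_real power2_abs)
  qed
  also have "z * (q * (1 + z ^ q) / ((1 - z\<^sup>2) * (1 - z ^ q)) - 1 / (1 - z)\<^sup>2) \<le> z * (q / (1 - z\<^sup>2))"
    using q z by (intro mult_left_mono poisson_kernel_punctured_sum_le) auto
  finally have le: "norm (\<Sum>m<q. cnj (chi (int m)) * koebe_term q z m)
    \<le> z * (q / (1 - z\<^sup>2))" .
  have "norm (char_power_series chi z) =
      norm (\<Sum>m<q. cnj (chi (int m)) * koebe_term q z m) / sqrt q"
    using char_power_series_sums[OF prim z]
    by (simp add: char_power_series_def sums_iff norm_divide norm_gauss_sum[OF prim])
  also have "\<dots> \<le> z * (q / (1 - z\<^sup>2)) / sqrt q"
    using le by (intro divide_right_mono) auto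
  also have "\<dots> = (real q / sqrt q) * (z / (1 - z\<^sup>2))" by (simp add: mult_ac)
  also have "real q / sqrt q = sqrt q" by (simp add: real_div_sqrt)
  finally show ?thesis .
qed

lemma norm_char_power_series_trivial:
  assumes char: "dirichlet_character q chi" and z: "0 < z" "z < 1"
  shows "norm (char_power_series chi z) \<le> z / (1 - z)\<^sup>2"
proof -
  have s: "(\<lambda>n. of_nat n * z ^ n) sums (z / (1 - z)\<^sup>2)"
    using z by (intro of_nat_mult_power_sums) auto
  have le: "norm (of_nat n * chi (int n) * of_real z ^ n) \<le> of_nat n * z ^ n" for n
    using z norm_character_le_1[OF char, of "int n"]
    by (simp add: norm_mult norm_power mult_mono mult_left_le)
  have "norm (char_power_series chi z) \<le> (\<Sum>n. of_nat n * z ^ n)"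
    unfolding char_power_series_def using s le by (intro norm_suminf_le) (auto simp: sums_iff)
  then show ?thesis using s by (simp add: sums_iff)
qed

lemma exp_diff_exp_minus_ge:
  fixes y :: real
  shows "y \<ge> 0 \<Longrightarrow> exp y - exp (- y) \<ge> 2 * y"
  using real_le_x_sinh[of y] by (simp add: exp_minus)

text \<open>The first two bounds, both from \<open>sinh y >= y\<close>, are the ones balanced in the
  Mellin integral. The third has the same order at 0 but decays exponentially; it secures
  integrability and holomorphy.\<close>

lemma exp_kernel_bounds:
  fixes v :: real
  assumes v: "v > 0"
  shows "exp (- v) / (1 - exp (- v))\<^sup>2 \<le> 1 / v\<^sup>2"
    and "exp (- v) / (1 - (exp (- v))\<^sup>2) \<le> 1 / (2 * v)"
    and "exp (- v) / (1 - (exp (- v))\<^sup>2) \<le> 2 * exp (- v / 2) / v"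
proof -
  have e1: "exp (- v) < 1" using v by simp
  have "exp (- v) / (1 - exp (- v))\<^sup>2 = 1 / (exp (v / 2) - exp (- (v / 2)))\<^sup>2"
  proof -
    have "1 - exp (- v) = exp (- (v / 2)) * (exp (v / 2) - exp (- (v / 2)))"
      by (simp add: algebra_simps flip: exp_add)
    moreover have "exp (- v) = (exp (- (v / 2)))\<^sup>2" by (simp add: power2_eq_square flip: exp_add)
    ultimately show ?thesis by (simp add: power_mult_distrib)
  qed
  also have "\<dots> \<le> 1 / v\<^sup>2"
    using exp_diff_exp_minus_ge[of "v / 2"] v by (intro divide_left_mono power_mono mult_pos_pos) auto
  finally show "exp (- v) / (1 - exp (- v))\<^sup>2 \<le> 1 / v\<^sup>2" .
  have eq: "exp (- v) / (1 - (exp (- v))\<^sup>2) = 1 / (exp v - exp (- v))"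
  proof -
    have "1 - (exp (- v))\<^sup>2 = exp (- v) * (exp v - exp (- v))"
      by (simp add: algebra_simps power2_eq_square flip: exp_add)
    then show ?thesis by simp
  qed
  show "exp (- v) / (1 - (exp (- v))\<^sup>2) \<le> 1 / (2 * v)"
    unfolding eq using exp_diff_exp_minus_ge[of v] v by (intro divide_left_mono mult_pos_pos) auto
  have "exp (v / 2) * (v / 2) \<le> exp (v / 2) * (exp (v / 2) - exp (- (3 * v / 2)))"
  proof (intro mult_left_mono)
    have "1 + v / 2 \<le> exp (v / 2)" by (rule exp_ge_add_one_self)
    moreover have "exp (- (3 * v / 2)) \<le> 1" using v by simp
    ultimately show "v / 2 \<le> exp (v / 2) - exp (- (3 * v / 2))" by linarith
  qed simp
  also have "\<dots> = exp v - exp (- v)" by (simp add: algebra_simps flip: exp_add)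
  finally have "1 / (exp v - exp (- v)) \<le> 1 / (exp (v / 2) * (v / 2))"
    using v by (intro divide_left_mono mult_pos_pos) auto
  also have "\<dots> = 2 * exp (- v / 2) / v" by (simp add: exp_minus field_simps)
  finally show "exp (- v) / (1 - (exp (- v))\<^sup>2) \<le> 2 * exp (- v / 2) / v" unfolding eq .
qed

section \<open>Dirichlet series\<close>

lemma divisor_pairs_bij:
  "bij_betw (\<lambda>(n, d). (d, n div d)) (SIGMA n:{1::nat..}. {d. d dvd n}) ({1..} \<times> {1..})"
  by (rule bij_betw_byWitness[where f' = "\<lambda>(d, m). (d * m, d)"])
     (auto simp: dvd_div_eq_0_iff Suc_le_eq intro: Nat.gr0I)

lemma has_sum_cong_imp:
  assumes "(f has_sum S) A" "\<And>x. x \<in> A \<Longrightarrow> f x = g x"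
  shows "(g has_sum S) A"
  using assms(1) has_sum_cong[of A f g S, OF assms(2)] by blast

lemma dirichlet_product_has_sum:
  fixes f g :: "nat \<Rightarrow> 'a :: {real_normed_field, banach}"
  assumes f: "(\<lambda>n. norm (f n)) summable_on {1..}" and g: "(\<lambda>n. norm (g n)) summable_on {1..}"
  shows "((\<lambda>n. \<Sum>d | d dvd n. f d * g (n div d)) has_sum (infsum f {1..} * infsum g {1..})) {1..}"
proof -
  have "(\<lambda>(d, m). norm (f d * g m)) summable_on {1..} \<times> {1..}"
  proof -
    have "(\<lambda>x. norm (f (fst x) * g (snd x))) summable_on (SIGMA d:{1..}. {1..})"
      unfolding Infinite_Sum.abs_summable_on_Sigma_iff
    proof (intro conjI ballI)
      show "(\<lambda>m. norm (f (fst (d, m)) * g (snd (d, m)))) summable_on {1..}" for d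
        using summable_on_cmult_right[OF g, of "norm (f d)"] by (simp add: norm_mult)
      have "(\<Sum>\<^sub>\<infinity>m\<in>{1..}. norm (f (fst (d, m)) * g (snd (d, m)))) = norm (f d) * (\<Sum>\<^sub>\<infinity>m\<in>{1..}. norm (g m))" for d
        using g by (simp add: norm_mult infsum_cmult_right)
      then show "(\<lambda>d. norm (\<Sum>\<^sub>\<infinity>m\<in>{1..}. norm (f (fst (d, m)) * g (snd (d, m))))) summable_on {1..}"
        using summable_on_cmult_left[OF f, of "\<Sum>\<^sub>\<infinity>m\<in>{1..}. norm (g m)"]
        by (simp add: infsum_nonneg abs_mult)
    qed
    then show ?thesis by (simp add: case_prod_unfold)
  qed
  then have "(\<lambda>(d, m). f d * g m) summable_on {1..} \<times> {1..}"
    by (intro Infinite_Sum.abs_summable_summable[of "\<lambda>(d, m). f d * g m"]) (simp add: case_prod_unfold)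
  then have "((\<lambda>(d, m). f d * g m) has_sum infsum (\<lambda>(d, m). f d * g m) ({1..} \<times> {1..})) ({1..} \<times> {1..})"
    by (rule has_sum_infsum)
  also have "infsum (\<lambda>(d, m). f d * g m) ({1..} \<times> {1..}) = infsum f {1..} * infsum g {1..}"
  proof -
    have "infsum (\<lambda>(d, m). f d * g m) ({1..} \<times> {1..}) = infsum (\<lambda>d. infsum (\<lambda>m. f d * g m) {1..}) {1..}"
      using infsum_Sigma_banach[OF \<open>(\<lambda>(d, m). f d * g m) summable_on {1..} \<times> {1..}\<close>] by simp
    also have "\<dots> = infsum f {1..} * infsum g {1..}"
      using Infinite_Sum.abs_summable_summable[OF f] Infinite_Sum.abs_summable_summable[OF g]
      by (simp add: infsum_cmult_right infsum_cmult_left)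
    finally show ?thesis .
  qed
  finally have "((\<lambda>(d, m). f d * g m) has_sum infsum f {1..} * infsum g {1..}) ({1..} \<times> {1..})" .
  then have "((\<lambda>(n, d). f d * g (n div d)) has_sum infsum f {1..} * infsum g {1..}) (SIGMA n:{1..}. {d. d dvd n})"
    by (subst (asm) has_sum_reindex_bij_betw[OF divisor_pairs_bij, symmetric]) (simp add: case_prod_unfold)
  then have hs: "((\<lambda>(n, d). f d * g (n div d)) has_sum infsum f {1..} * infsum g {1..}) (Sigma {1..} (\<lambda>n. {d. d dvd n}))" .
  show ?thesis
  proof (rule has_sum_SigmaD[OF hs])
    fix n :: nat assume "n \<in> {1..}"
    then show "((\<lambda>d. case (n, d) of (n, d) \<Rightarrow> f d * g (n div d)) has_sum (\<Sum>d | d dvd n. f d * g (n div d))) {d. d dvd n}"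
      by (simp add: has_sum_finite)
  qed
qed

text \<open>Its purpose is the inverse series: \<open>1 / L\<close> again has coefficients of
  modulus at most 1, and this yields the lower bound for \<open>|L|\<close> to the right of
  1.\<close>

definition moebius :: "nat \<Rightarrow> int" where
  "moebius n = (if squarefree n then (- 1) ^ card (prime_factors n) else 0)"

lemma abs_moebius_le_1: "\<bar>moebius n\<bar> \<le> 1"
  by (simp add: moebius_def power_abs)

lemma moebius_1 [simp]: "moebius (Suc 0) = 1"
  by (simp add: moebius_def)

text \<open>For a prime \<open>p\<close> dividing \<open>n\<close>, the map
  \<open>d \<mapsto> p d\<close> is a bijection from the squarefree divisors prime to
  \<open>p\<close> onto those divisible by \<open>p\<close>, and it reverses the sign.\<close>

lemma sum_moebius_divisors:
  assumes n: "n > 1"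
  shows "(\<Sum>d | d dvd n. moebius d) = 0"
proof -
  obtain p where p: "prime p" "p dvd n" using prime_factor_nat[of n] n by auto
  define A where "A = {d. d dvd n \<and> squarefree d \<and> \<not> p dvd d}"
  define B where "B = {d. d dvd n \<and> squarefree d \<and> p dvd d}"
  have fin: "finite {d. d dvd n}" using n by simp
  then have finAB: "finite A" "finite B" by (auto simp: A_def B_def elim: finite_subset[rotated])
  have cop: "coprime p d" if "d \<in> A" for d using p that by (auto simp: A_def prime_imp_coprime)
  have sq: "squarefree (p * d)" if "d \<in> A" for d
    using that by (intro squarefree_mult_coprime[OF cop[OF that] squarefree_prime[OF p(1)]]) (simp add: A_def)
  have mu: "moebius (p * d) = - moebius d" if "d \<in> A" for d
  proof -
    have sq: "squarefree (p * d)" by (rule sq[OF that])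
    have "d \<noteq> 0" using that n by (intro notI) (simp add: A_def)
    then have "prime_factors (p * d) = insert p (prime_factors d)"
      using p by (simp add: prime_factors_product prime_prime_factors)
    moreover have "p \<notin> prime_factors d" using that by (auto simp: A_def)
    ultimately show ?thesis using sq that by (simp add: moebius_def A_def)
  qed
  have im: "(\<lambda>d. p * d) ` A = B"
  proof
    show "(\<lambda>d. p * d) ` A \<subseteq> B"
    proof (rule image_subsetI)
      fix d assume d: "d \<in> A"
      then have "p * d dvd n" using p by (intro divides_mult cop) (auto simp: A_def)
      then show "p * d \<in> B" using sq[OF d] by (simp add: B_def)
    qed
    show "B \<subseteq> (\<lambda>d. p * d) ` A"
    proof
      fix e assume e: "e \<in> B"
      then obtain d where d: "e = p * d" by (auto simp: B_def)
      have "\<not> p dvd d"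
      proof
        assume "p dvd d"
        then have "p\<^sup>2 dvd e" by (simp add: d power2_eq_square)
        then have "is_unit p" using e by (auto simp: B_def squarefree_def)
        then show False using p by simp
      qed
      moreover have "squarefree d" using e squarefree_multD(2)[of p d] by (simp add: B_def d)
      moreover have "d dvd n" using e d by (auto simp: B_def dest: dvd_mult_right)
      ultimately show "e \<in> (\<lambda>d. p * d) ` A" using d by (auto simp: A_def)
    qed
  qed
  have "(\<Sum>d | d dvd n. moebius d) = (\<Sum>d\<in>A \<union> B. moebius d)"
    using fin by (intro sum.mono_neutral_right) (auto simp: A_def B_def moebius_def)
  also have "\<dots> = (\<Sum>d\<in>A. moebius d) + (\<Sum>d\<in>B. moebius d)"
    using finAB by (intro sum.union_disjoint) (auto simp: A_def B_def)
  also have "(\<Sum>d\<in>B. moebius d) = (\<Sum>d\<in>A. moebius (p * d))"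
    unfolding im[symmetric] using p by (subst sum.reindex) (auto simp: inj_on_def)
  also have "\<dots> = - (\<Sum>d\<in>A. moebius d)" by (simp add: mu sum_negf)
  finally show ?thesis by simp
qed

lemma norm_nat_powr: "n > 0 \<Longrightarrow> norm (complex_of_nat n powr s) = real n powr Re s"
  by (subst norm_powr_real_powr) auto

lemma summable_on_nat_powr:
  fixes x :: real
  assumes "x > 1"
  shows "(\<lambda>n. 1 / real n powr x) summable_on {1..}"
proof -
  have "summable (\<lambda>n. real n powr (- x))" using assms by (simp add: summable_real_powr_iff)
  then have "(\<lambda>n. real n powr (- x)) summable_on UNIV"
    by (intro norm_summable_imp_summable_on) simp
  then have "(\<lambda>n. real n powr (- x)) summable_on {1..}"
    by (rule summable_on_subset_banach) simp
  then show ?thesis by (simp add: powr_minus_divide)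
qed

lemma abs_summable_dirichlet:
  fixes a :: "nat \<Rightarrow> complex"
  assumes a: "\<And>n. n \<ge> 1 \<Longrightarrow> norm (a n) \<le> 1" and s: "Re s > 1"
  shows "(\<lambda>n. norm (a n / of_nat n powr s)) summable_on {1..}"
proof (rule Infinite_Sum.abs_summable_on_comparison_test'[OF summable_on_nat_powr[OF s]])
  fix n :: nat assume "n \<in> {1..}"
  then show "norm (a n / of_nat n powr s) \<le> 1 / real n powr Re s"
    using a[of n] by (simp add: norm_divide norm_nat_powr divide_right_mono)
qed

definition zeta_real :: "real \<Rightarrow> real" where
  "zeta_real x = (\<Sum>\<^sub>\<infinity>n\<in>{1::nat..}. 1 / real n powr x)"

definition dseries :: "(nat \<Rightarrow> complex) \<Rightarrow> complex \<Rightarrow> complex" where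
  "dseries a s = (\<Sum>\<^sub>\<infinity>n\<in>{1..}. a n / of_nat n powr s)"

lemma dseries_cong: "(\<And>n. n \<ge> 1 \<Longrightarrow> a n = b n) \<Longrightarrow> dseries a s = dseries b s"
  unfolding dseries_def by (rule infsum_cong) simp

lemma norm_dseries_le:
  assumes a: "\<And>n. n \<ge> 1 \<Longrightarrow> norm (a n) \<le> 1" and s: "Re s > 1"
  shows "norm (dseries a s) \<le> zeta_real (Re s)"
proof -
  note abs = abs_summable_dirichlet[OF a s]
  have "norm (dseries a s) \<le> (\<Sum>\<^sub>\<infinity>n\<in>{1..}. norm (a n / of_nat n powr s))"
    unfolding dseries_def by (rule norm_infsum_bound[OF abs])
  also have "\<dots> \<le> zeta_real (Re s)"
    unfolding zeta_real_def
  proof (rule infsum_mono[OF abs summable_on_nat_powr[OF s]])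
    fix n :: nat assume "n \<in> {1..}"
    then show "norm (a n / of_nat n powr s) \<le> 1 / real n powr Re s"
      using a[of n] by (simp add: norm_divide norm_nat_powr divide_right_mono)
  qed
  finally show ?thesis .
qed

lemma abs_summable_dirichlet_ln:
  fixes a :: "nat \<Rightarrow> complex"
  assumes a: "\<And>n. n \<ge> 1 \<Longrightarrow> norm (a n) \<le> ln n" and s: "Re s > 1"
  shows "(\<lambda>n. norm (a n / of_nat n powr s)) summable_on {1..}"
proof -
  \<comment> \<open>Half of the excess of \<open>Re s\<close> over 1 is spent on the logarithm,
    through \<open>ln n <= n^e / e\<close>; the other half keeps the series convergent.\<close>
  define e where "e = (Re s - 1) / 2"
  have e: "e > 0" "Re s - e > 1" using s by (auto simp: e_def field_simps)
  show ?thesis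
  proof (rule Infinite_Sum.abs_summable_on_comparison_test'[OF summable_on_cmult_right[OF summable_on_nat_powr[OF e(2)], of "1 / e"]])
    fix n :: nat assume n: "n \<in> {1..}"
    have "norm (a n) \<le> real n powr e / e" using a[of n] ln_powr_bound[of n e] n e by auto
    then have "norm (a n) / real n powr Re s \<le> real n powr e / e / real n powr Re s"
      by (intro divide_right_mono) auto
    also have "\<dots> = 1 / e * (1 / real n powr (Re s - e))"
      using n by (simp add: powr_diff)
    finally show "norm (a n / of_nat n powr s) \<le> 1 / e * (1 / real n powr (Re s - e))"
      using n by (simp add: norm_divide norm_nat_powr)
  qed
qed

lemma has_sum_atLeast_1_imp_sums:
  assumes "(f has_sum S) {1::nat..}"
  shows "(\<lambda>n. f (Suc n)) sums S"
proof (rule has_sum_imp_sums)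
  have "bij_betw Suc UNIV {1..}"
    by (rule bij_betw_byWitness[where f' = "\<lambda>n. n - 1"]) auto
  then show "((\<lambda>n. f (Suc n)) has_sum S) UNIV"
    using assms by (simp add: has_sum_reindex_bij_betw[of Suc])
qed

lemma infsum_atLeast_1_eq_suminf:
  fixes f :: "nat \<Rightarrow> 'a :: banach"
  assumes "(\<lambda>n. norm (f n)) summable_on {1..}"
  shows "infsum f {1..} = (\<Sum>n. f (Suc n))"
  using has_sum_atLeast_1_imp_sums[OF has_sum_infsum[OF Infinite_Sum.abs_summable_summable[OF assms]]]
  by (simp add: sums_iff)

lemma has_field_derivative_dseries:
  fixes a :: "nat \<Rightarrow> complex"
  assumes a: "\<And>n. n \<ge> 1 \<Longrightarrow> norm (a n) \<le> 1" and s: "Re s > 1"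
  shows "(dseries a has_field_derivative - dseries (\<lambda>n. of_real (ln n) * a n) s) (at s)"
proof -
  \<comment> \<open>The abscissa \<open>c\<close> lies strictly between 1 and \<open>Re s\<close>,
    so \<open>s\<close> is interior to the half-plane \<open>S\<close>, and \<open>e\<close> is
    small enough that the differentiated terms still have the summable majorant with exponent
    \<open>c - e > 1\<close> on all of \<open>S\<close>.\<close>
  define c where "c = (1 + Re s) / 2"
  define S where "S = {z. Re z \<ge> c}"
  define e where "e = (c - 1) / 2"
  have e: "e > 0" "c - e > 1" "c > 1" "Re s > c" using s by (auto simp: e_def c_def field_simps)
  define f where "f n z = a (Suc n) / of_nat (Suc n) powr z" for n z
  define f' where "f' n z = - of_real (ln (Suc n)) * a (Suc n) / of_nat (Suc n) powr z" for n z
  have abs1: "(\<lambda>n. norm (a n / of_nat n powr z)) summable_on {1..}" if "Re z > 1" for z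
    by (rule abs_summable_dirichlet[OF a that])
  have abs2: "(\<lambda>n. norm (of_real (ln n) * a n / of_nat n powr s)) summable_on {1..}"
  proof (rule abs_summable_dirichlet_ln[OF _ s])
    fix n :: nat assume "n \<ge> 1"
    then have "ln n * norm (a n) \<le> ln n * 1" using a[of n] by (intro mult_left_mono) auto
    then show "norm (of_real (ln n) * a n) \<le> ln n" using \<open>n \<ge> 1\<close> by (simp add: norm_mult)
  qed
  have "((\<lambda>z. \<Sum>n. f n z) has_field_derivative (\<Sum>n. f' n s)) (at s)"
  proof (rule has_field_derivative_series'(2))
    show "convex S" unfolding S_def by (rule convex_halfspace_Re_ge)
    show "s \<in> S" using e by (simp add: S_def)
    show "s \<in> interior S"
      by (rule interiorI[of "{z. Re z > c}"]) (use e in \<open>auto simp: S_def open_halfspace_Re_gt\<close>)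
    show "summable (\<lambda>n. f n s)"
      using has_sum_atLeast_1_imp_sums[OF has_sum_infsum[OF Infinite_Sum.abs_summable_summable[OF abs1[OF s]]]]
      unfolding f_def by (rule sums_summable)
    show "(f n has_field_derivative f' n z) (at z within S)" for n z
    proof -
      define l where "l = complex_of_real (ln (Suc n))"
      have "Ln (of_nat (Suc n)) = l"
        unfolding l_def using Ln_of_real[of "real (Suc n)"] by (simp del: of_nat_Suc)
      then have pw: "of_nat (Suc n) powr z = exp (z * l)" for z
        unfolding powr_def by (simp del: of_nat_Suc)
      have "((\<lambda>z. exp (- (z * l))) has_field_derivative exp (- (z * l)) * (- l)) (at z within S)"
        by (auto intro!: derivative_eq_intros)
      from DERIV_cmult[OF this, of "a (Suc n)"]
      have "((\<lambda>z. a (Suc n) / exp (z * l)) has_field_derivative - l * a (Suc n) / exp (z * l)) (at z within S)"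
        by (simp add: exp_minus divide_inverse mult_ac)
      then show ?thesis
        unfolding f_def f'_def pw l_def .
    qed
    show "uniformly_convergent_on S (\<lambda>n z. \<Sum>i<n. f' i z)"
    proof (rule Weierstrass_m_test')
      have "summable (\<lambda>n. real n powr (- (c - e)))" using e by (simp add: summable_real_powr_iff)
      then have "summable (\<lambda>n. real (Suc n) powr (- (c - e)))" by (rule summable_Suc_iff[THEN iffD2])
      then show "summable (\<lambda>n. 1 / e * real (Suc n) powr (- (c - e)))" by (rule summable_mult)
      fix n z assume z: "z \<in> S"
      have "norm (f' n z) = ln (Suc n) * norm (a (Suc n)) / real (Suc n) powr Re z"
        unfolding f'_def norm_divide norm_mult norm_minus_cancel by (simp add: norm_nat_powr del: of_nat_Suc)
      also have "\<dots> \<le> (real (Suc n) powr e / e * 1) / real (Suc n) powr c"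
        using z e a[of "Suc n"] ln_powr_bound[of "Suc n" e]
        by (intro frac_le mult_mono powr_mono) (auto simp: S_def)
      also have "\<dots> = 1 / e * real (Suc n) powr (- (c - e))"
        by (simp add: powr_diff del: of_nat_Suc)
      finally show "norm (f' n z) \<le> 1 / e * real (Suc n) powr (- (c - e))" .
    qed
  qed
  moreover have "(\<Sum>n. f' n s) = - dseries (\<lambda>n. of_real (ln n) * a n) s"
  proof -
    note hs = has_sum_atLeast_1_imp_sums[OF has_sum_infsum[OF Infinite_Sum.abs_summable_summable[OF abs2]]]
    from sums_minus[OF hs] show ?thesis unfolding f'_def dseries_def by (simp add: sums_iff)
  qed
  moreover have "(\<Sum>n. f n z) = dseries a z" if "z \<in> {z. Re z > 1}" for z
    unfolding f_def dseries_def using abs1 that by (intro infsum_atLeast_1_eq_suminf[symmetric]) auto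
  ultimately show ?thesis
    using has_field_derivative_transform_within_open[of "\<lambda>z. \<Sum>n. f n z" _ s "{z. Re z > 1}"] s
    by (simp add: open_halfspace_Re_gt)
qed

text \<open>Interpreted twice: with \<open>chi\<close> for the L-function and with the constant 1
  for zeta.\<close>

locale completely_multiplicative =
  fixes a :: "nat \<Rightarrow> complex"
  assumes mult: "a (m * n) = a m * a n" and one: "a 1 = 1" and bounded: "norm (a n) \<le> 1"
begin

lemma abs_summable_dseries: "Re s > 1 \<Longrightarrow> (\<lambda>n. norm (a n / of_nat n powr s)) summable_on {1..}"
  by (rule abs_summable_dirichlet) (simp_all add: bounded)

lemma abs_summable_mangoldt:
  assumes s: "Re s > 1"
  shows "(\<lambda>n. norm (mangoldt n * a n / of_nat n powr s)) summable_on {1..}"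
proof (rule abs_summable_dirichlet_ln[OF _ s])
  fix n :: nat assume "n \<ge> 1"
  then have "mangoldt n * norm (a n) \<le> ln n * 1"
    using bounded[of n] mangoldt_le[of n] by (intro mult_mono) (auto simp: mangoldt_nonneg)
  then show "norm (mangoldt n * a n) \<le> ln n" by (simp add: norm_mult)
qed

text \<open>Complete multiplicativity pulls \<open>a n\<close> out of the convolution, since
  \<open>a d * a (n div d) = a n\<close>. With \<open>b\<close> the von Mangoldt function the
  divisor sums become \<open>ln n\<close>, with \<open>b\<close> the Moebius function they become
  the indicator of 1.\<close>

lemma dseries_twist_product:
  assumes b: "(\<lambda>n. norm (b n * a n / of_nat n powr s)) summable_on {1..}" and s: "Re s > 1"
  shows "dseries (\<lambda>n. b n * a n) s * dseries a s = dseries (\<lambda>n. (\<Sum>d | d dvd n. b d) * a n) s"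
proof -
  have "(\<Sum>d | d dvd n. (b d * a d / of_nat d powr s) * (a (n div d) / of_nat (n div d) powr s)) =
      (\<Sum>d | d dvd n. b d) * a n / of_nat n powr s" if "n \<in> {1..}" for n
    unfolding sum_distrib_right sum_divide_distrib
  proof (intro sum.cong refl)
    fix d assume "d \<in> {d. d dvd n}"
    then obtain m where m: "n = d * m" by auto
    then have pos: "d > 0" "m > 0" using that by (auto intro: Nat.gr0I)
    have "complex_of_nat n powr s = of_nat d powr s * of_nat m powr s"
      unfolding m of_nat_mult by (rule powr_times_real) auto
    then show "(b d * a d / of_nat d powr s) * (a (n div d) / of_nat (n div d) powr s) = b d * a n / of_nat n powr s"
      using pos by (simp add: m mult)
  qed
  from has_sum_cong_imp[OF dirichlet_product_has_sum[OF b abs_summable_dseries[OF s]] this]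
  show ?thesis unfolding dseries_def by (rule infsumI[symmetric])
qed

lemma mangoldt_times_dseries:
  assumes s: "Re s > 1"
  shows "dseries (\<lambda>n. mangoldt n * a n) s * dseries a s = dseries (\<lambda>n. of_real (ln n) * a n) s"
  unfolding dseries_twist_product[OF abs_summable_mangoldt[OF s] s]
  by (rule dseries_cong) (simp add: mangoldt_sum)

lemma norm_moebius_mult_le: "norm (of_int (moebius n) * a n) \<le> 1"
proof -
  have "\<bar>real_of_int (moebius n)\<bar> \<le> 1" using abs_moebius_le_1[of n] by linarith
  then show ?thesis using bounded[of n] by (simp add: norm_mult mult_le_one)
qed

lemma moebius_times_dseries:
  assumes s: "Re s > 1"
  shows "dseries (\<lambda>n. of_int (moebius n) * a n) s * dseries a s = 1"
proof -
  have "dseries (\<lambda>n. of_int (moebius n) * a n) s * dseries a s =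
      dseries (\<lambda>n. (\<Sum>d | d dvd n. of_int (moebius d)) * a n) s"
    by (rule dseries_twist_product[OF abs_summable_dirichlet[OF norm_moebius_mult_le s] s])
  also have "\<dots> = dseries (\<lambda>n. if n = 1 then 1 else 0) s"
  proof (rule dseries_cong)
    fix n :: nat assume n: "n \<ge> 1"
    have "(\<Sum>d | d dvd n. of_int (moebius d)) = (of_int (\<Sum>d | d dvd n. moebius d) :: complex)" by simp
    then show "(\<Sum>d | d dvd n. of_int (moebius d)) * a n = (if n = 1 then 1 else 0)"
      using sum_moebius_divisors[of n] n one by (cases "n = 1") auto
  qed
  also have "\<dots> = (\<Sum>\<^sub>\<infinity>n\<in>{1::nat}. (if n = 1 then 1 else 0) / complex_of_nat n powr s)"
    unfolding dseries_def by (rule infsum_cong_neutral) auto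
  finally show ?thesis by simp
qed

text \<open>The Moebius twist is the reciprocal series and obeys the same trivial bound by
  zeta.\<close>

lemma norm_dseries_ge:
  assumes s: "Re s > 1"
  shows "1 \<le> norm (dseries a s) * zeta_real (Re s)"
proof -
  have "norm (dseries (\<lambda>n. of_int (moebius n) * a n) s) * norm (dseries a s) \<le> zeta_real (Re s) * norm (dseries a s)"
    by (intro mult_right_mono norm_dseries_le norm_moebius_mult_le s) auto
  moreover have "norm (dseries (\<lambda>n. of_int (moebius n) * a n) s) * norm (dseries a s) = 1"
    by (simp only: moebius_times_dseries[OF s] norm_one flip: norm_mult)
  ultimately show ?thesis by (simp add: mult.commute)
qed

end

section \<open>The zeta function to the right of 1\<close>

lemma powr_above_tangent:
  fixes x y p :: real
  assumes "x > 0" "y > 0" "p < 0"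
  shows "x powr p \<ge> y powr p + p * y powr (p - 1) * (x - y)"
proof -
  have "ln (x / y) \<le> x / y - 1" using assms by (intro ln_le_minus_one) simp
  then have "p * ln (x / y) \<ge> p * (x / y - 1)" using assms by (intro mult_left_mono_neg) auto
  moreover have "(x / y) powr p = exp (p * ln (x / y))" using assms by (simp add: powr_def)
  moreover have "exp (p * ln (x / y)) \<ge> 1 + p * ln (x / y)" by (rule exp_ge_add_one_self)
  ultimately have "(x / y) powr p \<ge> 1 + p * (x / y - 1)" by linarith
  then have "y powr p * (1 + p * (x / y - 1)) \<le> y powr p * (x / y) powr p"
    by (intro mult_left_mono) auto
  also have "\<dots> = x powr p" using assms by (simp add: powr_divide)
  finally show ?thesis using assms by (simp add: powr_diff field_simps)
qed

lemma DERIV_powr_affine: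
  fixes y c t p :: real
  assumes "y + c * t > 0"
  shows "((\<lambda>t. (y + c * t) powr p) has_real_derivative p * (y + c * t) powr (p - 1) * c) (at t)"
  by (rule DERIV_chain2[where f = "\<lambda>z. z powr p" and g = "\<lambda>t. y + c * t", OF has_real_derivative_powr[OF assms]])
     (auto intro!: derivative_eq_intros)

text \<open>The right side is the integral of the convex function \<open>x^(- 1 - u)\<close> over
  \<open>[y - 1/2, y + 1/2]\<close>, so this is the midpoint half of the Hermite-Hadamard
  inequality. Taking the half-width \<open>t\<close> as variable, the derivative of the difference
  is a second difference, nonnegative by convexity.\<close>

lemma nat_powr_midpoint:
  fixes y u :: real
  assumes y: "y > 1/2" and u: "u > 0"
  shows "y powr (- 1 - u) \<le> (y - 1/2) powr (- u) / u - (y + 1/2) powr (- u) / u"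
proof -
  define h where "h t = (y - t) powr (- u) / u - (y + t) powr (- u) / u - 2 * t * y powr (- 1 - u)" for t
  have "h 0 \<le> h (1/2)"
  proof (rule DERIV_nonneg_imp_nondecreasing[where f = h])
    fix t :: real assume t: "0 \<le> t" "t \<le> 1/2"
    then have pos: "y - t > 0" "y + t > 0" using y by linarith+
    have "(h has_real_derivative ((y - t) powr (- u - 1) + (y + t) powr (- u - 1) - 2 * y powr (- 1 - u))) (at t)"
    proof -
      have 1: "((\<lambda>t. (y - t) powr (- u)) has_real_derivative u * (y - t) powr (- u - 1)) (at t)"
        using DERIV_powr_affine[of y "- 1" t "- u"] pos by simp
      have 2: "((\<lambda>t. (y + t) powr (- u)) has_real_derivative - u * (y + t) powr (- u - 1)) (at t)"
        using DERIV_powr_affine[of y 1 t "- u"] pos by simp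
      have 3: "((\<lambda>t. 2 * t * y powr (- 1 - u)) has_real_derivative 2 * y powr (- 1 - u)) (at t)"
        by (auto intro!: derivative_eq_intros)
      show ?thesis
        unfolding h_def
        using DERIV_diff[OF DERIV_diff[OF DERIV_cdivide[OF 1, of u] DERIV_cdivide[OF 2, of u]] 3] u by simp
    qed
    moreover have "(y - t) powr (- u - 1) + (y + t) powr (- u - 1) - 2 * y powr (- 1 - u) \<ge> 0"
    proof -
      have e: "- u - 1 = - 1 - u" by simp
      have "- u - 1 < 0" "y > 0" using u y by auto
      note p = powr_above_tangent[OF pos(1) this(2,1)] powr_above_tangent[OF pos(2) this(2,1)]
      have "2 * y powr (- u - 1) \<le> (y - t) powr (- u - 1) + (y + t) powr (- u - 1)"
        using p by (simp add: algebra_simps)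
      then show ?thesis by (simp add: e)
    qed
    ultimately show "\<exists>d. (h has_real_derivative d) (at t) \<and> 0 \<le> d" by blast
  qed simp
  then show ?thesis by (simp add: h_def)
qed

text \<open>The trapezoid half of Hermite-Hadamard, for the same function over
  \<open>[y, y + 1]\<close>; here the length \<open>t\<close> of the interval is the variable, and
  the derivative is nonnegative by the tangent inequality at \<open>y + t\<close>.\<close>

lemma nat_powr_trapezoid:
  fixes y u :: real
  assumes y: "y > 0" and u: "u > 0"
  shows "y powr (- u) / u - (y + 1) powr (- u) / u \<le> (y powr (- 1 - u) + (y + 1) powr (- 1 - u)) / 2"
proof -
  define h where "h t = t / 2 * (y powr (- 1 - u) + (y + t) powr (- 1 - u)) - y powr (- u) / u + (y + t) powr (- u) / u" for t
  have "h 0 \<le> h 1"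
  proof (rule DERIV_nonneg_imp_nondecreasing[where f = h])
    fix t :: real assume t: "0 \<le> t" "t \<le> 1"
    then have pos: "y + t > 0" using y by linarith
    have "(h has_real_derivative ((y powr (- 1 - u) + (y + t) powr (- 1 - u)) / 2 + t / 2 * ((- 1 - u) * (y + t) powr (- 1 - u - 1)) - (y + t) powr (- 1 - u))) (at t)"
    proof -
      have e: "- u - 1 = - 1 - u" by simp
      have 1: "((\<lambda>t. (y + t) powr (- 1 - u)) has_real_derivative (- 1 - u) * (y + t) powr (- 1 - u - 1)) (at t)"
        using DERIV_powr_affine[of y 1 t "- 1 - u"] pos by simp
      have 2: "((\<lambda>t. (y + t) powr (- u)) has_real_derivative - u * (y + t) powr (- 1 - u)) (at t)"
        using DERIV_powr_affine[of y 1 t "- u", unfolded e] pos by simp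
      have 3: "((\<lambda>t. t / 2) has_real_derivative 1 / 2) (at t)"
        by (auto intro!: derivative_eq_intros)
      have 4: "((\<lambda>t. y powr (- 1 - u) + (y + t) powr (- 1 - u)) has_real_derivative (- 1 - u) * (y + t) powr (- 1 - u - 1)) (at t)"
        using DERIV_add[OF DERIV_const 1] by simp
      show ?thesis
        unfolding h_def
        by (rule DERIV_cong[OF DERIV_add[OF DERIV_diff[OF DERIV_mult[OF 3 4] DERIV_const] DERIV_cdivide[OF 2, of u]]])
           (use u in \<open>simp add: field_simps\<close>)
    qed
    moreover have "(y powr (- 1 - u) + (y + t) powr (- 1 - u)) / 2 + t / 2 * ((- 1 - u) * (y + t) powr (- 1 - u - 1)) - (y + t) powr (- 1 - u) \<ge> 0"
    proof -
      have "- 1 - u < 0" using u by auto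
      from powr_above_tangent[OF y pos this] show ?thesis by (simp add: field_simps)
    qed
    ultimately show "\<exists>d. (h has_real_derivative d) (at t) \<and> 0 \<le> d" by blast
  qed simp
  then have "0 \<le> (y powr (- 1 - u) + (y + 1) powr (- 1 - u)) / 2 - y powr (- u) / u + (y + 1) powr (- u) / u"
    by (simp add: h_def)
  then show ?thesis by linarith
qed

lemma zeta_real_sums:
  assumes "x > 1"
  shows "(\<lambda>n. real (Suc n) powr (- x)) sums zeta_real x"
  using has_sum_atLeast_1_imp_sums[OF has_sum_infsum[OF summable_on_nat_powr[OF assms]]]
  by (simp add: zeta_real_def powr_minus_divide)

text \<open>The term at 1 is kept exactly, and the midpoint estimates from 2 on telescope to the
  integral from 3/2.\<close>

lemma zeta_real_upper:
  assumes u: "u > 0"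
  shows "zeta_real (1 + u) \<le> 1 + (3/2) powr (- u) / u"
proof -
  have "(\<Sum>n<m. real (Suc n) powr (- 1 - u)) \<le> 1 + (3/2) powr (- u) / u - (real m + 1/2) powr (- u) / u" if "m \<ge> 1" for m
    using that
  proof (induction m rule: dec_induct)
    case (step m)
    have "real (Suc m) powr (- 1 - u) \<le> (real (Suc m) - 1/2) powr (- u) / u - (real (Suc m) + 1/2) powr (- u) / u"
      by (rule nat_powr_midpoint) (use u in auto)
    then show ?case using step by (simp add: algebra_simps)
  qed simp
  then have le: "(\<Sum>n<m. real (Suc n) powr (- 1 - u)) \<le> 1 + (3/2) powr (- u) / u" for m
  proof (cases "m \<ge> 1")
    case True
    have "(real m + 1/2) powr (- u) / u \<ge> 0" using u by simp
    then show ?thesis using \<open>\<And>m. m \<ge> 1 \<Longrightarrow> _\<close>[OF True] by linarith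
  next
    case False
    then have "m = 0" by simp
    moreover have "0 \<le> 1 + (3/2) powr (- u) / u" using u by simp
    ultimately show ?thesis by simp
  qed
  have s: "(\<lambda>n. real (Suc n) powr (- 1 - u)) sums zeta_real (1 + u)"
    using zeta_real_sums[of "1 + u"] u by (simp add: algebra_simps)
  then have "zeta_real (1 + u) = (\<Sum>n. real (Suc n) powr (- 1 - u))" by (simp only: sums_iff)
  also have "\<dots> \<le> 1 + (3/2) powr (- u) / u"
    using le s by (intro suminf_le_const) (auto simp only: sums_iff)
  finally show ?thesis .
qed

text \<open>The trapezoid estimates on \<open>[n, n + 1]\<close> for \<open>n >= 2\<close> telescope
  to the integral from 2; they use only half of the term at 2, so its other half remains.\<close>

lemma zeta_real_lower:
  assumes u: "u > 0"
  shows "zeta_real (1 + u) \<ge> 1 + 2 powr (- 1 - u) / 2 + 2 powr (- u) / u"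
proof -
  have ge: "(\<Sum>n<m. real (Suc n) powr (- 1 - u)) \<ge> 1 + 2 powr (- 1 - u) / 2 + 2 powr (- u) / u - real m powr (- u) / u" if "m \<ge> 2" for m
  proof -
    have "(\<Sum>n<m. real (Suc n) powr (- 1 - u)) \<ge> 1 + 2 powr (- 1 - u) / 2 + 2 powr (- u) / u + real m powr (- 1 - u) / 2 - real m powr (- u) / u"
      using that
    proof (induction m rule: dec_induct)
      case (step m)
      have "real m powr (- u) / u - (real m + 1) powr (- u) / u \<le> (real m powr (- 1 - u) + (real m + 1) powr (- 1 - u)) / 2"
        by (rule nat_powr_trapezoid) (use step u in auto)
      then show ?case using step by (simp add: algebra_simps add_divide_distrib)
    qed (simp add: numeral_2_eq_2)
    moreover have "real m powr (- 1 - u) / 2 \<ge> 0" by simp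
    ultimately show ?thesis by linarith
  qed
  have s: "(\<lambda>n. real (Suc n) powr (- 1 - u)) sums zeta_real (1 + u)"
    using zeta_real_sums[of "1 + u"] u by (simp add: algebra_simps)
  have "(\<lambda>m. real m powr (- u)) \<longlonglongrightarrow> 0"
    using u by (intro tendsto_neg_powr filterlim_real_sequentially) auto
  then have "(\<lambda>m. 1 + 2 powr (- 1 - u) / 2 + 2 powr (- u) / u - real m powr (- u) / u) \<longlonglongrightarrow> 1 + 2 powr (- 1 - u) / 2 + 2 powr (- u) / u - 0 / u"
    by (intro tendsto_intros) (use u in auto)
  moreover have "(\<lambda>m. \<Sum>n<m. real (Suc n) powr (- 1 - u)) \<longlonglongrightarrow> zeta_real (1 + u)"
    using s by (simp only: sums_def)
  ultimately show ?thesis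
    using tendsto_le[OF sequentially_bot] ge
    by (metis (mono_tags, lifting) diff_zero div_0 eventually_sequentially)
qed

text \<open>The function \<open>f\<close> decreases from \<open>e\<close> on, hence from 3, so each
  term beyond the third is below the integral over the preceding unit interval. \<open>H\<close> is
  the tail integral of \<open>f\<close>; the terms at 2 and 3 are kept exactly and the one at 1 is
  0.\<close>

lemma ln_div_powr_sum_upper:
  assumes u: "u > 0"
  shows "(\<Sum>\<^sub>\<infinity>n\<in>{1::nat..}. ln (real n) / real n powr (1 + u)) \<le>
    ln 2 * 2 powr (- 1 - u) + ln 3 * 3 powr (- 1 - u) + 3 powr (- u) * (ln 3 / u + 1 / u\<^sup>2)"
proof -
  define f where "f y = ln y * y powr (- 1 - u)" for y :: real
  define H where "H y = y powr (- u) * (ln y / u + 1 / u\<^sup>2)" for y :: real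
  have f_decr: "f y \<le> f x" if "3 \<le> x" "x \<le> y" for x y
  proof (rule DERIV_nonpos_imp_nonincreasing[OF that(2)])
    fix t assume t: "x \<le> t" "t \<le> y"
    then have t3: "t \<ge> 3" "t > 0" using that by auto
    have "exp 1 \<le> t" using t3 exp_le by linarith
    then have "ln t \<ge> 1" using t3 by (simp add: ln_ge_iff)
    then have "t powr (- 2 - u) * (1 - (1 + u) * ln t) \<le> 0"
      using u by (intro mult_nonneg_nonpos) (auto intro: order.trans[OF _ mult_mono[of 1 "1 + u" 1 "ln t"]])
    moreover have "(f has_real_derivative t powr (- 2 - u) * (1 - (1 + u) * ln t)) (at t)"
    proof -
      have "(f has_real_derivative (1 / t * t powr (- 1 - u) + ((- 1 - u) * t powr (- 1 - u - 1)) * ln t)) (at t)"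
        unfolding f_def
        using DERIV_mult[OF DERIV_ln_divide[OF t3(2)] has_real_derivative_powr[OF t3(2), of "- 1 - u"]] by simp
      moreover have "1 / t * t powr (- 1 - u) = t powr (- 2 - u)"
        using t3 by (simp add: powr_diff powr_minus field_simps power2_eq_square)
      moreover have "- 1 - u - 1 = - 2 - u" by simp
      ultimately have "(f has_real_derivative t powr (- 2 - u) + (- 1 - u) * t powr (- 2 - u) * ln t) (at t)" by (simp only:)
      then show ?thesis by (simp add: algebra_simps)
    qed
    ultimately show "\<exists>d. (f has_real_derivative d) (at t) \<and> d \<le> 0" by blast
  qed
  have H_deriv: "(H has_real_derivative - f t) (at t)" if "t > 0" for t
  proof -
    have "(H has_real_derivative ((- u) * t powr (- u - 1) * (ln t / u + 1 / u\<^sup>2) + (1 / t / u) * t powr (- u))) (at t)"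
    proof -
      have 1: "((\<lambda>t. ln t / u + 1 / u\<^sup>2) has_real_derivative 1 / t / u) (at t)"
        using DERIV_add[OF DERIV_cdivide[OF DERIV_ln_divide[OF that], of u] DERIV_const] by simp
      show ?thesis unfolding H_def
        using DERIV_mult[OF has_real_derivative_powr[OF that, of "- u"] 1] by simp
    qed
    moreover have "(- u) * t powr (- u - 1) * (ln t / u + 1 / u\<^sup>2) + (1 / t / u) * t powr (- u) = - f t"
    proof -
      have "- u - 1 = - 1 - u" by simp
      then have e1: "t powr (- u - 1) = t powr (- 1 - u)" by (simp only:)
      have e2: "1 / t * t powr (- u) = t powr (- 1 - u)"
        using that by (simp add: powr_diff powr_minus field_simps)
      have "(1 / t / u) * t powr (- u) = (1 / t * t powr (- u)) / u" by simp
      then have e3: "(1 / t / u) * t powr (- u) = t powr (- 1 - u) / u" by (simp only: e2)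
      then show ?thesis unfolding e1 e3 f_def using u by (simp add: field_simps power2_eq_square)
    qed
    ultimately show ?thesis by simp
  qed
  have step: "f (real (Suc n)) \<le> H (real n) - H (real (Suc n))" if "n \<ge> 3" for n
  proof -
    have "\<exists>z>real n. z < real (Suc n) \<and> H (real (Suc n)) - H (real n) = (real (Suc n) - real n) * (- f z)"
      by (rule MVT2) (use H_deriv that in auto)
    then obtain z where z: "real n < z" "z < real (Suc n)" "H (real (Suc n)) - H (real n) = (real (Suc n) - real n) * (- f z)"
      by blast
    then have "f z = H (real n) - H (real (Suc n))" by simp
    moreover have "f (real (Suc n)) \<le> f z" using z that by (intro f_decr) auto
    ultimately show ?thesis by simp
  qed
  have Hnn: "H (real m) \<ge> 0" if "m \<ge> 1" for m using that u by (simp add: H_def)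
  have part: "(\<Sum>n<m. f (real (Suc n))) \<le> f 2 + f 3 + H 3 - H (real m)" if "m \<ge> 3" for m
    using that
  proof (induction m rule: dec_induct)
    case base
    show ?case by (simp add: f_def numeral_3_eq_3)
  next
    case (step m)
    then show ?case using \<open>\<And>n. n \<ge> 3 \<Longrightarrow> _\<close>[of m] by simp
  qed
  have fnn: "f (real (Suc n)) \<ge> 0" for n by (simp add: f_def)
  have le: "(\<Sum>n<m. f (real (Suc n))) \<le> f 2 + f 3 + H 3" for m
  proof -
    have "(\<Sum>n<m. f (real (Suc n))) \<le> (\<Sum>n<max m 3. f (real (Suc n)))"
      using fnn by (intro sum_mono2) auto
    also have "\<dots> \<le> f 2 + f 3 + H 3 - H (real (max m 3))" by (rule part) simp
    also have "\<dots> \<le> f 2 + f 3 + H 3" using Hnn[of "max m 3"] by simp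
    finally show ?thesis .
  qed
  have "(\<lambda>n. norm (complex_of_real (ln (real n)) / of_nat n powr of_real (1 + u))) summable_on {1..}"
    by (rule abs_summable_dirichlet_ln) (use u in auto)
  then have "(\<lambda>n. ln (real n) / real n powr (1 + u)) summable_on {1..}"
    by (rule summable_on_cong[THEN iffD1, rotated]) (auto simp: norm_divide norm_nat_powr)
  from has_sum_atLeast_1_imp_sums[OF has_sum_infsum[OF this]]
  have s: "(\<lambda>n. f (real (Suc n))) sums (\<Sum>\<^sub>\<infinity>n\<in>{1::nat..}. ln (real n) / real n powr (1 + u))"
    by (simp add: f_def powr_diff powr_minus powr_add field_simps)
  then have "(\<Sum>\<^sub>\<infinity>n\<in>{1::nat..}. ln (real n) / real n powr (1 + u)) = (\<Sum>n. f (real (Suc n)))" by (simp only: sums_iff)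
  also have "\<dots> \<le> f 2 + f 3 + H 3"
    using le s by (intro suminf_le_const) (auto simp only: sums_iff)
  finally show ?thesis by (simp add: f_def H_def)
qed

section \<open>Mellin transforms\<close>

lemma Gamma_integral_scaled:
  fixes z :: complex
  assumes z: "Re z > 0" and a: "a > 0"
  shows "set_integrable lborel {0<..} (\<lambda>t. of_real t powr (z - 1) * of_real (exp (- a * t)))"
    and "(LINT t:{0<..}|lborel. of_real t powr (z - 1) * of_real (exp (- a * t))) = Gamma z * of_real a powr (- z)"
proof -
  define f where "f b t = indicator {0<..} t *\<^sub>R (complex_of_real t powr (z - 1) * of_real (exp (- b * t)))" for b t :: real
  have meas: "f b \<in> borel_measurable lborel" for b
  proof -
    have "f b \<in> borel_measurable borel"
      unfolding f_def by (rule borel_measurable_continuous_on_indicator) (auto intro!: continuous_intros)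
    then show ?thesis by simp
  qed
  have int: "integrable lborel (f b)" if "b > 0" for b
  proof -
    have "set_integrable lebesgue {0<..} (\<lambda>t. complex_of_real t powr (z - 1) / of_real (exp (b * t)))"
      by (rule absolutely_integrable_Gamma_integral[OF z that])
    moreover have "(\<lambda>t. indicator {0<..} t *\<^sub>R (complex_of_real t powr (z - 1) / of_real (exp (b * t)))) = f b"
      by (simp add: fun_eq_iff f_def exp_minus field_simps)
    ultimately have "integrable lebesgue (f b)"
      by (simp add: set_integrable_def)
    then show ?thesis using integrable_completion[OF meas] by blast
  qed
  show "set_integrable lborel {0<..} (\<lambda>t. of_real t powr (z - 1) * of_real (exp (- a * t)))"
    using int[OF a] by (simp add: set_integrable_def f_def[abs_def])
  have one: "integral\<^sup>L lborel (f 1) = Gamma z"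
  proof -
    have si: "set_integrable lebesgue {0<..} (\<lambda>t. complex_of_real t powr (z - 1) / of_real (exp (1 * t)))"
      by (rule absolutely_integrable_Gamma_integral[OF z]) simp
    have "integral\<^sup>L lborel (f 1) = integral\<^sup>L lebesgue (f 1)"
      using integral_completion[OF meas] by simp
    also have "\<dots> = (LINT t:{0<..}|lebesgue. complex_of_real t powr (z - 1) / of_real (exp (1 * t)))"
      by (simp add: set_lebesgue_integral_def f_def[abs_def] exp_minus divide_inverse)
    also have "\<dots> = integral {0<..} (\<lambda>t. complex_of_real t powr (z - 1) / of_real (exp (1 * t)))"
      by (rule set_lebesgue_integral_eq_integral(2)[OF si])
    also have "\<dots> = Gamma z"
      using Gamma_integral_complex'[OF z] by (simp add: integral_unique)
    finally show ?thesis .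
  qed
  have "integral\<^sup>L lborel (f 1) = a *\<^sub>R integral\<^sup>L lborel (\<lambda>x. f 1 (0 + a * x))"
    using lborel_integral_real_affine[of a "f 1" 0] a by simp
  also have "(\<lambda>x. f 1 (0 + a * x)) = (\<lambda>x. of_real a powr (z - 1) * f a x)"
  proof
    fix x :: real
    show "f 1 (0 + a * x) = of_real a powr (z - 1) * f a x"
    proof (cases "x > 0")
      case True
      then have "complex_of_real (a * x) powr (z - 1) = of_real a powr (z - 1) * of_real x powr (z - 1)"
        using a by (simp add: powr_times_real)
      then show ?thesis using True a by (simp add: f_def)
    next
      case False
      then show ?thesis using a by (simp add: f_def zero_less_mult_iff)
    qed
  qed
  finally have "Gamma z = a *\<^sub>R (of_real a powr (z - 1) * integral\<^sup>L lborel (f a))"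
    using one by simp
  also have "\<dots> = of_real a powr z * integral\<^sup>L lborel (f a)"
    using a by (simp add: scaleR_conv_of_real powr_diff)
  finally have "integral\<^sup>L lborel (f a) = Gamma z * of_real a powr (- z)"
    using a by (simp add: powr_minus field_simps)
  then show "(LINT t:{0<..}|lborel. of_real t powr (z - 1) * of_real (exp (- a * t))) = Gamma z * of_real a powr (- z)"
    by (simp add: set_lebesgue_integral_def f_def[abs_def])
qed

lemma integral_powr_exp_real:
  fixes x :: real
  assumes x: "x > 0" and a: "a > 0"
  shows "set_integrable lborel {0<..} (\<lambda>t. t powr (x - 1) * exp (- a * t))"
    and "(LINT t:{0<..}|lborel. t powr (x - 1) * exp (- a * t)) = Gamma x * a powr (- x)"
proof -
  have eq: "indicator {0<..} t *\<^sub>R (complex_of_real t powr (of_real x - 1) * of_real (exp (- a * t))) =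
      complex_of_real (indicator {0<..} t *\<^sub>R (t powr (x - 1) * exp (- a * t)))" for t
  proof (cases "t > 0")
    case True
    then have "complex_of_real t powr (of_real x - 1) = of_real (t powr (x - 1))"
      by (metis of_real_1 of_real_diff powr_of_real less_imp_le)
    then show ?thesis using True by simp
  qed simp
  have *: "Re (complex_of_real x) > 0" using x by simp
  show "set_integrable lborel {0<..} (\<lambda>t. t powr (x - 1) * exp (- a * t))"
    using Gamma_integral_scaled(1)[OF * a] unfolding set_integrable_def eq
    by (simp only: complex_of_real_integrable_eq)
  have "complex_of_real (LINT t:{0<..}|lborel. t powr (x - 1) * exp (- a * t)) = Gamma (of_real x) * of_real a powr (- of_real x)"
    using Gamma_integral_scaled(2)[OF * a] unfolding set_lebesgue_integral_def eq
    by (simp only: integral_complex_of_real)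
  also have "\<dots> = of_real (Gamma x * a powr (- x))"
    using a x by (simp add: Gamma_complex_of_real powr_of_real flip: of_real_minus)
  finally show "(LINT t:{0<..}|lborel. t powr (x - 1) * exp (- a * t)) = Gamma x * a powr (- x)"
    by (simp only: of_real_eq_iff)
qed

text \<open>The exponent is \<open>s\<close>, so this is the usual Mellin transform at
  \<open>s + 1\<close>: the weight \<open>n\<close> in the power series lowers the exponent of
  \<open>n\<close> by one, and the result is \<open>\<Gamma>(s + 1) L(s)\<close>.\<close>

definition mellin :: "(real \<Rightarrow> complex) \<Rightarrow> complex \<Rightarrow> complex" where
  "mellin P s = (LINT v:{0<..}|lborel. P v * of_real v powr s)"

lemma mellin_dirichlet:
  fixes a :: "nat \<Rightarrow> complex" and s :: complex
  assumes a: "\<And>n. norm (a n) \<le> 1" and s: "Re s > 1"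
  shows "(\<lambda>n. of_nat n * a n * (Gamma (s + 1) * of_nat n powr (- (s + 1)))) sums
    mellin (\<lambda>v. \<Sum>n. of_nat n * a n * of_real (exp (- v)) ^ n) s"
proof -
  define f where "f n v = indicator {0<..} v *\<^sub>R (of_nat n * a n * (of_real v powr s * of_real (exp (- real n * v))))"
    for n :: nat and v :: real
  have sz: "Re (s + 1) > 0" "s = (s + 1) - 1" using s by auto
  have int: "integrable lborel (f n)" and val: "integral\<^sup>L lborel (f n) = of_nat n * a n * (Gamma (s + 1) * of_nat n powr (- (s + 1)))" for n
  proof -
    have "integrable lborel (f n) \<and> integral\<^sup>L lborel (f n) = of_nat n * a n * (Gamma (s + 1) * of_nat n powr (- (s + 1)))"
    proof (cases "n = 0")
      case True
      then have "f n = (\<lambda>_. 0)" by (simp add: f_def fun_eq_iff)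
      then show ?thesis using True by simp
    next
      case False
      then have n: "real n > 0" by simp
      note G = Gamma_integral_scaled[OF sz(1) n]
      define k where "k v = indicator {0<..} v *\<^sub>R (complex_of_real v powr (s + 1 - 1) * of_real (exp (- real n * v)))" for v :: real
      have f: "f n = (\<lambda>v. of_nat n * a n * k v)"
        by (simp add: f_def k_def fun_eq_iff)
      have "integrable lborel k" "integral\<^sup>L lborel k = Gamma (s + 1) * of_nat n powr (- (s + 1))"
        using G unfolding k_def[abs_def] set_integrable_def set_lebesgue_integral_def by simp_all
      then show ?thesis unfolding f by simp
    qed
    then show "integrable lborel (f n)" "integral\<^sup>L lborel (f n) = of_nat n * a n * (Gamma (s + 1) * of_nat n powr (- (s + 1)))"
      by auto
  qed
  have nrm: "norm (f n v) \<le> real n * (indicator {0<..} v *\<^sub>R (v powr Re s * exp (- real n * v)))" for n v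
  proof (cases "v > 0")
    case True
    have "real n * norm (a n) * (v powr Re s * exp (- real n * v)) \<le> real n * 1 * (v powr Re s * exp (- real n * v))"
      using a by (intro mult_right_mono mult_left_mono) auto
    then show ?thesis using True by (simp add: f_def norm_mult norm_powr_real_powr)
  next
    case False
    then show ?thesis by (simp add: f_def)
  qed
  \<comment> \<open>This is the hypothesis for exchanging sum and integral: the integral of the n-th
    norm is of order \<open>n^(- Re s)\<close>, summable because \<open>Re s > 1\<close>.\<close>
  have sums: "summable (\<lambda>n. \<integral>v. norm (f n v) \<partial>lborel)"
  proof (rule summable_comparison_test')
    show "summable (\<lambda>n. Gamma (Re s + 1) * real n powr (- Re s))"
      using s by (intro summable_mult) (simp add: summable_real_powr_iff)
    fix n :: nat assume "n \<ge> 1"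
    then have n: "real n > 0" by simp
    have x: "Re s + 1 > 0" using s by simp
    note G = integral_powr_exp_real[OF x n]
    have "(\<integral>v. norm (f n v) \<partial>lborel) \<le> (\<integral>v. real n * (indicator {0<..} v *\<^sub>R (v powr Re s * exp (- real n * v))) \<partial>lborel)"
      using G(1) int nrm by (intro integral_mono) (auto simp: set_integrable_def)
    also have "\<dots> = real n * (Gamma (Re s + 1) * real n powr (- (Re s + 1)))"
      using G(2) by (simp add: set_lebesgue_integral_def)
    also have "\<dots> = Gamma (Re s + 1) * real n powr (- Re s)"
    proof -
      have "real n powr (- Re s) = real n powr 1 * real n powr (- (Re s + 1))"
        by (simp only: powr_add[symmetric]) simp
      also have "real n powr 1 = real n" using n by simp
      finally show ?thesis by (simp only: mult_ac)
    qed
    finally show "norm (\<integral>v. norm (f n v) \<partial>lborel) \<le> Gamma (Re s + 1) * real n powr (- Re s)"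
      by (simp add: integral_nonneg_AE)
  qed
  have pt: "norm (of_nat n * a n * of_real (exp (- v)) ^ n) \<le> of_nat n * exp (- v) ^ n" for n v
    using a[of n] by (simp add: norm_mult norm_power mult_mono mult_left_le)
  have summ: "summable (\<lambda>n. norm (of_nat n * a n * of_real (exp (- v)) ^ n))" if "v > 0" for v
  proof (rule summable_comparison_test)
    have "(\<lambda>n. real (Suc n) * exp (- v) ^ n) sums (1 / (1 - exp (- v))\<^sup>2)"
      using that by (intro geometric_deriv_sums) simp
    then have "summable (\<lambda>n. exp (- v) * (real (Suc n) * exp (- v) ^ n))"
      by (intro summable_mult) (simp add: sums_iff)
    then have "summable (\<lambda>n. real (Suc n) * exp (- v) ^ Suc n)" by (simp add: mult_ac)
    then show "summable (\<lambda>n. real n * exp (- v) ^ n)" by (rule summable_Suc_iff[THEN iffD1])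
  qed (use pt in auto)
  have fe: "f n v = (of_nat n * a n * of_real (exp (- v)) ^ n) * of_real v powr s" if "v > 0" for n v
    using that by (simp add: f_def exp_of_nat_mult[symmetric] mult_ac flip: of_real_power)
  have AE: "AE v in lborel. summable (\<lambda>n. norm (f n v))"
  proof (rule AE_I2)
    fix v :: real
    show "summable (\<lambda>n. norm (f n v))"
    proof (cases "v > 0")
      case True
      have "summable (\<lambda>n. norm (of_nat n * a n * of_real (exp (- v)) ^ n) * norm (complex_of_real v powr s))"
        using summ[OF True] by (rule summable_mult2)
      then show ?thesis using True by (simp add: fe norm_mult)
    next
      case False
      then show ?thesis by (simp add: f_def)
    qed
  qed
  have "(\<Sum>n. f n v) = indicator {0<..} v *\<^sub>R ((\<Sum>n. of_nat n * a n * of_real (exp (- v)) ^ n) * of_real v powr s)" for v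
  proof (cases "v > 0")
    case True
    have "summable (\<lambda>n. of_nat n * a n * of_real (exp (- v)) ^ n)"
      using summ[OF True] by (rule summable_norm_cancel)
    then have "(\<Sum>n. (of_nat n * a n * of_real (exp (- v)) ^ n) * of_real v powr s) =
        (\<Sum>n. of_nat n * a n * of_real (exp (- v)) ^ n) * of_real v powr s"
      by (rule suminf_mult2[symmetric])
    then show ?thesis using True by (simp add: fe)
  next
    case False
    then show ?thesis by (simp add: f_def)
  qed
  then show ?thesis
    using sums_integral[OF int AE sums] by (simp add: val mellin_def set_lebesgue_integral_def)
qed

text \<open>A single majorant for the whole strip \<open>x1 <= Re s <= x2\<close>: of
  \<open>v^x1\<close> and \<open>v^x2\<close>, the first dominates for \<open>v <= 1\<close> and the
  second for \<open>v > 1\<close>. Its independence of \<open>s\<close> is what gives locally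
  uniform convergence.\<close>

lemma mellin_integrand_dominated:
  fixes P :: "real \<Rightarrow> complex"
  assumes P: "\<And>v. v > 0 \<Longrightarrow> norm (P v) \<le> C * exp (- v / 2) / v"
    and x: "0 < x1" "x1 \<le> Re s" "Re s \<le> x2" and v: "v > 0"
  shows "norm (P v * of_real v powr s) \<le> C * (v powr (x1 - 1) * exp (- (1/2) * v) + v powr (x2 - 1) * exp (- (1/2) * v))"
proof -
  have C: "C * exp (- v / 2) / v \<ge> 0" using P[OF v] norm_ge_zero order_trans by blast
  have le: "v powr Re s \<le> v powr x1 + v powr x2"
  proof (cases "v \<le> 1")
    case True
    then have "v powr Re s \<le> v powr x1" using v x by (intro powr_mono') auto
    then show ?thesis by (simp add: add_increasing2)
  next
    case False
    then have "v powr Re s \<le> v powr x2" using v x by (intro powr_mono) auto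
    then show ?thesis by (simp add: add_increasing)
  qed
  have "norm (P v * of_real v powr s) = norm (P v) * v powr Re s"
    using v by (simp add: norm_mult norm_powr_real_powr)
  also have "\<dots> \<le> C * exp (- v / 2) / v * (v powr x1 + v powr x2)"
    using P[OF v] le C by (intro mult_mono) auto
  also have "\<dots> = C * (v powr (x1 - 1) * exp (- (1/2) * v) + v powr (x2 - 1) * exp (- (1/2) * v))"
    using v by (simp add: powr_diff field_simps)
  finally show ?thesis .
qed

lemma mellin_integrable:
  fixes P :: "real \<Rightarrow> complex"
  assumes cont: "continuous_on {0<..} P" and P: "\<And>v. v > 0 \<Longrightarrow> norm (P v) \<le> C * exp (- v / 2) / v"
    and s: "Re s > 0"
  shows "set_integrable lborel {0<..} (\<lambda>v. P v * of_real v powr s)"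
  unfolding set_integrable_def
proof (rule Bochner_Integration.integrable_bound)
  have "set_integrable lborel {0<..} (\<lambda>v. v powr (Re s - 1) * exp (- (1/2) * v))"
    by (rule integral_powr_exp_real) (use s in auto)
  \<comment> \<open>The summands coincide because the strip of the majorant is taken degenerate,
    \<open>x1 = x2 = Re s\<close>.\<close>
  then show "integrable lborel (\<lambda>v. C * (indicator {0<..} v *\<^sub>R (v powr (Re s - 1) * exp (- (1/2) * v)) +
      indicator {0<..} v *\<^sub>R (v powr (Re s - 1) * exp (- (1/2) * v))))"
    unfolding set_integrable_def by (intro integrable_mult_right Bochner_Integration.integrable_add)
  have "(\<lambda>v. indicator {0<..} v *\<^sub>R (P v * of_real v powr s)) \<in> borel_measurable borel"
    by (rule borel_measurable_continuous_on_indicator) (auto intro!: continuous_intros cont)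
  then show "(\<lambda>v. indicator {0<..} v *\<^sub>R (P v * of_real v powr s)) \<in> borel_measurable lborel" by simp
  show "AE v in lborel. norm (indicator {0<..} v *\<^sub>R (P v * of_real v powr s)) \<le>
      norm (C * (indicator {0<..} v *\<^sub>R (v powr (Re s - 1) * exp (- (1/2) * v)) +
      indicator {0<..} v *\<^sub>R (v powr (Re s - 1) * exp (- (1/2) * v))))"
  proof (rule AE_I2)
    fix v :: real
    show "norm (indicator {0<..} v *\<^sub>R (P v * of_real v powr s)) \<le>
      norm (C * (indicator {0<..} v *\<^sub>R (v powr (Re s - 1) * exp (- (1/2) * v)) +
      indicator {0<..} v *\<^sub>R (v powr (Re s - 1) * exp (- (1/2) * v))))"
      using mellin_integrand_dominated[OF P s order_refl order_refl, of v] by (cases "v > 0") auto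
  qed
qed

text \<open>The integrals over the compact intervals \<open>K m\<close> are holomorphic by
  differentiation under the integral sign, and they converge locally uniformly to the full
  one.\<close>

lemma mellin_holomorphic:
  fixes P :: "real \<Rightarrow> complex"
  assumes cont: "continuous_on {0<..} P" and P: "\<And>v. v > 0 \<Longrightarrow> norm (P v) \<le> C * exp (- v / 2) / v"
  shows "mellin P holomorphic_on {s. Re s > 0}"
proof -
  define K where "K m = {1 / real (m + 1)..real (m + 1)}" for m :: nat
  have Kpos: "K m \<subseteq> {0<..}" for m
  proof
    fix x assume "x \<in> K m"
    moreover have "0 < 1 / real (m + 1)" by simp
    ultimately show "x \<in> {0<..}" unfolding K_def atLeastAtMost_iff greaterThan_iff by linarith
  qed
  define F where "F m s = integral (K m) (\<lambda>v. P v * of_real v powr s)" for m s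
  have hol: "F m holomorphic_on {s. Re s > 0}" for m
    unfolding F_def K_def cbox_interval[symmetric]
  proof (rule leibniz_rule_holomorphic[where fx = "\<lambda>s v. P v * (of_real v powr s * Ln (of_real v))"])
    fix s t assume "t \<in> cbox (1 / real (m + 1)) (real (m + 1))"
    then have "t > 0" using Kpos[of m] by (auto simp: K_def)
    then show "((\<lambda>s. P t * of_real t powr s) has_field_derivative P t * (of_real t powr s * Ln (of_real t)))
        (at s within {s. Re s > 0})"
      using DERIV_cmult[OF has_field_derivative_powr_right[of "of_real t" s], of "P t"]
      by (auto intro: has_field_derivative_at_within simp: mult.commute)
  next
    fix s
    have "continuous_on (K m) (\<lambda>v. P v * of_real v powr s)"
      using Kpos[of m] by (intro continuous_intros continuous_on_subset[OF cont]) auto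
    then show "(\<lambda>v. P v * of_real v powr s) integrable_on cbox (1 / real (m + 1)) (real (m + 1))"
      unfolding K_def by (intro integrable_continuous) simp
  next
    define Q where "Q = {s. Re s > 0} \<times> K m"
    have pos: "snd z > 0" if "z \<in> Q" for z using that Kpos[of m] by (auto simp: Q_def)
    have "continuous_on Q (\<lambda>z. P (snd z))"
      by (rule continuous_on_compose2[OF cont continuous_on_snd[OF continuous_on_id]]) (use pos in auto)
    then have "continuous_on Q (\<lambda>z. P (snd z) * (exp (fst z * of_real (ln (snd z))) * of_real (ln (snd z))))"
      by (intro continuous_intros) (use pos in force)+
    then have "continuous_on Q (\<lambda>z. P (snd z) * (of_real (snd z) powr (fst z) * Ln (of_real (snd z))))"
      by (rule continuous_on_eq) (use pos in \<open>auto simp: powr_def Ln_of_real dest!: pos\<close>)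
    then show "continuous_on ({s. Re s > 0} \<times> cbox (1 / real (m + 1)) (real (m + 1)))
        (\<lambda>(s, v). P v * (of_real v powr s * Ln (of_real v)))"
      by (simp add: Q_def K_def case_prod_unfold)
  qed (simp add: convex_halfspace_Re_gt)
  have Kborel: "K m \<in> sets lborel" for m by (simp add: K_def)
  show ?thesis
  proof (rule holomorphic_uniform_sequence[OF open_halfspace_Re_gt hol])
    fix s0 assume s0: "s0 \<in> {s. Re s > 0}"
    define d where "d = Re s0 / 2"
    define x1 where "x1 = Re s0 - d"
    define x2 where "x2 = Re s0 + d"
    have d: "d > 0" "x1 > 0" using s0 by (auto simp: d_def x1_def)
    have Re_in: "x1 \<le> Re s" "Re s \<le> x2" if "s \<in> cball s0 d" for s
      using abs_Re_le_cmod[of "s0 - s"] that by (auto simp: x1_def x2_def dist_norm)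
    define D where "D v = indicator {0<..} v *\<^sub>R (C * (v powr (x1 - 1) * exp (- (1/2) * v) + v powr (x2 - 1) * exp (- (1/2) * v)))" for v :: real
    have Dint: "integrable lborel D"
    proof -
      have "integrable lborel (\<lambda>v. C * (indicator {0<..} v *\<^sub>R (v powr (x1 - 1) * exp (- (1/2) * v)) +
          indicator {0<..} v *\<^sub>R (v powr (x2 - 1) * exp (- (1/2) * v))))"
        using integral_powr_exp_real(1)[of x1 "1/2"] integral_powr_exp_real(1)[of x2 "1/2"] d
        unfolding set_integrable_def by (intro integrable_mult_right Bochner_Integration.integrable_add) (auto simp: x2_def x1_def)
      then show ?thesis by (simp add: D_def[abs_def] algebra_simps)
    qed
    \<comment> \<open>\<open>E m\<close> is the mass of the majorant outside \<open>K m\<close>. It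
      bounds the truncation error for every \<open>s\<close> in the disc at once and tends to 0 by
      dominated convergence.\<close>
    define E where "E m = (\<integral>v. indicator (- K m) v *\<^sub>R D v \<partial>lborel)" for m
    have "(\<lambda>m. E m) \<longlonglongrightarrow> (\<integral>v. 0 \<partial>(lborel :: real measure))"
      unfolding E_def
    proof (rule integral_dominated_convergence[where w = "\<lambda>v. norm (D v)"])
      show "integrable lborel (\<lambda>v. norm (D v))" using Dint by simp
      show "(\<lambda>v. indicator (- K m) v *\<^sub>R D v) \<in> borel_measurable lborel" for m
        using Dint Kborel[of m] by (intro borel_measurable_scaleR borel_measurable_indicator) auto
      show "AE v in lborel. (\<lambda>m. indicator (- K m) v *\<^sub>R D v) \<longlonglongrightarrow> 0"
      proof (rule AE_I2)
        fix v :: real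
        show "(\<lambda>m. indicator (- K m) v *\<^sub>R D v) \<longlonglongrightarrow> 0"
        proof (cases "v > 0")
          case True
          obtain N where N: "real N > max v (1 / v)" using reals_Archimedean2 by blast
          have "eventually (\<lambda>m. indicator (- K m) v *\<^sub>R D v = 0) sequentially"
          proof (rule eventually_sequentiallyI[of N])
            fix m assume "N \<le> m"
            then have m: "real (m + 1) > v" "real (m + 1) > 1 / v" using N by auto
            then have "1 / real (m + 1) \<le> v" using True by (simp add: field_simps)
            then have "v \<in> K m" using m by (simp add: K_def)
            then show "indicator (- K m) v *\<^sub>R D v = 0" by simp
          qed
          then show ?thesis by (rule tendsto_eventually)
        next
          case False
          then show ?thesis by (simp add: D_def)
        qed
      qed
      show "AE v in lborel. norm (indicator (- K m) v *\<^sub>R D v) \<le> norm (D v)" for m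
        by (auto simp: indicator_def)
    qed simp
    then have E0: "E \<longlonglongrightarrow> 0" by simp
    have bound: "norm (F m s - mellin P s) \<le> E m" if s: "s \<in> cball s0 d" for m s
    proof -
      define g where "g v = P v * of_real v powr s" for v
      have "Re s > 0" using Re_in[OF s] d by linarith
      then have gi: "set_integrable lborel {0<..} g"
        unfolding g_def using cont P by (intro mellin_integrable[where C = C]) auto
      have gK: "set_integrable lborel (K m) g"
        using gi Kborel Kpos by (rule set_integrable_subset)
      have gC: "set_integrable lborel ({0<..} - K m) g"
        using gi by (rule set_integrable_subset) (use Kborel in auto)
      have "F m s = (LINT v:K m|lborel. g v)"
        unfolding F_def g_def[symmetric] by (rule set_borel_integral_eq_integral(2)[symmetric]) fact
      moreover have "(LINT v:{0<..}|lborel. g v) = (LINT v:K m|lborel. g v) + (LINT v:({0<..} - K m)|lborel. g v)"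
        using set_integral_Un[OF _ gK gC] Kpos[of m] by (simp add: Un_absorb1)
      ultimately have "norm (F m s - (LINT v:{0<..}|lborel. g v)) = norm (LINT v:({0<..} - K m)|lborel. g v)"
        by (simp add: norm_minus_commute)
      also have "\<dots> \<le> E m"
        unfolding set_lebesgue_integral_def E_def
      proof (rule Bochner_Integration.integral_norm_bound_integral)
        show "integrable lborel (\<lambda>v. indicator ({0<..} - K m) v *\<^sub>R g v)" using gC by (simp add: set_integrable_def)
        show "integrable lborel (\<lambda>v. indicator (- K m) v *\<^sub>R D v)"
          using Dint Kborel[of m] by (intro integrable_mult_indicator) auto
        show "norm (indicator ({0<..} - K m) v *\<^sub>R g v) \<le> indicator (- K m) v *\<^sub>R D v" for v
          using mellin_integrand_dominated[OF P d(2) Re_in[OF s], of v]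
          by (auto simp: indicator_def D_def g_def)
      qed
      finally show ?thesis by (simp add: g_def mellin_def)
    qed
    have "uniform_limit (cball s0 d) F (mellin P) sequentially"
    proof (rule uniform_limitI)
      fix e :: real assume "e > 0"
      then have "eventually (\<lambda>m. E m < e) sequentially" using E0 by (simp add: order_tendstoD)
      then show "\<forall>\<^sub>F m in sequentially. \<forall>s\<in>cball s0 d. dist (F m s) (mellin P s) < e"
      proof eventually_elim
        case (elim m)
        then show ?case using le_less_trans[OF bound elim] by (auto simp: dist_norm)
      qed
    qed
    moreover have "cball s0 d \<subseteq> {s. Re s > 0}" using Re_in d by fastforce
    ultimately show "\<exists>d>0. cball s0 d \<subseteq> {s. Re s > 0} \<and>
        uniform_limit (cball s0 d) F (mellin P) sequentially"
      using d by blast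
  qed
qed

lemma mellin_bound:
  fixes P :: "real \<Rightarrow> complex"
  assumes int: "set_integrable lborel {0<..} (\<lambda>v. P v * of_real v powr s)"
    and P: "\<And>v. v > 0 \<Longrightarrow> norm (P v) \<le> A / v" "\<And>v. v > 0 \<Longrightarrow> norm (P v) \<le> 1 / v\<^sup>2"
    and A: "A > 0" and s: "0 < Re s" "Re s < 1"
  shows "norm (mellin P s) \<le> A powr (1 - Re s) / (Re s * (1 - Re s))"
proof -
  define x where "x = Re s"
  have x: "0 < x" "x < 1" using s by (auto simp: x_def)
  \<comment> \<open>At \<open>v0\<close> the bounds \<open>A / v\<close> and \<open>1 / v^2\<close>
    agree. Both pieces of the integral then carry the factor \<open>v0^(x - 1)\<close>, and
    \<open>1 / x + 1 / (1 - x) = 1 / (x (1 - x))\<close>.\<close>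
  define v0 where "v0 = 1 / A"
  have v0: "v0 > 0" using A by (simp add: v0_def)
  define g where "g v = (if v \<le> v0 then A * v powr (x - 1) else v powr (x - 2))" for v
  have I1: "(g has_integral A * (v0 powr x / x)) {0..v0}"
  proof (rule has_integral_eq)
    show "((\<lambda>v. A * v powr (x - 1)) has_integral A * (v0 powr x / x)) {0..v0}"
      using has_integral_powr_from_0[of "x - 1" v0] x v0 by (intro has_integral_mult_right) simp
  qed (auto simp: g_def)
  have I2: "(g has_integral v0 powr (x - 1) / (1 - x)) {v0..}"
  proof (rule has_integral_spike[of "{v0}"])
    have "((\<lambda>v. v powr (x - 2)) has_integral - (v0 powr (x - 2 + 1)) / (x - 2 + 1)) {v0..}"
      using x v0 by (intro has_integral_powr_to_inf) auto
    moreover have "- (v0 powr (x - 2 + 1)) / (x - 2 + 1) = v0 powr (x - 1) / (1 - x)"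
      using x by (simp add: field_simps)
    ultimately show "((\<lambda>v. v powr (x - 2)) has_integral v0 powr (x - 1) / (1 - x)) {v0..}" by simp
  qed (auto simp: g_def)
  have "(g has_integral A * (v0 powr x / x) + v0 powr (x - 1) / (1 - x)) ({0..v0} \<union> {v0..})"
  proof (rule has_integral_Un[OF I1 I2])
    have "{0..v0} \<inter> {v0..} = {v0}" using v0 by auto
    then show "negligible ({0..v0} \<inter> {v0..})" by simp
  qed
  moreover have "{0..v0} \<union> {v0..} = {0..}" using v0 by auto
  ultimately have "(g has_integral A * (v0 powr x / x) + v0 powr (x - 1) / (1 - x)) {0..}" by simp
  moreover have "(g has_integral y) {0<..} \<longleftrightarrow> (g has_integral y) {0..}" for y
    by (rule has_integral_spike_set_eq; rule negligible_subset[of "{0}"]; auto)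
  ultimately have G: "(g has_integral A * (v0 powr x / x) + v0 powr (x - 1) / (1 - x)) {0<..}" by blast
  have "A * v0 powr x = v0 powr (x - 1)"
    using v0 A by (simp add: powr_diff v0_def)
  then have val: "A * (v0 powr x / x) + v0 powr (x - 1) / (1 - x) = v0 powr (x - 1) / (x * (1 - x))"
    using x by (simp add: field_simps)
  have "v0 powr (x - 1) = A powr (1 - x)"
    using A by (simp add: v0_def powr_divide powr_diff)
  then have val: "A * (v0 powr x / x) + v0 powr (x - 1) / (1 - x) = A powr (1 - x) / (x * (1 - x))"
    using val by simp
  have "norm (mellin P s) = norm (integral {0<..} (\<lambda>v. P v * of_real v powr s))"
    by (simp add: mellin_def set_borel_integral_eq_integral(2)[OF int])
  also have "\<dots> \<le> integral {0<..} g"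
  proof (rule integral_norm_bound_integral)
    show "(\<lambda>v. P v * of_real v powr s) integrable_on {0<..}"
      by (rule set_borel_integral_eq_integral(1)[OF int])
    show "g integrable_on {0<..}" using G by blast
    fix v :: real assume "v \<in> {0<..}"
    then have v: "v > 0" by simp
    have eq: "norm (P v * of_real v powr s) = norm (P v) * v powr x"
      using v by (simp add: norm_mult norm_powr_real_powr x_def)
    have "norm (P v) * v powr x \<le> A / v * v powr x" "norm (P v) * v powr x \<le> 1 / v\<^sup>2 * v powr x"
      using mult_right_mono[OF P(1)[OF v], of "v powr x"] mult_right_mono[OF P(2)[OF v], of "v powr x"] by simp_all
    moreover have "A / v * v powr x = A * v powr (x - 1)" using v by (simp add: powr_diff)
    moreover have "1 / v\<^sup>2 * v powr x = v powr (x - 2)" using v by (simp add: powr_diff)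
    ultimately show "norm (P v * of_real v powr s) \<le> g v" unfolding eq g_def by simp
  qed
  also have "\<dots> = A powr (1 - x) / (x * (1 - x))"
    using integral_unique[OF G] val by (simp only:)
  finally show ?thesis by (simp add: x_def)
qed

section \<open>A weighted Jensen formula\<close>

text \<open>The zero-free case. Write \<open>g = exp h\<close> on the disc: against
  \<open>cis (- \<theta>)\<close> the integral of \<open>h\<close> is
  \<open>2 pi \<rho> h'(a)\<close> by Cauchy's formula for the derivative, against
  \<open>cis \<theta>\<close> it is 0 by Cauchy's theorem, and half the sum has the stated real
  part.\<close>

lemma integral_cos_ln_norm:
  fixes g :: "complex \<Rightarrow> complex"
  assumes U: "open U" "cball a \<rho> \<subseteq> U" and g: "g holomorphic_on U" and nz: "\<And>z. z \<in> cball a \<rho> \<Longrightarrow> g z \<noteq> 0"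
    and \<rho>: "\<rho> > 0"
  shows "((\<lambda>\<theta>. cos \<theta> * ln (norm (g (a + \<rho> * cis \<theta>)))) has_integral pi * \<rho> * Re (deriv g a / g a)) {0..2 * pi}"
proof -
  obtain h where h: "h holomorphic_on cball a \<rho>" "\<And>z. z \<in> cball a \<rho> \<Longrightarrow> g z = exp (h z)"
  proof -
    have "contractible (cball a \<rho>)" by (simp add: convex_imp_contractible)
    then show ?thesis
      using contractible_imp_holomorphic_log[OF holomorphic_on_subset[OF g U(2)]] nz that by metis
  qed
  have sB: "a + \<rho> * cis \<theta> \<in> cball a \<rho>" for \<theta>
    using \<rho> by (simp add: dist_norm norm_mult)
  have hb: "h holomorphic_on ball a \<rho>" using h(1) by (rule holomorphic_on_subset) auto
  have aB: "a \<in> ball a \<rho>" using \<rho> by simp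
  have circ: "circlepath a \<rho> = part_circlepath a \<rho> 0 (2 * pi)"
    by (simp add: circlepath_def)
  have 1: "((\<lambda>u. h u / (u - a)\<^sup>2) has_contour_integral (2 * of_real pi * \<i> * deriv h a)) (circlepath a \<rho>)"
  proof -
    have c: "continuous_on (cball a \<rho>) h" "h holomorphic_on ball a \<rho>" "a \<in> ball a \<rho>"
      using h(1) hb aB by (auto intro: holomorphic_on_imp_continuous_on)
    from Cauchy_derivative_integral_circlepath(2)[OF c]
    have "deriv h a = 1 / (2 * of_real pi * \<i>) * contour_integral (circlepath a \<rho>) (\<lambda>u. h u / (u - a)\<^sup>2)"
      by (rule DERIV_imp_deriv)
    then have "contour_integral (circlepath a \<rho>) (\<lambda>u. h u / (u - a)\<^sup>2) = 2 * of_real pi * \<i> * deriv h a"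
      by simp
    then show ?thesis
      using has_contour_integral_integral[OF Cauchy_derivative_integral_circlepath(1)[OF c]] by simp
  qed
  have 2: "(h has_contour_integral 0) (circlepath a \<rho>)"
    using \<rho> by (intro Cauchy_theorem_convex_simple[OF h(1)]) auto
  have "((\<lambda>t. h (a + \<rho> * cis t) / (\<rho> * cis t)\<^sup>2 * \<rho> * \<i> * cis t) has_integral (2 * of_real pi * \<i> * deriv h a)) {0..2*pi}"
    using 1 unfolding circ by (subst (asm) has_contour_integral_part_circlepath_iff) simp_all
  from has_integral_mult_right[OF this, of "\<rho> / \<i>"]
  have I1: "((\<lambda>t. h (a + \<rho> * cis t) * cis (- t)) has_integral (2 * of_real pi * \<rho> * deriv h a)) {0..2*pi}"
  proof (rule has_integral_eq_rhs[OF has_integral_eq, rotated])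
    fix t show "of_real \<rho> / \<i> * (h (a + \<rho> * cis t) / (\<rho> * cis t)\<^sup>2 * \<rho> * \<i> * cis t) = h (a + \<rho> * cis t) * cis (- t)"
      using \<rho> by (simp add: power2_eq_square field_simps cis_mult flip: cis_inverse)
  qed simp
  have "((\<lambda>t. h (a + \<rho> * cis t) * \<rho> * \<i> * cis t) has_integral 0) {0..2*pi}"
    using 2 unfolding circ by (subst (asm) has_contour_integral_part_circlepath_iff) simp_all
  from has_integral_mult_right[OF this, of "1 / (\<rho> * \<i>)"]
  have I2: "((\<lambda>t. h (a + \<rho> * cis t) * cis t) has_integral 0) {0..2*pi}"
  proof (rule has_integral_eq_rhs[OF has_integral_eq, rotated])
    fix t show "1 / (\<rho> * \<i>) * (h (a + \<rho> * cis t) * \<rho> * \<i> * cis t) = h (a + \<rho> * cis t) * cis t"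
      using \<rho> by (simp add: field_simps)
  qed simp
  have I3: "((\<lambda>t. 1 / 2 * (h (a + \<rho> * cis t) * cis (- t) + h (a + \<rho> * cis t) * cis t)) has_integral
      1 / 2 * (2 * of_real pi * \<rho> * deriv h a + 0)) {0..2*pi}"
    by (intro has_integral_mult_right has_integral_add I1 I2)
  have R0: "((\<lambda>t. Re (1 / 2 * (h (a + \<rho> * cis t) * cis (- t) + h (a + \<rho> * cis t) * cis t))) has_integral
      Re (1 / 2 * (2 * of_real pi * \<rho> * deriv h a + 0))) {0..2*pi}"
    using has_integral_linear[OF I3 bounded_linear_Re] by (simp only: o_def)
  have eq: "Re (1 / 2 * (h (a + \<rho> * cis t) * cis (- t) + h (a + \<rho> * cis t) * cis t)) =
      cos t * ln (norm (g (a + \<rho> * cis t)))" for t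
  proof -
    have "cis (- t) + cis t = of_real (2 * cos t)" by (simp add: complex_eq_iff)
    then have "1 / 2 * (h (a + \<rho> * cis t) * cis (- t) + h (a + \<rho> * cis t) * cis t) = of_real (cos t) * h (a + \<rho> * cis t)"
      by (simp flip: distrib_left)
    moreover have "ln (norm (g (a + \<rho> * cis t))) = Re (h (a + \<rho> * cis t))"
      using h(2)[OF sB[of t]] by simp
    ultimately show ?thesis by simp
  qed
  have "((\<lambda>\<theta>. cos \<theta> * ln (norm (g (a + \<rho> * cis \<theta>)))) has_integral
      Re (1 / 2 * (2 * of_real pi * \<rho> * deriv h a + 0))) {0..2*pi}"
    by (rule has_integral_eq[OF _ R0]) (rule eq)
  moreover have "deriv h a = deriv g a / g a"
  proof -
    have "(h has_field_derivative deriv h a) (at a)"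
      by (rule holomorphic_derivI[OF hb open_ball aB])
    then have "((\<lambda>z. exp (h z)) has_field_derivative exp (h a) * deriv h a) (at a)"
      by (auto intro!: derivative_eq_intros)
    then have "(g has_field_derivative exp (h a) * deriv h a) (at a)"
      by (rule DERIV_cong_ev[OF refl _ refl, THEN iffD1, rotated])
         (use h(2) aB in \<open>auto intro!: eventually_nhds_in_open[of "ball a \<rho>", THEN eventually_mono]\<close>)
    then have "deriv g a = g a * deriv h a" using h(2)[of a] \<rho> by (simp add: DERIV_imp_deriv)
    moreover have "g a \<noteq> 0" using h(2)[of a] \<rho> by simp
    ultimately show ?thesis by simp
  qed
  moreover have "Re (1 / 2 * (2 * of_real pi * \<rho> * deriv h a + 0)) = pi * \<rho> * Re (deriv h a)" by simp
  ultimately show ?thesis by (simp only:)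
qed

lemma norm_on_circle_reflect:
  fixes a w z :: complex
  assumes "norm (z - a) = \<rho>" "\<rho> > 0"
  shows "norm ((of_real (\<rho>\<^sup>2) - cnj (w - a) * (z - a)) / of_real \<rho>) = norm (z - w)"
proof -
  have "complex_of_real (\<rho>\<^sup>2) = (z - a) * cnj (z - a)"
    by (simp only: assms(1)[symmetric] complex_norm_square)
  then have "of_real (\<rho>\<^sup>2) - cnj (w - a) * (z - a) = (z - a) * cnj (z - w)"
    by (simp add: algebra_simps)
  then have "norm (of_real (\<rho>\<^sup>2) - cnj (w - a) * (z - a)) = \<rho> * norm (z - w)"
    using assms by (simp only: norm_mult complex_mod_cnj)
  then show ?thesis using assms by (simp add: norm_divide)
qed

text \<open>The factor can vanish only at the reflection of \<open>w\<close> in the circle, at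
  distance \<open>\<rho>^2 / |w - a| > \<rho>\<close> from the centre, and nowhere if
  \<open>w = a\<close>.\<close>

lemma reflect_nonzero:
  fixes a w z :: complex
  assumes "norm (w - a) < \<rho>" "z \<in> cball a \<rho>"
  shows "of_real (\<rho>\<^sup>2) - cnj (w - a) * (z - a) \<noteq> 0"
proof
  assume "of_real (\<rho>\<^sup>2) - cnj (w - a) * (z - a) = 0"
  then have "norm (cnj (w - a) * (z - a)) = norm (complex_of_real (\<rho>\<^sup>2))" by simp
  then have eq: "norm (w - a) * norm (z - a) = \<rho>\<^sup>2"
    by (simp only: norm_mult complex_mod_cnj norm_of_real) simp
  have "norm (z - a) \<le> \<rho>" using assms by (simp add: dist_norm norm_minus_commute)
  have \<rho>: "\<rho> > 0" using assms(1) norm_ge_zero[of "w - a"] by linarith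
  have "norm (w - a) * norm (z - a) \<le> norm (w - a) * \<rho>"
    using \<open>norm (z - a) \<le> \<rho>\<close> by (intro mult_left_mono) auto
  also have "\<dots> < \<rho> * \<rho>" using assms(1) \<rho> by (intro mult_strict_right_mono)
  finally show False using eq by (simp add: power2_eq_square)
qed

lemma remove_zero:
  fixes f :: "complex \<Rightarrow> complex"
  assumes f: "f holomorphic_on U" and U: "open U" "connected U" and w: "w \<in> U" "f w = 0"
    and nz: "\<exists>z\<in>U. f z \<noteq> 0"
  obtains g n where "n > 0" "g holomorphic_on U" "g w \<noteq> 0" "\<And>z. z \<in> U \<Longrightarrow> f z = g z * (z - w) ^ n"
proof -
  define n where "n = nat (zorder f w)"
  define h where "h = zor_poly f w"
  from zorder_exist_zero[OF f U w(1) nz] w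
  obtain r where r: "zorder f w > 0" "r > 0" "cball w r \<subseteq> U" "h holomorphic_on cball w r"
    "\<And>z. z \<in> cball w r \<Longrightarrow> f z = h z * (z - w) ^ n \<and> h z \<noteq> 0"
    unfolding h_def n_def by auto
  define g where "g z = (if z = w then h w else f z / (z - w) ^ n)" for z
  have gh: "g z = h z" if "z \<in> ball w r" for z
    using r(5)[of z] that by (auto simp: g_def)
  have "g holomorphic_on ball w r"
    by (rule holomorphic_transform[of h]) (use r gh in \<open>auto simp: holomorphic_on_subset\<close>)
  moreover have "g holomorphic_on (U - {w})"
    by (rule holomorphic_transform[of "\<lambda>z. f z / (z - w) ^ n"])
       (auto simp: g_def intro!: holomorphic_intros holomorphic_on_subset[OF f])
  ultimately have "g holomorphic_on (ball w r \<union> (U - {w}))"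
    using U by (intro holomorphic_on_Un) auto
  moreover have "ball w r \<union> (U - {w}) = U" using r w by auto
  ultimately have "g holomorphic_on U" by simp
  moreover have "f z = g z * (z - w) ^ n" if "z \<in> U" for z
    using w r(1) by (auto simp: g_def n_def)
  moreover have "g w \<noteq> 0" using r(5)[of w] r(2) by (simp add: g_def)
  ultimately show ?thesis using that[of n g] r(1) by (simp add: n_def)
qed

lemma finite_zeros_compact:
  assumes "f holomorphic_on U" "open U" "connected U" "compact K" "K \<subseteq> U" "a \<in> U" "f a \<noteq> 0"
  shows "finite {z \<in> K. f z = 0}"
proof (cases "f constant_on U")
  case True
  then have "{z \<in> K. f z = 0} = {}" using assms(5-7) unfolding constant_on_def by auto
  then show ?thesis by (simp only: finite.emptyI)
next
  case False
  then show ?thesis using assms by (intro holomorphic_compact_finite_zeros[of f U]) auto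
qed

lemma cball_subset_halfspace_Re:
  assumes "R < Re a"
  shows "cball a R \<subseteq> {s. Re s > 0}"
proof
  fix w assume "w \<in> cball a R"
  then have "Re (a - w) \<le> R" using complex_Re_le_cmod[of "a - w"] by (simp add: dist_norm)
  then show "w \<in> {s. Re s > 0}" using assms by simp
qed

text \<open>\<open>Re (1 / (a - w))\<close> is \<open>Re (a - w) / |a - w|^2\<close>, and
  \<open>|a - w| <= \<rho>\<close>. This is why unknown zeros can be discarded.\<close>

lemma zero_term_nonneg:
  fixes a w :: complex
  assumes "Re w \<le> Re a" "norm (a - w) \<le> \<rho>"
  shows "Re (1 / (a - w)) - Re (a - w) / \<rho>\<^sup>2 \<ge> 0"
\<comment> \<open>For \<open>a = w\<close> both terms are 0, the first by
  \<open>1 / 0 = 0\<close>.\<close>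
proof (cases "a = w")
  case False
  then have pos: "norm (a - w) > 0" by simp
  with assms(2) have "\<rho> > 0" by linarith
  then have "Re (a - w) / \<rho>\<^sup>2 \<le> Re (a - w) / (norm (a - w))\<^sup>2"
    using assms pos \<open>\<rho> > 0\<close> by (intro divide_left_mono power_mono mult_pos_pos zero_less_power) auto
  also have "\<dots> = Re (1 / (a - w))" by (simp add: Re_divide cmod_power2)
  finally show ?thesis by simp
qed simp

text \<open>Induction on the number of distinct zeros: one zero at a time is exchanged, with its
  full multiplicity, for a factor without zeros in the disc, until
  \<open>integral_cos_ln_norm\<close> applies. Existence of the integral is part of the claim and is
  carried along.\<close>

lemma jensen_cos_inequality:
  fixes f :: "complex \<Rightarrow> complex"
  assumes U: "open U" "connected U" "cball a \<rho> \<subseteq> U" and \<rho>: "\<rho> > 0"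
    and f: "f holomorphic_on U" and fa: "f a \<noteq> 0"
    and sphere: "\<And>z. z \<in> sphere a \<rho> \<Longrightarrow> f z \<noteq> 0"
    and left: "\<And>z. z \<in> ball a \<rho> \<Longrightarrow> f z = 0 \<Longrightarrow> Re z \<le> Re a"
  shows "\<exists>I. ((\<lambda>\<theta>. cos \<theta> * ln (norm (f (a + \<rho> * cis \<theta>)))) has_integral I) {0..2 * pi} \<and>
    I \<le> pi * \<rho> * (Re (deriv f a / f a) -
      (\<Sum>w\<in>{w \<in> cball a \<rho>. f w = 0}. Re (1 / (a - w)) - Re (a - w) / \<rho>\<^sup>2))"
proof -
  have "finite {w \<in> cball a \<rho>. f w = 0}"
    using U \<rho> fa by (intro finite_zeros_compact[OF f U(1,2), of _ a]) auto
  then show ?thesis using f fa sphere left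
  proof (induction "card {w \<in> cball a \<rho>. f w = 0}" arbitrary: f)
    case 0
    then have none: "{w \<in> cball a \<rho>. f w = 0} = {}" by (metis card_0_eq)
    then have "\<And>z. z \<in> cball a \<rho> \<Longrightarrow> f z \<noteq> 0" by blast
    from integral_cos_ln_norm[OF U(1,3) 0(3) this \<rho>] show ?case
      unfolding none by auto
  next
    case (Suc k)
    define Z where "Z = {w \<in> cball a \<rho>. f w = 0}"
    have "Z \<noteq> {}" using Suc(2) by (metis Z_def card.empty nat.distinct(1))
    then obtain w where w: "w \<in> Z" by blast
    have fw: "f w = 0" and wb: "norm (w - a) < \<rho>"
      using w Suc(6)[of w] by (auto simp: Z_def dist_norm norm_minus_commute le_less)
    have wU: "w \<in> U" and aU: "a \<in> U" using w U(3) \<rho> by (auto simp: Z_def)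
    obtain g n where g: "n > 0" "g holomorphic_on U" "g w \<noteq> 0" "\<And>z. z \<in> U \<Longrightarrow> f z = g z * (z - w) ^ n"
      using remove_zero[OF Suc(4) U(1,2) wU fw] Suc(5) aU by metis
    \<comment> \<open>Blaschke factor: replacing \<open>z - w\<close> by \<open>b\<close> removes the zero and leaves the modulus on the circle alone\<close>
    define b where "b z = (of_real (\<rho>\<^sup>2) - cnj (w - a) * (z - a)) / of_real \<rho>" for z
    define F where "F z = g z * b z ^ n" for z
    have b0: "b z \<noteq> 0" if "z \<in> cball a \<rho>" for z
      using reflect_nonzero[OF wb that] \<rho> by (simp add: b_def)
    have bs: "norm (b z) = norm (z - w)" if "z \<in> sphere a \<rho>" for z
      unfolding b_def using that \<rho> by (intro norm_on_circle_reflect) (auto simp: dist_norm norm_minus_commute)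
    have FZ: "{w \<in> cball a \<rho>. F w = 0} = Z - {w}"
      using g b0 U(3) by (auto simp: F_def Z_def)
    have hF: "F holomorphic_on U"
      unfolding F_def b_def by (intro holomorphic_intros g) (use \<rho> in auto)
    have wa: "w \<noteq> a" using fw Suc(5) by auto
    have normF: "norm (F z) = norm (f z)" if "z \<in> sphere a \<rho>" for z
      using bs[OF that] g(4)[of z] U(3) that by (auto simp: F_def norm_mult norm_power)
    have finZ: "finite Z" using Suc(3) by (simp add: Z_def)
    have "\<exists>I. ((\<lambda>\<theta>. cos \<theta> * ln (norm (F (a + \<rho> * cis \<theta>)))) has_integral I) {0..2 * pi} \<and>
      I \<le> pi * \<rho> * (Re (deriv F a / F a) -
      (\<Sum>w\<in>{w \<in> cball a \<rho>. F w = 0}. Re (1 / (a - w)) - Re (a - w) / \<rho>\<^sup>2))"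
    proof (rule Suc(1))
      have "card Z = Suc k" using Suc(2) by (simp add: Z_def)
      then show "k = card {w \<in> cball a \<rho>. F w = 0}" unfolding FZ using w finZ by simp
      show "finite {w \<in> cball a \<rho>. F w = 0}" unfolding FZ using finZ by simp
      show "F holomorphic_on U" by fact
      show "F a \<noteq> 0"
      proof
        assume "F a = 0"
        then have "a \<in> {w \<in> cball a \<rho>. F w = 0}" using \<rho> by simp
        then have "a \<in> Z" unfolding FZ by simp
        then show False using Suc(5) by (simp add: Z_def)
      qed
      show "F z \<noteq> 0" if "z \<in> sphere a \<rho>" for z using normF[OF that] Suc(6)[OF that] by (metis norm_eq_zero)
      show "Re z \<le> Re a" if "z \<in> ball a \<rho>" "F z = 0" for z
      proof -
        have "z \<in> {w \<in> cball a \<rho>. F w = 0}" using that by simp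
        then have "z \<in> Z" unfolding FZ by simp
        then show ?thesis using Suc(7) that by (auto simp: Z_def)
      qed
    qed
    then obtain I where I: "((\<lambda>\<theta>. cos \<theta> * ln (norm (F (a + \<rho> * cis \<theta>)))) has_integral I) {0..2 * pi}"
      "I \<le> pi * \<rho> * (Re (deriv F a / F a) - (\<Sum>w\<in>Z - {w}. Re (1 / (a - w)) - Re (a - w) / \<rho>\<^sup>2))"
      unfolding FZ by blast
    have "a + \<rho> * cis \<theta> \<in> sphere a \<rho>" for \<theta> using \<rho> by (simp add: dist_norm norm_mult)
    then have I': "((\<lambda>\<theta>. cos \<theta> * ln (norm (f (a + \<rho> * cis \<theta>)))) has_integral I) {0..2 * pi}"
      using I(1) normF by simp
    define T where "T w = Re (1 / (a - w)) - Re (a - w) / \<rho>\<^sup>2" for w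
    \<comment> \<open>At the centre, \<open>(z - w)^n\<close> contributes \<open>n / (a - w)\<close>
      to the logarithmic derivative of \<open>f\<close>, while its replacement contributes
      \<open>- n cnj (w - a) / \<rho>^2\<close> to that of \<open>F\<close>. The difference has real
      part \<open>n * T w\<close>.\<close>
    have dF: "deriv F a / F a = deriv f a / f a - n / (a - w) - n * cnj (w - a) / \<rho>\<^sup>2"
    proof -
      have "(g has_field_derivative deriv g a) (at a)" using g(2) U(1) aU by (simp add: holomorphic_derivI)
      then have "(F has_field_derivative deriv g a * b a ^ n + g a * (of_nat n * b a ^ (n - 1) * (- cnj (w - a) / \<rho>))) (at a)"
        unfolding F_def b_def using \<rho> by (auto intro!: derivative_eq_intros)
      then have 1: "deriv F a = deriv g a * b a ^ n + g a * (of_nat n * b a ^ (n - 1) * (- cnj (w - a) / \<rho>))"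
        by (rule DERIV_imp_deriv)
      have "((\<lambda>z. g z * (z - w) ^ n) has_field_derivative deriv g a * (a - w) ^ n + g a * (of_nat n * (a - w) ^ (n - 1))) (at a)"
        using \<open>(g has_field_derivative deriv g a) (at a)\<close> by (auto intro!: derivative_eq_intros)
      then have "(f has_field_derivative deriv g a * (a - w) ^ n + g a * (of_nat n * (a - w) ^ (n - 1))) (at a)"
        by (rule has_field_derivative_transform_within_open[OF _ U(1) aU]) (use g(4) in auto)
      then have 2: "deriv f a = deriv g a * (a - w) ^ n + g a * (of_nat n * (a - w) ^ (n - 1))"
        by (rule DERIV_imp_deriv)
      have ba: "b a = \<rho>" using \<rho> by (simp add: b_def power2_eq_square)
      have fa: "f a = g a * (a - w) ^ n" using g(4) aU by simp
      have "g a \<noteq> 0" using fa Suc(5) by auto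
      obtain m where m: "n = Suc m" using g(1) by (cases n) auto
      have "deriv F a / F a = deriv g a / g a - n * cnj (w - a) / \<rho>\<^sup>2"
        unfolding 1 F_def ba m using \<open>g a \<noteq> 0\<close> \<rho> by (simp add: field_simps power2_eq_square)
      moreover have "deriv f a / f a = deriv g a / g a + n / (a - w)"
        unfolding 2 fa m using \<open>g a \<noteq> 0\<close> wa by (simp add: field_simps)
      ultimately show ?thesis by simp
    qed
    have "Re (n * cnj (w - a) / \<rho>\<^sup>2) = - n * (Re (a - w) / \<rho>\<^sup>2)"
      by (simp add: field_simps flip: of_real_power)
    moreover have "Re (n / (a - w)) = n * Re (1 / (a - w))"
      by (simp add: Re_divide)
    ultimately have RdF: "Re (deriv F a / F a) = Re (deriv f a / f a) - n * T w"
      unfolding dF by (simp add: T_def algebra_simps add_divide_distrib diff_divide_distrib)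
    have "Re w \<le> Re a" using Suc(7)[of w] wb fw by (simp add: dist_norm norm_minus_commute)
    then have Tw: "T w \<ge> 0"
      unfolding T_def using wb by (intro zero_term_nonneg) (auto simp: norm_minus_commute)
    \<comment> \<open>Here equality is given up: of the \<open>n\<close> copies of the zero only one
      is counted in the sum.\<close>
    have "1 * T w \<le> n * T w" using g(1) Tw by (intro mult_right_mono) auto
    moreover have "(\<Sum>w\<in>Z. T w) = T w + (\<Sum>w\<in>Z - {w}. T w)"
      using finZ w by (simp add: sum.remove)
    ultimately have "Re (deriv F a / F a) - (\<Sum>w\<in>Z - {w}. T w) \<le> Re (deriv f a / f a) - (\<Sum>w\<in>Z. T w)"
      using RdF by simp
    then have "I \<le> pi * \<rho> * (Re (deriv f a / f a) - (\<Sum>w\<in>Z. T w))"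
      using I(2) \<rho> unfolding T_def
      by (elim order_trans) (intro mult_left_mono, auto)
    then show ?case using I' unfolding Z_def T_def by blast
  qed
qed

section \<open>The Gamma function\<close>

text \<open>\<open>1 / z^2 <= 1 / (z^2 - 1/4)\<close>, and the latter telescopes as
  \<open>1 / (z - 1/2) - 1 / (z + 1/2)\<close>.\<close>

lemma sum_inverse_square_le:
  fixes x :: real
  assumes "x > 1/2"
  shows "(\<Sum>j<n. 1 / (x + real j)\<^sup>2) \<le> 1 / (x - 1/2) - 1 / (x + real n - 1/2)"
proof (induction n)
  case (Suc n)
  define z where "z = x + real n"
  have z: "z > 1/2" using assms by (simp add: z_def)
  have "1/2 * (1/2) < z * z" using z by (intro mult_strict_mono) auto
  then have "1 / z\<^sup>2 \<le> 1 / (z\<^sup>2 - 1/4)"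
    by (intro divide_left_mono mult_pos_pos) (auto simp: power2_eq_square)
  also have "\<dots> = 1 / (z - 1/2) - 1 / (z + 1/2)"
  proof -
    have "z\<^sup>2 - 1/4 = (z - 1/2) * (z + 1/2)" by (simp add: power2_eq_square algebra_simps)
    then show ?thesis using z by (simp add: diff_divide_eq_iff divide_diff_eq_iff field_simps)
  qed
  finally have "1 / z\<^sup>2 \<le> 1 / (z - 1/2) - 1 / (z + 1/2)" .
  then show ?case using Suc by (simp add: z_def algebra_simps)
qed simp

lemma norm_shift_le:
  fixes s :: complex
  assumes "a + Re s > 0"
  shows "norm (s + of_real a) \<le> (Re s + a) * exp ((Im s)\<^sup>2 / (2 * (Re s + a)\<^sup>2))"
proof -
  define X where "X = Re s + a"
  have X: "X > 0" using assms by (simp add: X_def)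
  have "(norm (s + of_real a))\<^sup>2 = X\<^sup>2 * (1 + (Im s)\<^sup>2 / X\<^sup>2)"
    using X by (simp add: cmod_power2 X_def field_simps)
  also have "\<dots> \<le> X\<^sup>2 * exp ((Im s)\<^sup>2 / X\<^sup>2)"
    by (intro mult_left_mono exp_ge_add_one_self) auto
  also have "\<dots> = (X * exp ((Im s)\<^sup>2 / (2 * X\<^sup>2)))\<^sup>2"
    by (simp add: power_mult_distrib flip: exp_double)
  finally have "norm (s + of_real a) \<le> X * exp ((Im s)\<^sup>2 / (2 * X\<^sup>2))"
    by (rule power2_le_imp_le) (use X in auto)
  then show ?thesis by (simp add: X_def)
qed

text \<open>In Gauss's product only the factors \<open>s + j\<close> feel the imaginary part. Each
  one is compared with its real part through \<open>1 + t <= exp t\<close>, and the sum of the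
  exponents is bounded by telescoping.\<close>

lemma norm_rGamma_le:
  fixes s :: complex
  assumes x: "Re s > 1/2"
  shows "norm (rGamma s) \<le> rGamma (Re s) * exp ((Im s)\<^sup>2 / (2 * Re s - 1))"
proof -
  define y where "y = Im s"
  define C where "C = exp (y\<^sup>2 / (2 * Re s - 1))"
  have le: "norm (rGamma_series s n) \<le> rGamma_series (Re s) n * C" for n
  proof -
    define N where "N = n + 1"
    have "norm (pochhammer s (N)) = (\<Prod>j<N. norm (s + of_nat j))"
      by (simp add: pochhammer_prod norm_mult atLeast0LessThan flip: prod_norm)
    also have "\<dots> \<le> (\<Prod>j<N. (Re s + real j) * exp (y\<^sup>2 / (2 * (Re s + real j)\<^sup>2)))"
      using norm_shift_le[of "real j" s for j] x unfolding y_def by (intro prod_mono) auto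
    also have "\<dots> = pochhammer (Re s) (N) * exp (\<Sum>j<N. y\<^sup>2 / (2 * (Re s + real j)\<^sup>2))"
      by (simp add: pochhammer_prod prod.distrib exp_sum atLeast0LessThan)
    also have "\<dots> \<le> pochhammer (Re s) (N) * C"
    proof -
      have "(\<Sum>j<N. y\<^sup>2 / (2 * (Re s + real j)\<^sup>2)) = y\<^sup>2 / 2 * (\<Sum>j<N. 1 / (Re s + real j)\<^sup>2)"
        by (simp add: sum_distrib_left)
      also have "\<dots> \<le> y\<^sup>2 / 2 * (1 / (Re s - 1/2))"
      proof (intro mult_left_mono)
        have "0 \<le> 1 / (Re s + real (N) - 1 / 2)" using x by simp
        then show "(\<Sum>j<N. 1 / (Re s + real j)\<^sup>2) \<le> 1 / (Re s - 1/2)"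
          using sum_inverse_square_le[OF x, of "N"] by linarith
      qed simp
      also have "\<dots> = y\<^sup>2 / (2 * Re s - 1)" using x by (simp add: field_simps)
      finally show ?thesis unfolding C_def using x
        by (intro mult_left_mono) (auto intro!: pochhammer_nonneg)
    qed
    finally have "norm (pochhammer s N) \<le> pochhammer (Re s) N * C" .
    moreover have "norm (fact n * exp (s * of_real (ln (of_nat n)))) = fact n * exp (Re s * ln (real n))"
      by (simp add: norm_mult)
    ultimately show ?thesis
      unfolding rGamma_series_def norm_divide N_def
      by (simp add: divide_right_mono)
  qed
  have "(\<lambda>n. norm (rGamma_series s n)) \<longlonglongrightarrow> norm (rGamma s)"
    by (intro tendsto_norm rGamma_series_LIMSEQ)
  moreover have "(\<lambda>n. rGamma_series (Re s) n * C) \<longlonglongrightarrow> rGamma (Re s) * C"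
    by (intro tendsto_mult rGamma_series_LIMSEQ tendsto_const)
  ultimately show ?thesis
    unfolding C_def[symmetric] y_def[symmetric] using le
    by (intro LIMSEQ_le) auto
qed

text \<open>The tangent at 3/2 of the convex function \<open>ln \<Gamma>\<close>. The arguments will
  lie between 1 and 2; at 3/2 the value is explicit and the slope is small, the minimum of the Gamma
  function being nearby.\<close>

lemma ln_Gamma_real_ge:
  fixes y :: real
  assumes y: "y > 0"
  shows "ln (Gamma y) \<ge> ln (sqrt pi / 2) + Digamma (3/2) * (y - 3/2)"
proof -
  have conv: "convex_on {0<..} (ln_Gamma :: real \<Rightarrow> real)"
  proof (rule f''_ge0_imp_convex)
    show "(ln_Gamma has_real_derivative Digamma x) (at x)" if "x \<in> {0<..}" for x
      using that by (auto intro!: derivative_eq_intros)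
    show "(Digamma has_real_derivative Polygamma 1 x) (at x)" if "x \<in> {0<..}" for x :: real
      using that by (auto intro!: derivative_eq_intros)
    show "Polygamma 1 x \<ge> 0" if "x \<in> {0<..}" for x :: real
      using that by (intro less_imp_le Polygamma_real_odd_pos) auto
  qed auto
  have "ln_Gamma y - ln_Gamma (3/2) \<ge> Digamma (3/2) * (y - 3/2)"
    by (rule convex_on_imp_above_tangent[OF conv])
       (use y in \<open>auto intro!: derivative_eq_intros simp: interior_open\<close>)
  moreover have "Gamma (3/2 :: real) = sqrt pi / 2"
  proof -
    have "(1/2 :: real) \<notin> \<int>\<^sub>\<le>\<^sub>0" by (auto dest: nonpos_Ints_nonpos)
    then show ?thesis using Gamma_plus1[of "1/2 :: real"] Gamma_one_half_real by simp
  qed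
  ultimately show ?thesis using y by (simp add: ln_Gamma_real_pos)
qed

lemma Digamma_three_halves_bounds:
  "0 < Digamma (3/2 :: real)" "Digamma (3/2 :: real) < 2 - 2 * ln 2 - 19/33"
proof -
  have "-Digamma (3/2 :: real) = -Digamma (of_nat 1 + 1/2)" by simp
  also have "\<dots> = 2 * ln 2 + euler_mascheroni - 2" by (subst Digamma_half_integer) simp
  finally show "Digamma (3/2 :: real) < 2 - 2 * ln 2 - 19/33"
    using euler_mascheroni_gt_19_over_33 by linarith
qed (rule Digamma_real_three_halves_pos)

section \<open>Elementary constants and integrals\<close>

lemma pi_bounds: "(314/100) < pi" "pi < (31417/10000)"
  using pi_approx by simp_all

lemma ln_2_bounds: "(693/1000) < ln (2::real)" "ln (2::real) < (6932/10000)"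
  using ln_approx_bounds[of 2 3] by (simp_all add: eval_nat_numeral)

lemma ln_3_halves_bounds: "(405/1000) < ln (3/2::real)" "ln (3/2::real) < (4056/10000)"
  using ln_approx_bounds[of "3/2" 2] by (simp_all add: eval_nat_numeral)

lemma ln_3_bounds: "(1098/1000) < ln (3::real)" "ln (3::real) < (10988/10000)"
proof -
  have "ln (3::real) = ln 2 + ln (3/2)" using ln_mult[of 2 "3/2::real"] by simp
  then show "(1098/1000) < ln (3::real)" "ln (3::real) < (10988/10000)"
    using ln_2_bounds ln_3_halves_bounds by simp_all
qed

lemma ln_10_bounds: "(23025/10000) < ln (10::real)" "ln (10::real) < (23028/10000)"
proof -
  have "ln (10::real) = 3 * ln 2 + ln (5/4)"
    using ln_mult[of 8 "5/4::real"] ln_realpow[of 2 3] by simp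
  moreover have "(2231/10000) < ln (5/4::real)" "ln (5/4::real) < (2232/10000)"
    using ln_approx_bounds[of "5/4" 3] by (simp_all add: eval_nat_numeral)
  moreover have "(69314/100000) < ln (2::real)" "ln (2::real) < (69315/100000)"
    using ln_approx_bounds[of 2 5] by (simp_all add: eval_nat_numeral)
  ultimately show "(23025/10000) < ln (10::real)" "ln (10::real) < (23028/10000)" by simp_all
qed

lemma has_integral_antiderivative:
  fixes F :: "real \<Rightarrow> real"
  assumes "a \<le> b" "\<And>x. (F has_real_derivative f x) (at x)"
  shows "(f has_integral F b - F a) {a..b}"
  using assms by (intro fundamental_theorem_of_calculus)
    (auto simp: has_real_derivative_iff_has_vector_derivative intro: has_vector_derivative_at_within)

lemma has_integral_cos:
  "(cos has_integral 2) {- (pi/2)..pi/2}"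
proof -
  have "(cos has_integral sin (pi/2) - sin (- (pi/2))) {- (pi/2)..pi/2}"
    by (rule has_integral_antiderivative) (auto intro!: derivative_eq_intros)
  then show ?thesis by simp
qed

lemma has_integral_cos_power2:
  "((\<lambda>x. cos x ^ 2) has_integral pi/2) {- (pi/2)..pi/2}"
proof -
  define F where "F x = (x + sin x * cos x) / 2" for x :: real
  have "((\<lambda>x. cos x ^ 2) has_integral F (pi/2) - F (- (pi/2))) {- (pi/2)..pi/2}"
  proof (rule has_integral_antiderivative)
    fix x :: real
    have "(F has_real_derivative (1 + (cos x * cos x - sin x * sin x)) / 2) (at x)"
      unfolding F_def by (auto intro!: derivative_eq_intros)
    moreover have "(1 + (cos x * cos x - sin x * sin x)) / 2 = cos x ^ 2"
      using sin_cos_squared_add[of x] by (simp add: power2_eq_square field_simps)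
    ultimately show "(F has_real_derivative cos x ^ 2) (at x)" by simp
  qed simp
  then show ?thesis by (simp add: F_def)
qed

lemma has_integral_cos_power3:
  "((\<lambda>x. cos x ^ 3) has_integral 4/3) {- (pi/2)..pi/2}"
proof -
  define F where "F x = sin x - sin x ^ 3 / 3" for x :: real
  have "((\<lambda>x. cos x ^ 3) has_integral F (pi/2) - F (- (pi/2))) {- (pi/2)..pi/2}"
  proof (rule has_integral_antiderivative)
    fix x :: real
    have "(F has_real_derivative (cos x - sin x ^ 2 * cos x)) (at x)"
      unfolding F_def by (auto intro!: derivative_eq_intros)
    moreover have "cos x - sin x ^ 2 * cos x = cos x ^ 3"
      unfolding sin_squared_eq[of x] by (simp add: power3_eq_cube power2_eq_square algebra_simps)
    ultimately show "(F has_real_derivative cos x ^ 3) (at x)" by simp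
  qed simp
  then show ?thesis by (simp add: F_def)
qed

lemma has_integral_cos_power4:
  "((\<lambda>x. cos x ^ 4) has_integral 3/8 * pi) {- (pi/2)..pi/2}"
proof -
  define F where "F x = cos x ^ 3 * sin x / 4 + 3/8 * (x + sin x * cos x)" for x :: real
  have "((\<lambda>x. cos x ^ 4) has_integral F (pi/2) - F (- (pi/2))) {- (pi/2)..pi/2}"
  proof (rule has_integral_antiderivative)
    fix x :: real
    have "(F has_real_derivative ((cos x ^ 3 * cos x - 3 * cos x ^ 2 * sin x * sin x) / 4 + 3/8 * (1 + (cos x * cos x - sin x * sin x)))) (at x)"
      unfolding F_def by (auto intro!: derivative_eq_intros simp: eval_nat_numeral field_simps)
    moreover have "(cos x ^ 3 * cos x - 3 * cos x ^ 2 * sin x * sin x) / 4 + 3/8 * (1 + (cos x * cos x - sin x * sin x)) = cos x ^ 4"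
    proof -
      have s: "sin x * sin x = 1 - cos x * cos x" using sin_squared_eq[of x] by (simp add: power2_eq_square)
      have "3 * cos x ^ 2 * sin x * sin x = 3 * cos x ^ 2 * (1 - cos x * cos x)" by (simp only: mult.assoc s)
      then show ?thesis unfolding s by (simp add: eval_nat_numeral field_simps)
    qed
    ultimately show "(F has_real_derivative cos x ^ 4) (at x)" by simp
  qed simp
  then show ?thesis by (simp add: F_def)
qed

text \<open>Continuity at 0 is the point: it allows the fundamental theorem with finitely many
  exceptional points to integrate across a logarithmic singularity.\<close>

lemma continuous_on_x_ln_abs: "continuous_on UNIV (\<lambda>x::real. x * ln \<bar>x\<bar>)"
proof -
  have "isCont (\<lambda>x::real. x * ln \<bar>x\<bar>) x" for x
  proof (cases "x = 0")
    case True
    have "((\<lambda>x::real. x * ln \<bar>x\<bar>) \<longlongrightarrow> 0) (at 0)"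
      unfolding filterlim_at_split by (intro conjI) real_asymp+
    then show ?thesis using True by (simp add: isCont_def)
  next
    case False
    then show ?thesis by (intro continuous_intros) auto
  qed
  then show ?thesis by (simp add: continuous_on_eq_continuous_at)
qed

lemma DERIV_x_ln_abs:
  fixes x :: real
  assumes "x \<noteq> 0"
  shows "((\<lambda>x. x * ln \<bar>x\<bar>) has_real_derivative ln \<bar>x\<bar> + 1) (at x)"
proof (cases "x > 0")
  case True
  have "((\<lambda>x. x * ln x) has_real_derivative ln x + 1) (at x)"
    using True by (auto intro!: derivative_eq_intros)
  then have "((\<lambda>x. x * ln \<bar>x\<bar>) has_real_derivative ln x + 1) (at x)"
    by (rule has_field_derivative_transform_within_open[of _ _ _ "{0<..}"]) (use True in auto)
  then show ?thesis using True by simp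
next
  case False
  then have "x < 0" using assms by simp
  have "((\<lambda>x. x * ln (- x)) has_real_derivative ln (- x) + 1) (at x)"
    using \<open>x < 0\<close> by (auto intro!: derivative_eq_intros simp: field_simps)
  then have "((\<lambda>x. x * ln \<bar>x\<bar>) has_real_derivative ln (- x) + 1) (at x)"
    by (rule has_field_derivative_transform_within_open[of _ _ _ "{..<0}"]) (use \<open>x < 0\<close> in auto)
  then show ?thesis using \<open>x < 0\<close> by simp
qed

text \<open>In the variable \<open>t = sin x\<close> the integrand is
  \<open>ln |t - a| + ln |t + a|\<close>. The antiderivative \<open>F\<close> is continuous
  everywhere and fails to be differentiable at most at the two angles with \<open>sin x = a\<close>
  or \<open>sin x = - a\<close>.\<close>

lemma has_integral_cos_ln_abs_sin_diff:
  fixes a :: real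
  assumes a: "0 < a" "a < 1"
  shows "((\<lambda>x. cos x * ln \<bar>sin x ^ 2 - a ^ 2\<bar>) has_integral
    2 * ((1 + a) * ln (1 + a) + (1 - a) * ln (1 - a) - 2)) {- (pi/2)..pi/2}"
proof -
  define g where "g x = x * ln \<bar>x\<bar>" for x :: real
  define F where "F x = g (sin x - a) + g (sin x + a) - 2 * sin x" for x
  have cg: "continuous_on UNIV g" unfolding g_def by (rule continuous_on_x_ln_abs)
  have "((\<lambda>x. cos x * ln \<bar>sin x ^ 2 - a ^ 2\<bar>) has_integral F (pi/2) - F (- (pi/2))) {- (pi/2)..pi/2}"
  proof (rule fundamental_theorem_of_calculus_strong[of "{arcsin a, arcsin (- a)}"])
    fix x assume x: "x \<in> {- (pi/2)..pi/2} - {arcsin a, arcsin (- a)}"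
    have ne: "sin x - a \<noteq> 0" "sin x + a \<noteq> 0"
    proof -
      have "x = arcsin (sin x)" using x by (simp add: arcsin_sin)
      then show "sin x - a \<noteq> 0" "sin x + a \<noteq> 0" using x by (auto simp: eq_neg_iff_add_eq_0[symmetric])
    qed
    have "((\<lambda>x. g (sin x - a)) has_real_derivative (ln \<bar>sin x - a\<bar> + 1) * cos x) (at x)"
      unfolding g_def by (rule DERIV_chain2[where f = "\<lambda>x. x * ln \<bar>x\<bar>" and g = "\<lambda>x. sin x - a", OF DERIV_x_ln_abs[OF ne(1)]]) (auto intro!: derivative_eq_intros)
    moreover have "((\<lambda>x. g (sin x + a)) has_real_derivative (ln \<bar>sin x + a\<bar> + 1) * cos x) (at x)"
      unfolding g_def by (rule DERIV_chain2[where f = "\<lambda>x. x * ln \<bar>x\<bar>" and g = "\<lambda>x. sin x + a", OF DERIV_x_ln_abs[OF ne(2)]]) (auto intro!: derivative_eq_intros)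
    ultimately have "(F has_real_derivative (ln \<bar>sin x - a\<bar> + 1) * cos x + (ln \<bar>sin x + a\<bar> + 1) * cos x - 2 * cos x) (at x)"
      unfolding F_def by (auto intro!: derivative_eq_intros)
    moreover have "ln \<bar>sin x ^ 2 - a ^ 2\<bar> = ln \<bar>sin x - a\<bar> + ln \<bar>sin x + a\<bar>"
    proof -
      have "sin x ^ 2 - a ^ 2 = (sin x - a) * (sin x + a)" by (simp add: power2_eq_square algebra_simps)
      then show ?thesis using ne by (simp add: abs_mult ln_mult)
    qed
    ultimately show "(F has_vector_derivative cos x * ln \<bar>sin x ^ 2 - a ^ 2\<bar>) (at x)"
      by (simp add: has_real_derivative_iff_has_vector_derivative algebra_simps)
  next
    show "continuous_on {- (pi/2)..pi/2} F"
      unfolding F_def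
      by (intro continuous_intros continuous_on_compose2[OF cg]) auto
  qed auto
  moreover have "F (pi/2) - F (- (pi/2)) = 2 * ((1 + a) * ln (1 + a) + (1 - a) * ln (1 - a) - 2)"
  proof -
    have "\<bar>- 1 - a\<bar> = 1 + a" "\<bar>- 1 + a\<bar> = 1 - a" using a by auto
    then show ?thesis using a by (simp add: F_def g_def algebra_simps)
  qed
  ultimately show ?thesis by simp
qed

lemma has_integral_cos_ln_sin_sum:
  fixes \<delta> :: real
  assumes \<delta>: "\<delta> > 0"
  shows "((\<lambda>x. cos x * ln (sin x ^ 2 + \<delta> ^ 2)) has_integral
    2 * (ln (1 + \<delta> ^ 2) - 2 + 2 * \<delta> * arctan (1 / \<delta>))) {- (pi/2)..pi/2}"
proof -
  define G where "G t = t * ln (t ^ 2 + \<delta> ^ 2) - 2 * t + 2 * \<delta> * arctan (t / \<delta>)" for t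
  have pos: "t ^ 2 + \<delta> ^ 2 > 0" for t :: real using \<delta> by (intro add_nonneg_pos) auto
  have G: "(G has_real_derivative ln (t ^ 2 + \<delta> ^ 2)) (at t)" for t
  proof -
    have "(G has_real_derivative (ln (t ^ 2 + \<delta> ^ 2) + t * (2 * t / (t ^ 2 + \<delta> ^ 2)) - 2 + 2 * \<delta> * (1 / \<delta> * inverse (1 + (t / \<delta>) ^ 2)))) (at t)"
      unfolding G_def using pos[of t] \<delta> by (auto intro!: derivative_eq_intros)
    moreover have "t * (2 * t / (t ^ 2 + \<delta> ^ 2)) - 2 + 2 * \<delta> * (1 / \<delta> * inverse (1 + (t / \<delta>) ^ 2)) = 0"
    proof -
      define S where "S = t ^ 2 + \<delta> ^ 2"
      have S: "S > 0" "t ^ 2 = S - \<delta> ^ 2" using pos[of t] by (simp_all add: S_def)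
      have "inverse (1 + (t / \<delta>) ^ 2) = \<delta> ^ 2 / S"
        using \<delta> pos[of t] by (simp add: S_def power_divide field_simps)
      then have "2 * \<delta> * (1 / \<delta> * inverse (1 + (t / \<delta>) ^ 2)) = 2 * (\<delta> ^ 2 / S)" using \<delta> by simp
      moreover have "t * (2 * t / S) = 2 * (t ^ 2 / S)" by (simp add: power2_eq_square)
      moreover have "t ^ 2 / S + \<delta> ^ 2 / S = 1" using S by (simp add: diff_divide_distrib)
      ultimately show ?thesis unfolding S_def[symmetric] by linarith
    qed
    ultimately show ?thesis by (simp add: algebra_simps)
  qed
  have "((\<lambda>x. cos x * ln (sin x ^ 2 + \<delta> ^ 2)) has_integral G (sin (pi/2)) - G (sin (- (pi/2)))) {- (pi/2)..pi/2}"
  proof (rule has_integral_antiderivative)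
    fix x :: real
    have "((\<lambda>x. G (sin x)) has_real_derivative ln (sin x ^ 2 + \<delta> ^ 2) * cos x) (at x)"
      by (rule DERIV_chain2[OF G]) (auto intro!: derivative_eq_intros)
    then show "((\<lambda>x. G (sin x)) has_real_derivative cos x * ln (sin x ^ 2 + \<delta> ^ 2)) (at x)"
      by (simp add: mult.commute)
  qed simp
  moreover have "G (sin (pi/2)) - G (sin (- (pi/2))) = 2 * (ln (1 + \<delta> ^ 2) - 2 + 2 * \<delta> * arctan (1 / \<delta>))"
    by (simp add: G_def arctan_minus algebra_simps)
  ultimately show ?thesis by (simp only:)
qed

text \<open>Applied with \<open>k = r / \<rho>\<close>, this is the weight of
  \<open>ln q / 2\<close>: the positive part selects the arc left of \<open>Re s = 1\<close>. The
  exact value is \<open>\<rho> (arccos k - k sqrt (1 - k^2))\<close>.\<close>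

lemma integral_cos_positive_part:
  fixes \<rho> k :: real
  assumes \<rho>: "\<rho> > 0" and k: "0 < k" "k < 1/10"
  shows "\<exists>J. ((\<lambda>x. cos x * max (\<rho> * cos x - \<rho> * k) 0) has_integral J) {- (pi/2)..pi/2} \<and>
    J \<le> \<rho> * (pi / 2 - 2 * k + (51/100) * k ^ 3)"
proof -
  define A where "A = arccos k"
  define s where "s = sqrt (1 - k ^ 2)"
  have "A \<le> arccos 0" unfolding A_def using k by (intro arccos_le_arccos) auto
  then have A: "0 \<le> A" "A \<le> pi/2" "cos A = k" using k by (auto simp: A_def arccos_lbound cos_arccos)
  have sA: "sin A = s" using k by (simp add: A_def s_def sin_arccos)
  define F where "F x = \<rho> * ((x + sin x * cos x) / 2) - \<rho> * k * sin x" for x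
  have "((\<lambda>x. cos x * (\<rho> * cos x - \<rho> * k)) has_integral F A - F (- A)) {- A..A}"
  proof (rule has_integral_antiderivative)
    fix x :: real
    have "(F has_real_derivative (\<rho> * ((1 + (cos x * cos x - sin x * sin x)) / 2) - \<rho> * k * cos x)) (at x)"
      unfolding F_def by (auto intro!: derivative_eq_intros)
    moreover have "(1 + (cos x * cos x - sin x * sin x)) / 2 = cos x * cos x"
      using sin_cos_squared_add[of x] by (simp add: power2_eq_square field_simps)
    ultimately have "(F has_real_derivative \<rho> * (cos x * cos x) - \<rho> * k * cos x) (at x)" by (simp only:)
    then show "(F has_real_derivative cos x * (\<rho> * cos x - \<rho> * k)) (at x)"
      by (simp add: algebra_simps)
  qed (use A in simp)
  then have "((\<lambda>x. if x \<in> {- A..A} then cos x * (\<rho> * cos x - \<rho> * k) else 0) has_integral F A - F (- A)) {- (pi/2)..pi/2}"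
    using A by (subst has_integral_restrict) auto
  moreover have "(if x \<in> {- A..A} then cos x * (\<rho> * cos x - \<rho> * k) else 0) = cos x * max (\<rho> * cos x - \<rho> * k) 0"
    if x: "x \<in> {- (pi/2)..pi/2}" for x
  proof (cases "\<bar>x\<bar> \<le> A")
    case True
    have "cos A \<le> cos \<bar>x\<bar>" using True A pi_gt_zero by (intro cos_monotone_0_pi_le) auto
    then have "\<rho> * k \<le> \<rho> * cos x" using A \<rho> by (intro mult_left_mono) auto
    then show ?thesis using True by (auto simp: abs_le_iff max_def)
  next
    case False
    have "cos \<bar>x\<bar> \<le> cos A" using False A x pi_gt_zero by (intro cos_monotone_0_pi_le) auto
    then have "\<rho> * cos x \<le> \<rho> * k" using A \<rho> by (intro mult_left_mono) auto
    then show ?thesis using False by (auto simp: abs_le_iff max_def)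
  qed
  ultimately have "((\<lambda>x. cos x * max (\<rho> * cos x - \<rho> * k) 0) has_integral F A - F (- A)) {- (pi/2)..pi/2}"
    by (rule has_integral_eq[rotated])
  moreover have "F A - F (- A) = \<rho> * (A - k * s)"
  proof -
    have "F (- A) = - F A" by (simp add: F_def field_simps)
    moreover have "2 * F A = \<rho> * (A - k * s)" by (simp add: F_def sA A(3) field_simps)
    ultimately show ?thesis by linarith
  qed
  moreover have "\<rho> * (A - k * s) \<le> \<rho> * (pi / 2 - 2 * k + (51/100) * k ^ 3)"
  proof (intro mult_left_mono)
    have "A \<le> pi / 2 - k"
    proof -
      have "sin k \<le> k" using k by (simp add: sin_x_le_x)
      then have "arcsin (sin k) \<le> arcsin k" using k by (intro arcsin_le_arcsin) auto
      then have "k \<le> arcsin k" using k pi_gt3 by (simp add: arcsin_sin)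
      moreover have "arccos k = pi / 2 - arcsin k" by (rule arccos_arcsin_eq) (use k in auto)
      ultimately show ?thesis unfolding A_def by linarith
    qed
    \<comment> \<open>The Taylor coefficient is 1/2; the surplus 0.01 pays for the quartic term when
      \<open>k < 1/10\<close>.\<close>
    moreover have "s \<ge> 1 - (51/100) * k ^ 2"
    proof -
      define K where "K = k ^ 2"
      have "K \<le> (1/10) ^ 2" unfolding K_def using k by (intro power_mono) auto
      then have K: "0 \<le> K" "K \<le> 1/100" by (auto simp: K_def power2_eq_square)
      have "K * K \<le> K * (1/100)" using K by (intro mult_left_mono)
      moreover have "(1 - (51/100) * K) ^ 2 = 1 - (102/100) * K + (2601/10000) * (K * K)"
        by (simp add: power2_eq_square algebra_simps)
      ultimately have "(1 - (51/100) * K) ^ 2 \<le> 1 - K" using K by linarith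
      then have "(1 - (51/100) * k ^ 2) ^ 2 \<le> 1 - k ^ 2" by (simp only: K_def)
      then show ?thesis unfolding s_def by (rule real_le_rsqrt)
    qed
    then have "k * s \<ge> k * (1 - (51/100) * k ^ 2)" using k by (intro mult_left_mono) auto
    ultimately show "A - k * s \<le> pi / 2 - 2 * k + (51/100) * k ^ 3"
      by (simp add: power3_eq_cube power2_eq_square algebra_simps)
  qed (use \<rho> in auto)
  ultimately show ?thesis by (intro exI[of _ "\<rho> * (A - k * s)"]) simp
qed

section \<open>Growth of the L-function\<close>

lemma completely_multiplicative_character:
  assumes char: "dirichlet_character q chi"
  shows "completely_multiplicative (\<lambda>n. chi (int n))"
  by unfold_locales
     (simp_all add: character_mult[OF char] character_1[OF char] norm_character_le_1[OF char])

text \<open>The continuation of the L-function to \<open>Re s > 0\<close>. The reciprocal Gamma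
  function is entire, so holomorphy needs no discussion of zeros or poles.\<close>

definition L_mellin :: "(int \<Rightarrow> complex) \<Rightarrow> complex \<Rightarrow> complex" where
  "L_mellin chi s = rGamma (s + 1) * mellin (\<lambda>v. char_power_series chi (exp (- v))) s"

context
  fixes q :: nat and chi :: "int \<Rightarrow> complex"
  assumes prim: "primitive_character q chi" and q: "q > 1"
begin

private lemmas char = primitive_imp_character[OF prim]

private definition P :: "real \<Rightarrow> complex" where
  "P v = char_power_series chi (exp (- v))"

private lemma L_mellin_eq: "L_mellin chi s = rGamma (s + 1) * mellin P s"
  by (simp add: L_mellin_def P_def[abs_def])

private lemma P_bounds:
  assumes "v > 0"
  shows "norm (P v) \<le> 1 / v\<^sup>2" "norm (P v) \<le> (sqrt q / 2) / v" "norm (P v) \<le> (2 * sqrt q) * exp (- v / 2) / v"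
proof -
  have e: "0 < exp (- v)" "exp (- v) < 1" using assms by auto
  note k = exp_kernel_bounds[OF assms]
  show "norm (P v) \<le> 1 / v\<^sup>2"
    unfolding P_def using norm_char_power_series_trivial[OF char e] k(1) by linarith
  have n: "norm (P v) \<le> sqrt q * (exp (- v) / (1 - (exp (- v))\<^sup>2))"
    unfolding P_def by (rule norm_char_power_series_le[OF prim q e])
  show "norm (P v) \<le> (sqrt q / 2) / v"
    using order.trans[OF n mult_left_mono[OF k(2)]] by simp
  show "norm (P v) \<le> (2 * sqrt q) * exp (- v / 2) / v"
    using order.trans[OF n mult_left_mono[OF k(3)]] by (simp add: mult_ac)
qed

private lemma P_continuous: "continuous_on {0<..} P"
proof -
  define Q where "Q v = (\<Sum>m<q. cnj (chi (int m)) * koebe_term q (exp (- v)) m) / cnj (gauss_sum q chi 1)" for v :: real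
  have g0: "gauss_sum q chi 1 \<noteq> 0" using norm_gauss_sum[OF prim] q by auto
  have "continuous_on {0<..} Q"
    unfolding Q_def koebe_term_def
  proof (intro continuous_intros ballI)
    fix m and v :: real assume "v \<in> {0<..}"
    then have "norm (complex_of_real (exp (- v)) * add_char q (- int m)) < 1" by (simp add: norm_mult)
    then have "complex_of_real (exp (- v)) * add_char q (- int m) \<noteq> 1" by auto
    then show "(1 - complex_of_real (exp (- v)) * add_char q (- int m))\<^sup>2 \<noteq> 0" by simp
  qed (use g0 in auto)
  moreover have "Q v = P v" if "v \<in> {0<..}" for v
    using char_power_series_sums[OF prim, of "exp (- v)"] that
    by (simp add: P_def Q_def char_power_series_def sums_iff)
  ultimately show ?thesis by (rule continuous_on_eq)
qed

lemma L_mellin_holomorphic: "L_mellin chi holomorphic_on {s. Re s > 0}"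
proof -
  have "mellin P holomorphic_on {s. Re s > 0}"
    by (rule mellin_holomorphic[OF P_continuous P_bounds(3)])
  then show ?thesis
    unfolding L_mellin_eq[abs_def] by (intro holomorphic_intros)
qed

lemma L_mellin_eq_series:
  assumes s: "Re s > 1"
  shows "L_mellin chi s = dseries (\<lambda>n. chi (int n)) s"
proof -
  interpret completely_multiplicative "\<lambda>n. chi (int n)"
    by (rule completely_multiplicative_character[OF char])
  define L where "L = dseries (\<lambda>n. chi (int n)) s"
  have sums: "(\<lambda>n. of_nat n * chi (int n) * (Gamma (s + 1) * of_nat n powr (- (s + 1)))) sums
      mellin P s"
    unfolding P_def[abs_def] char_power_series_def
    using norm_character_le_1[OF char] s by (intro mellin_dirichlet) auto
  have summand: "of_nat n * chi (int n) * (Gamma (s + 1) * of_nat n powr (- (s + 1))) =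
      Gamma (s + 1) * (chi (int n) / of_nat n powr s)" if "n > 0" for n
  proof -
    have "of_nat n powr (- (s + 1)) = of_nat n powr (- s) / complex_of_nat n"
      using that powr_diff[of "complex_of_nat n" "- s" 1] by simp
    then show ?thesis using that by (simp add: powr_minus divide_inverse)
  qed
  have "(\<lambda>n. of_nat (Suc n) * chi (int (Suc n)) * (Gamma (s + 1) * of_nat (Suc n) powr (- (s + 1)))) sums
      mellin P s"
    using sums sums_Suc_iff[of "\<lambda>n. of_nat n * chi (int n) * (Gamma (s + 1) * of_nat n powr (- (s + 1)))"
      "mellin P s"] by simp
  then have s1: "(\<lambda>n. Gamma (s + 1) * (chi (int (Suc n)) / of_nat (Suc n) powr s)) sums
      mellin P s"
    by (simp only: summand zero_less_Suc)
  have "(\<lambda>n. chi (int (Suc n)) / of_nat (Suc n) powr s) sums L"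
    unfolding L_def dseries_def
    by (rule has_sum_atLeast_1_imp_sums[OF has_sum_infsum[OF Infinite_Sum.abs_summable_summable[OF abs_summable_dseries[OF s]]]])
  then have "(\<lambda>n. Gamma (s + 1) * (chi (int (Suc n)) / of_nat (Suc n) powr s)) sums (Gamma (s + 1) * L)"
    by (rule sums_mult)
  with s1 have "mellin P s = Gamma (s + 1) * L"
    by (rule sums_unique2)
  moreover have "s + 1 \<notin> \<int>\<^sub>\<le>\<^sub>0"
    using s by (auto elim!: nonpos_Ints_cases simp: complex_eq_iff)
  then have "rGamma (s + 1) * Gamma (s + 1) = 1" by (simp add: rGamma_inverse_Gamma Gamma_eq_zero_iff)
  ultimately show ?thesis by (simp add: L_mellin_eq L_def flip: mult.assoc)
qed

text \<open>The half-plane \<open>Re z > 0\<close> serves as domain of continuation.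
  \<open>L_mellin\<close> is continuous also at 1, so the limit in \<open>L_value\<close> is its
  value there too.\<close>

lemma dirichlet_L_eq_mellin:
  assumes "Re s > 0"
  shows "dirichlet_L s chi = L_mellin chi s"
proof (rule dirichlet_L_eqI)
  have "L_mellin chi holomorphic_on ({z. Re z > 0} - {1})"
    by (rule holomorphic_on_subset[OF L_mellin_holomorphic]) auto
  moreover have "isCont (L_mellin chi) s"
    using holomorphic_on_imp_continuous_on[OF L_mellin_holomorphic] assms
    by (simp add: continuous_on_eq_continuous_at open_halfspace_Re_gt)
  then have "(L_mellin chi \<longlongrightarrow> L_mellin chi s) (at s)" by (simp add: isCont_def)
  ultimately show "L_value chi s (L_mellin chi s)"
    unfolding L_value_def using assms L_mellin_eq_series by (auto simp: dirichlet_series_def dseries_def)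
qed

text \<open>The Mellin bound with \<open>A = sqrt q / 2\<close> in logarithmic form. The reciprocal
  Gamma factor is split: \<open>norm_rGamma_le\<close> at \<open>s + 1\<close> accounts for the term
  with \<open>Im s\<close>, and the tangent of \<open>ln \<Gamma>\<close> at 3/2 for the last three
  terms.\<close>

lemma ln_norm_L_mellin_le:
  assumes s: "0 < Re s" "Re s < 1" and nz: "L_mellin chi s \<noteq> 0"
  shows "ln (norm (L_mellin chi s)) \<le> (1 - Re s) * (ln q / 2 - ln 2) - ln (Re s) - ln (1 - Re s)
    + (Im s)\<^sup>2 / (2 * Re s + 1) + ln 2 - ln pi / 2 - Digamma (3/2) * (Re s - 1/2)"
proof -
  define x where "x = Re s"
  have x: "0 < x" "x < 1" using s by (auto simp: x_def)
  define A where "A = sqrt q / 2"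
  have A: "A > 0" using q by (simp add: A_def)
  have b1: "norm (mellin P s) \<le> A powr (1 - x) / (x * (1 - x))"
    unfolding x_def
    by (rule mellin_bound[OF mellin_integrable[OF P_continuous P_bounds(3)]])
       (use P_bounds A s in \<open>auto simp: A_def\<close>)
  have b2: "norm (rGamma (s + 1)) \<le> rGamma (x + 1) * exp ((Im s)\<^sup>2 / (2 * x + 1))"
    using norm_rGamma_le[of "s + 1"] x by (simp add: x_def algebra_simps)
  have "Gamma (x + 1) > 0" using x by (intro Gamma_real_pos) auto
  moreover define g where "g = Gamma (x + 1)"
  ultimately have G: "g > 0" by simp
  have rG: "rGamma (x + 1) = inverse g" by (simp add: g_def rGamma_inverse_Gamma)
  have "norm (L_mellin chi s) = norm (rGamma (s + 1)) * norm (mellin P s)"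
    by (simp add: L_mellin_eq norm_mult)
  also have "\<dots> \<le> (rGamma (x + 1) * exp ((Im s)\<^sup>2 / (2 * x + 1))) * (A powr (1 - x) / (x * (1 - x)))"
    using b1 b2 by (intro mult_mono) (auto intro: order.trans[OF norm_ge_zero])
  finally have "ln (norm (L_mellin chi s)) \<le> ln ((rGamma (x + 1) * exp ((Im s)\<^sup>2 / (2 * x + 1))) * (A powr (1 - x) / (x * (1 - x))))"
    using nz by (subst ln_le_cancel_iff) (auto intro: order.strict_trans2[of 0 "norm (L_mellin chi s)"])
  also have "\<dots> = - ln g + (Im s)\<^sup>2 / (2 * x + 1) + (1 - x) * ln A - ln x - ln (1 - x)"
    unfolding rG using G A x by (simp add: ln_mult ln_div ln_powr ln_inverse)
  also have "ln A = ln q / 2 - ln 2"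
    using q by (simp add: A_def ln_div ln_sqrt)
  also have "- ln g \<le> ln 2 - ln pi / 2 - Digamma (3/2) * (x - 1/2)"
  proof -
    have "ln (Gamma (x + 1)) \<ge> ln (sqrt pi / 2) + Digamma (3/2) * (x + 1 - 3/2)"
      using x by (intro ln_Gamma_real_ge) simp
    moreover have "ln (sqrt pi / 2) = ln pi / 2 - ln 2" by (simp add: ln_div ln_sqrt)
    moreover have "x + 1 - 3/2 = x - 1/2" by simp
    ultimately show ?thesis by (simp add: g_def)
  qed
  finally show ?thesis unfolding x_def by linarith
qed

lemma abs_ln_norm_L_mellin_le:
  assumes s: "Re s > 1"
  shows "L_mellin chi s \<noteq> 0" "\<bar>ln (norm (L_mellin chi s))\<bar> \<le> ln (zeta_real (Re s))"
proof -
  interpret completely_multiplicative "\<lambda>n. chi (int n)"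
    by (rule completely_multiplicative_character[OF char])
  define D where "D = dseries (\<lambda>n. chi (int n)) s"
  have D: "L_mellin chi s = D" using L_mellin_eq_series[OF s] by (simp add: D_def)
  have up: "norm D \<le> zeta_real (Re s)" unfolding D_def by (rule norm_dseries_le) (simp_all add: bounded s)
  have lo: "1 \<le> norm D * zeta_real (Re s)" unfolding D_def by (rule norm_dseries_ge[OF s])
  then show nz: "L_mellin chi s \<noteq> 0" using D by auto
  have pos: "norm D > 0" using nz D by simp
  note pos = pos order.strict_trans2[OF pos up]
  have "ln (norm D) \<le> ln (zeta_real (Re s))" using up pos by simp
  moreover have "0 \<le> ln (norm D * zeta_real (Re s))" using lo by simp
  then have "0 \<le> ln (norm D) + ln (zeta_real (Re s))" using pos by (simp add: ln_mult)
  ultimately show "\<bar>ln (norm (L_mellin chi s))\<bar> \<le> ln (zeta_real (Re s))" unfolding D by linarith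
qed

end

section \<open>Explicit bounds for zeta and its derivative to the right of 1\<close>

lemma exp_minus_le_quadratic:
  fixes w :: real
  assumes "w \<ge> 0"
  shows "exp (- w) \<le> 1 - w + w\<^sup>2 / 2"
proof -
  have "(\<lambda>w. 1 - w + w\<^sup>2 / 2 - exp (- w)) 0 \<le> (\<lambda>w. 1 - w + w\<^sup>2 / 2 - exp (- w)) w"
  proof (rule DERIV_nonneg_imp_nondecreasing[OF assms])
    fix t :: real
    have "((\<lambda>w. 1 - w + w\<^sup>2 / 2 - exp (- w)) has_real_derivative (- 1 + t + exp (- t))) (at t)"
      by (auto intro!: derivative_eq_intros)
    moreover have "- 1 + t + exp (- t) \<ge> 0" using exp_ge_add_one_self[of "- t"] by linarith
    ultimately show "\<exists>y. ((\<lambda>w. 1 - w + w\<^sup>2 / 2 - exp (- w)) has_real_derivative y) (at t) \<and> 0 \<le> y" by blast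
  qed
  then show ?thesis by simp
qed

lemma zeta_real_ge_1:
  assumes "x > 1"
  shows "zeta_real x \<ge> 1"
proof -
  have s: "(\<lambda>n. real (Suc n) powr (- x)) sums zeta_real x" by (rule zeta_real_sums[OF assms])
  have "(\<Sum>n<1. real (Suc n) powr (- x)) \<le> (\<Sum>n. real (Suc n) powr (- x))"
    by (rule sum_le_suminf) (use s in \<open>auto simp only: sums_iff powr_ge_zero finite_lessThan\<close>)
  then show ?thesis using s by (simp only: sums_iff) simp
qed

text \<open>From \<open>zeta_real_upper\<close> it suffices that
  \<open>u + (3/2)^(- u) <= exp (0.595 u)\<close>; to first order the left side is
  \<open>1 + (1 - ln (3/2)) u\<close>, and \<open>0.595 = 1 - 0.405\<close> with
  \<open>0.405 < ln (3/2)\<close>. The quadratic coefficient is enlarged to match that of the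
  exponential.\<close>

lemma ln_zeta_real_le:
  assumes u: "u > 0"
  shows "ln (zeta_real (1 + u)) \<le> (595/1000) * u - ln u"
proof -
  have "(3/2::real) powr (- u) = exp (- (ln (3/2) * u))" by (simp add: powr_def mult.commute)
  also have "\<dots> \<le> exp (- ((405/1000) * u))" using ln_3_halves_bounds(1) u by simp
  also have "\<dots> \<le> 1 - (405/1000) * u + ((405/1000) * u)\<^sup>2 / 2" using u by (intro exp_minus_le_quadratic) simp
  also have "\<dots> \<le> 1 - (405/1000) * u + ((595/1000) * u)\<^sup>2 / 2"
    using u by (intro add_left_mono divide_right_mono power_mono) auto
  finally have e1: "(3/2) powr (- u) \<le> 1 - (405/1000) * u + ((595/1000) * u)\<^sup>2 / 2" .
  have "1 + (595/1000) * u + ((595/1000) * u)\<^sup>2 / 2 \<le> exp ((595/1000) * u)"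
    using exp_lower_Taylor_quadratic[of "(595/1000) * u"] u by simp
  then have "u + (3/2) powr (- u) \<le> exp ((595/1000) * u)" using e1 by linarith
  moreover have "zeta_real (1 + u) \<le> (u + (3/2) powr (- u)) / u"
    using zeta_real_upper[OF u] u by (simp add: add_divide_distrib)
  ultimately have "zeta_real (1 + u) \<le> exp ((595/1000) * u) / u"
    using u by (meson divide_right_mono less_imp_le order_trans)
  then have "ln (zeta_real (1 + u)) \<le> ln (exp ((595/1000) * u) / u)"
    using zeta_real_ge_1[of "1 + u"] u by (subst ln_le_cancel_iff) auto
  then show ?thesis using u by (simp add: ln_div)
qed

text \<open>With \<open>2^(- u) >= 1 - 0.6932 u\<close> the lower bound for zeta exceeds
  \<open>1 / u\<close> by at least \<open>1.25 - 0.6932 - 0.1733 u\<close>, which stays above 0.544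
  for \<open>u <= 0.07\<close>.\<close>

lemma zeta_real_ge:
  assumes u: "0 < u" "u \<le> (7/100)"
  shows "zeta_real (1 + u) \<ge> 1 / u + (544/1000)"
proof -
  have e: "(2::real) powr (- u) \<ge> 1 - (6932/10000) * u"
  proof -
    have "(2::real) powr (- u) = exp (- (ln 2 * u))" by (simp add: powr_def mult.commute)
    moreover have "exp (- (ln 2 * u)) \<ge> 1 + - (ln 2 * u)" by (rule exp_ge_add_one_self)
    moreover have "ln 2 * u \<le> (6932/10000) * u" using ln_2_bounds u by (intro mult_right_mono) auto
    ultimately show ?thesis by linarith
  qed
  have "2 powr (- 1 - u) / 2 = (2::real) powr (- u) / 4"
    by (simp add: powr_diff powr_minus field_simps)
  moreover have "2 powr (- u) / u \<ge> (1 - (6932/10000) * u) / u" using e u by (intro divide_right_mono) auto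
  moreover have "(1 - (6932/10000) * u) / u = 1 / u - (6932/10000)" using u by (simp add: diff_divide_distrib)
  ultimately show ?thesis using zeta_real_lower[OF u(1)] e u(2) by linarith
qed

text \<open>The terms at 2 and 3 contribute at most 0.3466 and 0.3663, the tail from 3 at most
  \<open>1 / u^2 - 0.556\<close>.\<close>

lemma ln_div_powr_sum_le:
  assumes u: "0 < u" "u \<le> (7/100)"
  shows "(\<Sum>\<^sub>\<infinity>n\<in>{1::nat..}. ln (real n) / real n powr (1 + u)) \<le> 1 / u\<^sup>2 + (16/100)"
proof -
  have a: "ln 2 * 2 powr (- 1 - u) \<le> ((6932/10000) * (1/2) :: real)"
  proof (intro mult_mono)
    have "(2::real) powr (- 1 - u) \<le> 2 powr (- 1)" using u by (intro powr_mono) auto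
    then show "(2::real) powr (- 1 - u) \<le> 1/2" by (simp add: powr_minus)
  qed (use ln_2_bounds in auto)
  have b: "ln 3 * 3 powr (- 1 - u) \<le> ((10988/10000) * (1/3) :: real)"
  proof (intro mult_mono)
    have "(3::real) powr (- 1 - u) \<le> 3 powr (- 1)" using u by (intro powr_mono) auto
    then show "(3::real) powr (- 1 - u) \<le> 1/3" by (simp add: powr_minus)
  qed (use ln_3_bounds in auto)
  define w where "w = ln 3 * u"
  have w: "w \<ge> 0" "(1098/1000) * u \<le> w" "w \<le> (10988/10000) * u" using u ln_3_bounds by (auto simp: w_def)
  have "3 powr (- u) * (ln 3 / u + 1 / u\<^sup>2) = exp (- w) * (1 + w) / u\<^sup>2"
    using u by (simp add: powr_def w_def field_simps power2_eq_square)
  also have "\<dots> \<le> (1 - w + w\<^sup>2 / 2) * (1 + w) / u\<^sup>2"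
    using w by (intro divide_right_mono mult_right_mono exp_minus_le_quadratic) auto
  also have "\<dots> = 1 / u\<^sup>2 - (w\<^sup>2 * (1 - w) / 2) / u\<^sup>2"
  proof -
    have "(1 - w + w\<^sup>2 / 2) * (1 + w) = 1 - w\<^sup>2 * (1 - w) / 2" by (simp add: power2_eq_square field_simps)
    then show ?thesis by (simp only: diff_divide_distrib)
  qed
  also have "\<dots> \<le> 1 / u\<^sup>2 - (556/1000)"
  proof -
    have "(1098/1000)\<^sup>2 * u\<^sup>2 \<le> w\<^sup>2" using w u by (simp add: power_mult_distrib[symmetric] power_mono)
    moreover have "1 - w \<ge> (923/1000)" using w u by linarith
    ultimately have "((1098/1000)\<^sup>2 * u\<^sup>2) * (923/1000) \<le> w\<^sup>2 * (1 - w)" by (intro mult_mono) auto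
    moreover have "(1112/1000) * u\<^sup>2 \<le> ((1098/1000)\<^sup>2 * (923/1000)) * u\<^sup>2"
      by (intro mult_right_mono) (auto simp: power2_eq_square)
    ultimately have "(556/1000) * u\<^sup>2 \<le> w\<^sup>2 * (1 - w) / 2" by (simp add: mult_ac)
    then have "556/1000 \<le> (w\<^sup>2 * (1 - w) / 2) / u\<^sup>2"
      using u by (subst pos_le_divide_eq) auto
    then show ?thesis by linarith
  qed
  finally show ?thesis using ln_div_powr_sum_upper[OF u(1)] a b by simp
qed

section \<open>The integral over the circle\<close>

text \<open>The outer quarters of \<open>[0, 2 pi]\<close> form the right half of the circle by
  periodicity; the middle piece is the left half, shifted by \<open>pi\<close>.\<close>

lemma integral_symmetric_half_period:
  fixes g :: "real \<Rightarrow> real"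
  assumes per: "\<And>x. g (x + 2 * pi) = g x" and int: "(g has_integral I) {0..2 * pi}"
  shows "((\<lambda>x. g x + g (x + pi)) has_integral I) {- (pi/2)..pi/2}"
proof -
  have sub: "g integrable_on {a..b}" if "0 \<le> a" "b \<le> 2 * pi" for a b
  proof (rule integrable_subinterval_real)
    show "g integrable_on {0..2 * pi}" using int by (rule has_integral_integrable)
    show "{a..b} \<subseteq> {0..2 * pi}" using that by (rule atLeastatMost_subset_iff[THEN iffD2, OF disjI2, OF conjI])
  qed
  define A where "A = integral {0..pi/2} g"
  define B where "B = integral {pi/2..3*pi/2} g"
  define C where "C = integral {3*pi/2..2*pi} g"
  have hA: "(g has_integral A) {0..pi/2}" and hB: "(g has_integral B) {pi/2..3*pi/2}"
    and hC: "(g has_integral C) {3*pi/2..2*pi}"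
    unfolding A_def B_def C_def using sub pi_gt_zero by (auto intro!: integrable_integral)
  have "(g has_integral (A + B) + C) {0..2*pi}"
    by (rule has_integral_combine[of _ "3*pi/2", OF _ _ has_integral_combine[of _ "pi/2", OF _ _ hA hB] hC])
       (use pi_gt_zero in auto)
  then have I: "I = A + B + C" using int has_integral_unique by blast
  have "((\<lambda>x. g (x + pi)) has_integral B) {pi/2 - pi..3*pi/2 - pi}"
    by (rule has_integral_shift_real_ivl[OF hB])
  moreover have "pi/2 - pi = - (pi/2)" "3*pi/2 - pi = pi/2" by simp_all
  ultimately have 1: "((\<lambda>x. g (x + pi)) has_integral B) {- (pi/2)..pi/2}" by simp
  have "((\<lambda>x. g (x + 2 * pi)) has_integral C) {3*pi/2 - 2*pi..2*pi - 2*pi}"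
    by (rule has_integral_shift_real_ivl[OF hC])
  moreover have "3*pi/2 - 2*pi = - (pi/2)" by simp
  ultimately have "(g has_integral C) {- (pi/2)..0}" by (simp add: per)
  then have "(g has_integral C + A) {- (pi/2)..pi/2}"
    using hA by (intro has_integral_combine[of _ 0]) auto
  from has_integral_add[OF this 1] show ?thesis by (simp add: I algebra_simps)
qed

text \<open>Up to the term with \<open>ln q\<close>, the bound for the difference of \<open>ln \<bar>L\<bar>\<close> at the opposite points
  \<open>1 + r - \<rho> cis \<theta>\<close> and \<open>1 + r + \<rho> cis \<theta>\<close>, where \<open>c = cos \<theta>\<close>.\<close>

definition circle_weight :: "real \<Rightarrow> real \<Rightarrow> real \<Rightarrow> real" where
  "circle_weight r \<rho> c = (119/200) * (r + \<rho> * c) - (\<rho> * c - r) * ln 2 - ln \<bar>r\<^sup>2 - (\<rho> * c)\<^sup>2\<bar> - ln (1 + r - \<rho> * c)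
     + \<rho>\<^sup>2 * (1 - c\<^sup>2) / (3 + 2 * r - 2 * \<rho> * c) + ln 2 - ln pi / 2 - Digamma (3/2) * (1/2 + r - \<rho> * c)"

lemma Digamma_three_halves_less: "Digamma (3/2 :: real) < 383/10000"
  using Digamma_three_halves_bounds(2) ln_2_bounds by linarith

lemma ln_pi_bounds: "(1144/1000) < ln pi" "ln pi < (11452/10000)"
proof -
  have "ln (314/100 :: real) = ln 2 + ln (157/100)" using ln_mult[of 2 "157/100 :: real"] by simp
  moreover have "(451/1000) < ln (157/100 :: real)"
    using ln_approx_bounds[of "157/100" 3] by (simp_all add: eval_nat_numeral)
  ultimately have "1144/1000 < ln (314/100 :: real)" using ln_2_bounds by linarith
  also have "\<dots> < ln pi" using pi_bounds by (subst ln_less_cancel_iff) auto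
  finally show "(1144/1000) < ln pi" .
  have "ln (31417/10000 :: real) = ln 2 + ln (31417/20000)" using ln_mult[of 2 "31417/20000 :: real"] by simp
  moreover have "ln (31417/20000 :: real) < 4519/10000"
    using ln_approx_bounds[of "31417/20000" 3] by (simp_all add: eval_nat_numeral)
  ultimately have "ln (31417/10000 :: real) < 11452/10000" using ln_2_bounds by linarith
  moreover have "ln pi < ln (31417/10000)" using pi_bounds by (subst ln_less_cancel_iff) auto
  ultimately show "ln pi < (11452/10000)" by linarith
qed

text \<open>The term \<open>- (\<rho> cos \<theta> - r) ln 2\<close> is kept without positive part,
  so that one formula serves on both sides of the line \<open>Re s = 1\<close>. The singular terms
  of the two points, \<open>- ln |1 - x|\<close> and \<open>- ln (r + \<rho> cos \<theta>)\<close>,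
  merge into one logarithm; 119/200 is the 0.595 of \<open>ln_zeta_real_le\<close>.\<close>

lemma ln_norm_L_circle_diff_le:
  assumes prim: "primitive_character q chi" and q: "q > 1"
    and r: "0 < r" "r \<le> 7/100" and \<rho>: "0 < \<rho>" "\<rho> < r + 7/8" and c: "cos \<theta> > 0" "\<rho> * cos \<theta> \<noteq> r"
    and nz: "L_mellin chi (of_real (1 + r) - \<rho> * cis \<theta>) \<noteq> 0"
  shows "ln (norm (L_mellin chi (of_real (1 + r) - \<rho> * cis \<theta>))) - ln (norm (L_mellin chi (of_real (1 + r) + \<rho> * cis \<theta>)))
    \<le> max (\<rho> * cos \<theta> - r) 0 * (ln q / 2) + circle_weight r \<rho> (cos \<theta>)"
proof -
  define c' where "c' = cos \<theta>"
  define s where "s = complex_of_real (1 + r) - \<rho> * cis \<theta>"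
  define s' where "s' = complex_of_real (1 + r) + \<rho> * cis \<theta>"
  define x where "x = 1 + r - \<rho> * c'"
  have c': "0 < c'" "c' \<le> 1" "\<rho> * c' \<noteq> r" using c by (auto simp: c'_def)
  have Re: "Re s = x" "(Im s)\<^sup>2 = \<rho>\<^sup>2 * (1 - c'\<^sup>2)" "Re s' = 1 + (r + \<rho> * c')"
    by (simp_all add: s_def s'_def x_def c'_def power_mult_distrib sin_squared_eq)
  have "\<rho> * c' \<le> \<rho> * 1" using c' \<rho> by (intro mult_left_mono) auto
  then have x: "x > 1/8" unfolding x_def using \<rho> by linarith
  have u': "r + \<rho> * c' > 0" using r \<rho> c' by (intro add_pos_pos) auto
  have R: "- ln (norm (L_mellin chi s')) \<le> (119/200) * (r + \<rho> * c') - ln (r + \<rho> * c')"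
    using abs_ln_norm_L_mellin_le(2)[OF prim q, of s'] ln_zeta_real_le[OF u'] u' Re by simp
  have dg: "0 < Digamma (3/2 :: real)" "Digamma (3/2 :: real) < 383/10000"
    using Digamma_three_halves_bounds Digamma_three_halves_less by auto
  have y0: "\<rho>\<^sup>2 * (1 - c'\<^sup>2) / (2 * x + 1) \<ge> 0"
    using x c' by (intro divide_nonneg_nonneg mult_nonneg_nonneg) (auto simp: power_le_one)
  have L: "ln (norm (L_mellin chi s)) \<le> max (\<rho> * c' - r) 0 * (ln q / 2) - (\<rho> * c' - r) * ln 2 - ln x - ln \<bar>1 - x\<bar>
      + \<rho>\<^sup>2 * (1 - c'\<^sup>2) / (2 * x + 1) + ln 2 - ln pi / 2 - Digamma (3/2) * (x - 1/2)"
  proof (cases "x < 1")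
    case True
    have m: "\<rho> * c' - r = 1 - x" "max (1 - x) 0 = 1 - x" "\<bar>1 - x\<bar> = 1 - x" using True by (auto simp: x_def)
    have "L_mellin chi s \<noteq> 0" using nz by (simp add: s_def)
    then have "ln (norm (L_mellin chi s)) \<le> (1 - x) * (ln q / 2 - ln 2) - ln x - ln (1 - x)
        + \<rho>\<^sup>2 * (1 - c'\<^sup>2) / (2 * x + 1) + ln 2 - ln pi / 2 - Digamma (3/2) * (x - 1/2)"
      using ln_norm_L_mellin_le[OF prim q, of s] x True unfolding Re by simp
    then show ?thesis unfolding m by (simp add: right_diff_distrib)
  next
    case False
    \<comment> \<open>the left point still lies to the right of 1, where the zeta bound is below the same expression\<close>
    then have x1: "x > 1" using c' by (simp add: x_def less_le)
    define u where "u = x - 1"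
    have "\<rho> * c' > 0" using \<rho> c' by simp
    then have "u \<le> 7/100" unfolding u_def x_def using r by linarith
    then have u: "0 < u" "u \<le> 7/100" "x = 1 + u" using x1 by (auto simp: u_def)
    have m: "\<rho> * c' - r = - u" "max (- u) 0 = 0" "\<bar>1 - x\<bar> = u" using x1 by (auto simp: x_def u_def)
    have "ln (norm (L_mellin chi s)) \<le> (119/200) * u - ln u"
      using abs_ln_norm_L_mellin_le(2)[OF prim q, of s] ln_zeta_real_le[OF u(1)] x1 Re u by simp
    \<comment> \<open>The constant \<open>ln 2 - ln pi / 2\<close>, about 0.12, outweighs
      \<open>ln x\<close> and the Digamma term because \<open>u <= 0.07\<close>.\<close>
    moreover have "ln x \<le> u" using ln_add_one_self_le_self[of u] u by simp
    moreover have "Digamma (3/2) * (x - 1/2) \<le> (383/10000) * (57/100)"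
      using dg u by (intro mult_mono) auto
    moreover have "u * (693/1000) \<le> u * ln 2" using u ln_2_bounds by (intro mult_left_mono) auto
    ultimately show ?thesis unfolding m mult_zero_left mult_minus_left using y0 ln_2_bounds ln_pi_bounds u by linarith
  qed
  have "\<bar>r\<^sup>2 - (\<rho> * c')\<^sup>2\<bar> = \<bar>1 - x\<bar> * (r + \<rho> * c')"
  proof -
    have "r\<^sup>2 - (\<rho> * c')\<^sup>2 = (r - \<rho> * c') * (r + \<rho> * c')" by (simp add: power2_eq_square algebra_simps)
    then show ?thesis using u' by (simp add: abs_mult x_def abs_minus_commute)
  qed
  moreover have "\<bar>1 - x\<bar> > 0" using c' by (simp add: x_def)
  ultimately have sq: "ln \<bar>r\<^sup>2 - (\<rho> * c')\<^sup>2\<bar> = ln \<bar>1 - x\<bar> + ln (r + \<rho> * c')" using u' by (simp add: ln_mult)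
  have e: "2 * x + 1 = 3 + 2 * r - 2 * \<rho> * c'" "x - 1/2 = 1/2 + r - \<rho> * c'" by (simp_all add: x_def)
  show ?thesis
    using L[unfolded e] R sq unfolding circle_weight_def s_def[symmetric] s'_def[symmetric] c'_def[symmetric] x_def[symmetric]
    by linarith
qed

text \<open>The cubic Taylor polynomial of \<open>1 / u\<close> at 1; its remainder
  \<open>(1 - u)^4 / u\<close> has an even power and therefore a sign.\<close>

lemma inverse_ge_cubic:
  fixes u :: real
  assumes "u > 0"
  shows "1 / u \<ge> 4 - 6 * u + 4 * u^2 - u^3"
proof -
  have "u * (4 - 6 * u + 4 * u^2 - u^3) = 1 - (1 - u)^4" by (simp add: eval_nat_numeral algebra_simps)
  also have "\<dots> \<le> 1" by simp
  finally show ?thesis using assms by (simp add: pos_le_divide_eq mult.commute)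
qed

text \<open>The bound of \<open>inverse_ge_cubic\<close> at \<open>u = X / 1.8\<close>, with \<open>X = 3.0954 - 1.8454 c\<close> a lower bound for the
  denominator in \<open>gamma_cubic_ge\<close> and \<open>0.8921\<close> an upper bound for \<open>\<rho>\<^sup>2\<close>.\<close>

definition gamma_cubic :: "real \<Rightarrow> real" where
  "gamma_cubic c = 22157402138906287/51721048867500000 - (1015516780531/1868467500000) * c
     + (1995511727/1822500000) * c^2 - (15886614931/16402500000) * c^3"

lemma gamma_cubic_ge:
  assumes r: "477/10000 \<le> r" "r \<le> 695/10000" and \<rho>: "0 < \<rho>" "\<rho> < r + 7/8" and c: "0 \<le> c" "c \<le> 1"
  shows "\<rho>\<^sup>2 * (1 - c\<^sup>2) / (3 + 2 * r - 2 * \<rho> * c) \<le> gamma_cubic c"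
proof -
  define X where "X = 30954/10000 - (18454/10000) * c"
  have X: "X > 0" "c = (30954/10000 - X) / (18454/10000)" using c by (auto simp: X_def)
  \<comment> \<open>With \<rho> raised to \<open>r + 7/8\<close> the denominator becomes
    \<open>3 - 7 c / 4 + 2 r (1 - c)\<close>, which increases with \<open>r\<close>; the smallest
    admissible \<open>r\<close> yields \<open>X\<close>.\<close>
  have "\<rho> * c \<le> (r + 7/8) * c" using \<rho> c by (intro mult_right_mono) auto
  moreover have "(477/10000) * (1 - c) \<le> r * (1 - c)" using r c by (intro mult_right_mono) auto
  moreover define P where "P = \<rho> * c"
  moreover define Q where "Q = r * c"
  ultimately have "P \<le> Q + (7/8) * c" "(477/10000) * (1 - c) \<le> r - Q"
    by (simp_all only: distrib_right right_diff_distrib mult_1_right)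
  then have "3 - (7/4) * c + 2 * ((477/10000) * (1 - c)) \<le> 3 + 2 * r - 2 * P" by linarith
  moreover have "X = 3 - (7/4) * c + 2 * ((477/10000) * (1 - c))" by (simp add: X_def field_simps)
  ultimately have "3 + 2 * r - 2 * P \<ge> X" by (simp only:)
  then have den: "3 + 2 * r - 2 * \<rho> * c \<ge> X" by (simp add: P_def mult.assoc)
  have "\<rho>\<^sup>2 \<le> (9445/10000)\<^sup>2" using r \<rho> by (intro power_mono) auto
  then have num: "\<rho>\<^sup>2 \<le> 8921/10000" by (simp add: power2_eq_square)
  have c2: "0 \<le> 1 - c\<^sup>2" using c by (simp add: power_le_one)
  have "\<rho>\<^sup>2 * (1 - c\<^sup>2) / (3 + 2 * r - 2 * \<rho> * c) \<le> (8921/10000) * (1 - c\<^sup>2) / X"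
    using den num c2 X(1) by (intro frac_le mult_right_mono mult_nonneg_nonneg) auto
  \<comment> \<open>Polynomial division by \<open>X\<close>, using that \<open>1 - c^2\<close> is
    quadratic in \<open>X\<close>: now \<open>1 / X\<close> occurs once, with a negative
    coefficient, so a lower bound for it suffices.\<close>
  also have "\<dots> = (8921/10000) / (18454/10000)^2 * (2 * (30954/10000) - X - ((30954/10000)^2 - (18454/10000)^2) * (1 / X))"
    unfolding X(2) using X(1) by (simp add: field_simps power2_eq_square)
  also have "\<dots> \<le> (8921/10000) / (18454/10000)^2 * (2 * (30954/10000) - X - ((30954/10000)^2 - (18454/10000)^2) *
      ((4 - 6 * (X / (18/10)) + 4 * (X / (18/10))^2 - (X / (18/10))^3) / (18/10)))"
  proof (intro mult_left_mono diff_left_mono)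
    have "1 / (X / (18/10)) / (18/10) \<ge> (4 - 6 * (X / (18/10)) + 4 * (X / (18/10))^2 - (X / (18/10))^3) / (18/10)"
      using X by (intro divide_right_mono inverse_ge_cubic) auto
    moreover have "1 / (X / (18/10)) / (18/10) = 1 / X" by simp
    ultimately show "(4 - 6 * (X / (18/10)) + 4 * (X / (18/10))^2 - (X / (18/10))^3) / (18/10) \<le> 1 / X" by simp
  qed (auto simp: power2_eq_square)
  also have "\<dots> = gamma_cubic c"
    unfolding X_def gamma_cubic_def by (simp add: power2_eq_square power3_eq_cube field_simps)
  finally show ?thesis .
qed

text \<open>Here \<open>9/5\<close> is the point of tangency in the estimate of \<open>ln (1 + r + \<rho> cos \<theta>)\<close>, and \<open>0.53\<close> is chosen
  so that \<open>\<rho>\<^sup>2 (1 + 0.53\<^sup>2) \<le> (1 + r)\<^sup>2\<close>.\<close>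

definition circle_majorant :: "real \<Rightarrow> real \<Rightarrow> real \<Rightarrow> real" where
  "circle_majorant r \<rho> \<theta> = - 4 * ln \<rho> - ln \<bar>sin \<theta> ^ 2 - (sqrt (1 - (r / \<rho>)\<^sup>2))\<^sup>2\<bar> - ln (sin \<theta> ^ 2 + (53/100)\<^sup>2)
    + ((119/200) * r + r * ln 2 + ln (9/5) - 1 + (1 + r) / (9/5) + ln 2 - ln pi / 2 - Digamma (3/2) * (1/2 + r))
    + ((119/200) * \<rho> - \<rho> * ln 2 + \<rho> / (9/5) + Digamma (3/2) * \<rho>) * cos \<theta> + gamma_cubic (cos \<theta>)"

text \<open>The term \<open>- ln (1 + r - \<rho> cos \<theta>)\<close> is made symmetric in
  \<open>cos \<theta>\<close> by adding and subtracting
  \<open>ln (1 + r + \<rho> cos \<theta>)\<close>. The product of the two arguments is at least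
  \<open>\<rho>^2 (sin^2 \<theta> + 0.53^2)\<close>, whose logarithm has an elementary integral
  against \<open>cos \<theta>\<close>, and the logarithm added is bounded by a tangent line.\<close>

lemma circle_weight_le:
  assumes r: "477/10000 \<le> r" "r \<le> 695/10000" and \<rho>: "r + 874/1000 \<le> \<rho>" "\<rho> < r + 7/8"
    and c: "0 \<le> cos \<theta>" "\<rho> * cos \<theta> \<noteq> r"
  shows "circle_weight r \<rho> (cos \<theta>) \<le> circle_majorant r \<rho> \<theta>"
proof -
  have \<rho>0: "\<rho> > 0" using \<rho> r by linarith
  have k: "0 < r / \<rho>" "r / \<rho> < 1" using r \<rho> by auto
  then have "(r / \<rho>)\<^sup>2 < 1" by (simp add: power_less_one_iff)
  then have a2: "(sqrt (1 - (r / \<rho>)\<^sup>2))\<^sup>2 = 1 - (r / \<rho>)\<^sup>2" by simp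
  have sc: "sin \<theta> ^ 2 = 1 - cos \<theta> ^ 2" by (rule sin_squared_eq)
  have "r\<^sup>2 - (\<rho> * cos \<theta>)\<^sup>2 = \<rho>\<^sup>2 * (sin \<theta> ^ 2 - (1 - (r / \<rho>)\<^sup>2))"
    using \<rho>0 by (simp add: sc power_mult_distrib power_divide field_simps)
  then have eq: "\<bar>r\<^sup>2 - (\<rho> * cos \<theta>)\<^sup>2\<bar> = \<rho>\<^sup>2 * \<bar>sin \<theta> ^ 2 - (1 - (r / \<rho>)\<^sup>2)\<bar>"
    by (simp add: abs_mult)
  have "\<bar>r\<^sup>2 - (\<rho> * cos \<theta>)\<^sup>2\<bar> > 0"
  proof -
    have "r\<^sup>2 \<noteq> (\<rho> * cos \<theta>)\<^sup>2" using c r \<rho>0 by (simp add: power2_eq_iff_nonneg)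
    then show ?thesis by simp
  qed
  then have "\<bar>sin \<theta> ^ 2 - (1 - (r / \<rho>)\<^sup>2)\<bar> > 0" unfolding eq using \<rho>0 by (simp add: zero_less_mult_iff)
  then have 1: "ln \<bar>r\<^sup>2 - (\<rho> * cos \<theta>)\<^sup>2\<bar> = 2 * ln \<rho> + ln \<bar>sin \<theta> ^ 2 - (1 - (r / \<rho>)\<^sup>2)\<bar>"
    unfolding eq using \<rho>0 by (simp add: ln_mult ln_realpow)
  define B where "B = 1 + r"
  have "\<rho> * cos \<theta> \<le> \<rho> * 1" using \<rho>0 by (intro mult_left_mono) auto
  then have m: "B - \<rho> * cos \<theta> > 0" unfolding B_def using \<rho> by linarith
  have m: "B - \<rho> * cos \<theta> > 0" "B + \<rho> * cos \<theta> > 0" using m \<rho>0 c r by (auto simp: B_def intro: add_pos_nonneg)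
  have s0: "sin \<theta> ^ 2 + (53/100)\<^sup>2 > 0" by (intro add_nonneg_pos) auto
  have "\<rho>\<^sup>2 * (sin \<theta> ^ 2 + (53/100)\<^sup>2) \<le> (B - \<rho> * cos \<theta>) * (B + \<rho> * cos \<theta>)"
  proof -
    \<comment> \<open>1.132 slightly exceeds \<open>sqrt (1 + 0.53^2)\<close>; the inequality
      follows from \<open>\<rho> < r + 7/8\<close> and \<open>r <= 0.0695\<close>.\<close>
    have "\<rho> * (1132/1000) \<le> B" using r \<rho> by (simp add: B_def)
    then have "(\<rho> * (1132/1000))\<^sup>2 \<le> B\<^sup>2" using \<rho>0 by (intro power_mono) auto
    then have "\<rho>\<^sup>2 * (1132/1000)\<^sup>2 \<le> B\<^sup>2" by (simp only: power_mult_distrib)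
    moreover have "\<rho>\<^sup>2 * (1 + (53/100)\<^sup>2) \<le> \<rho>\<^sup>2 * (1132/1000)\<^sup>2" by (intro mult_left_mono) (auto simp: power2_eq_square)
    ultimately have "\<rho>\<^sup>2 * (1 + (53/100)\<^sup>2) \<le> B\<^sup>2" by linarith
    moreover have "(B - \<rho> * cos \<theta>) * (B + \<rho> * cos \<theta>) = B\<^sup>2 - \<rho>\<^sup>2 * cos \<theta> ^ 2"
      by (simp add: power2_eq_square algebra_simps)
    moreover have "\<rho>\<^sup>2 * (sin \<theta> ^ 2 + (53/100)\<^sup>2) = \<rho>\<^sup>2 * (1 + (53/100)\<^sup>2) - \<rho>\<^sup>2 * cos \<theta> ^ 2"
      unfolding sc by (simp only: distrib_left right_diff_distrib)
    ultimately show ?thesis by linarith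
  qed
  then have "ln (\<rho>\<^sup>2 * (sin \<theta> ^ 2 + (53/100)\<^sup>2)) \<le> ln ((B - \<rho> * cos \<theta>) * (B + \<rho> * cos \<theta>))"
    using \<rho>0 s0 m by (subst ln_le_cancel_iff) auto
  then have 2: "2 * ln \<rho> + ln (sin \<theta> ^ 2 + (53/100)\<^sup>2) \<le> ln (B - \<rho> * cos \<theta>) + ln (B + \<rho> * cos \<theta>)"
    using \<rho>0 s0 m by (simp add: ln_mult ln_realpow)
  have "ln ((B + \<rho> * cos \<theta>) / (9/5)) \<le> (B + \<rho> * cos \<theta>) / (9/5) - 1"
    using m by (intro ln_le_minus_one) auto
  moreover have "ln ((B + \<rho> * cos \<theta>) / (9/5)) = ln (B + \<rho> * cos \<theta>) - ln (9/5)"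
    by (subst ln_div) (use m in auto)
  ultimately have 3: "ln (B + \<rho> * cos \<theta>) \<le> ln (9/5) + (B + \<rho> * cos \<theta>) / (9/5) - 1" by linarith
  have 4: "\<rho>\<^sup>2 * (1 - cos \<theta> ^ 2) / (3 + 2 * r - 2 * \<rho> * cos \<theta>) \<le> gamma_cubic (cos \<theta>)"
    by (rule gamma_cubic_ge[OF r \<rho>0 \<rho>(2) c(1)]) simp
  show ?thesis
    using 1 2 3 4 unfolding circle_weight_def circle_majorant_def a2 B_def by (simp add: algebra_simps add_divide_distrib)
qed

lemma ln_9_fifths_less: "ln (9/5 :: real) < 5879/10000"
  using ln_approx_bounds[of "9/5" 3] by (simp_all add: eval_nat_numeral)

text \<open>With \<open>d = 1 - a\<close> this controls the value of the logarithmic integral with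
  parameter \<open>a\<close>. The first summand is estimated near 2, and \<open>d ln d\<close> by
  its tangent at 1/400, inside the range of \<open>d\<close>.\<close>

lemma entropy_ge:
  fixes d :: real
  assumes d: "0 < d" "d \<le> 275/100000"
  shows "(2 - d) * ln (2 - d) + d * ln d \<ge> 1365/1000"
proof -
  have "ln ((2 - d) / 2) \<ge> 1 - 1 / ((2 - d) / 2)"
    using ln_le_minus_one[of "1 / ((2 - d) / 2)"] d by (simp add: ln_div)
  then have "(2 - d) * (ln (2 - d) - ln 2) \<ge> (2 - d) * (1 - 2 / (2 - d))"
    using d by (intro mult_left_mono) (auto simp: ln_div)
  also have "(2 - d) * (1 - 2 / (2 - d)) = - d" using d by (simp add: field_simps)
  finally have 1: "(2 - d) * ln (2 - d) \<ge> (2 - d) * ln 2 - d" by (simp add: algebra_simps)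
  have "ln (400 :: real) = 2 * ln 10 + 2 * ln 2"
    using ln_mult[of 100 "4 :: real"] ln_realpow[of 10 2] ln_realpow[of 2 2] by simp
  then have l400: "ln (400 :: real) \<le> 5992/1000" using ln_10_bounds ln_2_bounds by simp
  have "ln (1 / (400 * d)) \<le> 1 / (400 * d) - 1" using d by (intro ln_le_minus_one) auto
  then have "d * (- ln 400 - ln d) \<le> d * (1 / (400 * d) - 1)"
    using d by (intro mult_left_mono) (auto simp: ln_div ln_mult)
  also have "\<dots> = 1/400 - d" using d by (simp add: field_simps)
  finally have 2: "d * ln d \<ge> d - 1/400 - d * ln 400" by (simp add: algebra_simps)
  have 3: "d * ln 400 \<le> d * (5992/1000)" using d l400 by (intro mult_left_mono) auto
  have 4: "d * ln 2 \<le> d * (6932/10000)" using d ln_2_bounds by (intro mult_left_mono) auto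
  have "(2 - d) * ln 2 = 2 * ln 2 - d * ln 2" by (rule left_diff_distrib)
  then show ?thesis using 1 2 3 4 d ln_2_bounds by linarith
qed

text \<open>\<open>J\<close> is an exact integral; only its evaluation is numerical. The linear
  bound is fitted so that, after adding the zeta contribution \<open>- 0.544 + 0.456 r\<close>, it
  lies below each \<open>E\<close> at the corresponding \<open>r\<close>.\<close>

lemma circle_bound_integral:
  assumes r: "477/10000 \<le> r" "r \<le> 695/10000" and \<rho>: "r + 874/1000 \<le> \<rho>" "\<rho> < r + 7/8"
  shows "\<exists>J. ((\<lambda>\<theta>. cos \<theta> * circle_majorant r \<rho> \<theta>) has_integral J) {- (pi/2)..pi/2} \<and>
    J / (pi * \<rho>) \<le> 18085/10000 - (1945/1000) * r"
proof -
  define k where "k = r / \<rho>"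
  define a where "a = sqrt (1 - k\<^sup>2)"
  define p where "p = Digamma (3/2 :: real)"
  define b0 where "b0 = (119/200) * r + r * ln 2 + ln (9/5) - 1 + (1 + r) / (9/5) + ln 2 - ln pi / 2 - p * (1/2 + r)"
  define b1 where "b1 = (119/200) * \<rho> - \<rho> * ln 2 + \<rho> / (9/5) + p * \<rho>"
  define q0 q1 q2 q3 :: real where "q0 = 22157402138906287/51721048867500000" and "q1 = - (1015516780531/1868467500000)"
    and "q2 = 1995511727/1822500000" and "q3 = - (15886614931/16402500000)"
  have \<rho>0: "\<rho> > 0" using \<rho> r by linarith
  have k: "0 < k" "k \<le> 737/10000"
  proof -
    show "0 < k" using r \<rho>0 by (simp add: k_def)
    have "r \<le> (737/10000) * \<rho>" using r \<rho> by linarith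
    then show "k \<le> 737/10000" using \<rho>0 by (simp add: k_def pos_divide_le_eq)
  qed
  have k2: "0 < k\<^sup>2" "k\<^sup>2 \<le> (737/10000)\<^sup>2" using k by (auto intro: power_mono)
  have a1: "a < 1" using k2 by (simp add: a_def)
  have a0: "a \<ge> 1 - 275/100000"
    unfolding a_def by (rule real_le_rsqrt) (use k2 in \<open>simp add: power2_eq_square\<close>)
  define J where "J = - 4 * ln \<rho> * 2 - 2 * ((1 + a) * ln (1 + a) + (1 - a) * ln (1 - a) - 2)
    - 2 * (ln (1 + (53/100)\<^sup>2) - 2 + 2 * (53/100) * arctan (1 / (53/100))) + b0 * 2 + b1 * (pi / 2)
    + (q0 * 2 + q1 * (pi/2) + q2 * (4/3) + q3 * (3/8 * pi))"
  have "((\<lambda>\<theta>. (- 4 * ln \<rho>) * cos \<theta> - cos \<theta> * ln \<bar>sin \<theta> ^ 2 - a ^ 2\<bar> - cos \<theta> * ln (sin \<theta> ^ 2 + (53/100) ^ 2)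
      + b0 * cos \<theta> + b1 * cos \<theta> ^ 2 + (q0 * cos \<theta> + q1 * cos \<theta> ^ 2 + q2 * cos \<theta> ^ 3 + q3 * cos \<theta> ^ 4)) has_integral J) {- (pi/2)..pi/2}"
    unfolding J_def
    by (intro has_integral_add has_integral_diff has_integral_mult_right has_integral_cos has_integral_cos_power2
        has_integral_cos_power3 has_integral_cos_power4 has_integral_cos_ln_abs_sin_diff has_integral_cos_ln_sin_sum)
       (use a0 a1 in auto)
  moreover have "(- 4 * ln \<rho>) * cos \<theta> - cos \<theta> * ln \<bar>sin \<theta> ^ 2 - a ^ 2\<bar> - cos \<theta> * ln (sin \<theta> ^ 2 + (53/100) ^ 2)
      + b0 * cos \<theta> + b1 * cos \<theta> ^ 2 + (q0 * cos \<theta> + q1 * cos \<theta> ^ 2 + q2 * cos \<theta> ^ 3 + q3 * cos \<theta> ^ 4) = cos \<theta> * circle_majorant r \<rho> \<theta>" for \<theta>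
  proof -
    have "gamma_cubic (cos \<theta>) = q0 + q1 * cos \<theta> + q2 * cos \<theta> ^ 2 + q3 * cos \<theta> ^ 3"
      by (simp add: gamma_cubic_def q0_def q1_def q2_def q3_def)
    then have W: "circle_majorant r \<rho> \<theta> = - 4 * ln \<rho> - ln \<bar>sin \<theta> ^ 2 - a\<^sup>2\<bar> - ln (sin \<theta> ^ 2 + (53/100)\<^sup>2) + b0 + b1 * cos \<theta>
        + (q0 + q1 * cos \<theta> + q2 * cos \<theta> ^ 2 + q3 * cos \<theta> ^ 3)"
      by (simp add: circle_majorant_def b0_def b1_def p_def a_def k_def)
    show ?thesis unfolding W
      by (simp only: distrib_left right_diff_distrib power2_eq_square power3_eq_cube power4_eq_xxxx mult_ac)
  qed
  ultimately have J: "((\<lambda>\<theta>. cos \<theta> * circle_majorant r \<rho> \<theta>) has_integral J) {- (pi/2)..pi/2}" by simp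
  have "J \<le> (18085/10000 - (1945/1000) * r) * (pi * \<rho>)"
  proof -
    have e: "(1 + a) * ln (1 + a) + (1 - a) * ln (1 - a) \<ge> 1365/1000"
      using entropy_ge[of "1 - a"] a0 a1 by simp
    have l: "- ln \<rho> \<le> (1865/1000 - \<rho>) / (8694/10000) - 1"
    proof -
      have "ln (1 / \<rho>) \<le> 1 / \<rho> - 1" using \<rho>0 by (intro ln_le_minus_one) auto
      \<comment> \<open>The chord of \<open>1 / \<rho>\<close> over \<open>[0.92, 0.945]\<close>,
        with \<open>1.865 = 0.92 + 0.945\<close> and \<open>0.8694 = 0.92 * 0.945\<close>.\<close>
      moreover have "1 / \<rho> \<le> (1865/1000 - \<rho>) / (8694/10000)"
      proof -
        have "(\<rho> - 92/100) * (945/1000 - \<rho>) \<ge> 0" using r \<rho> by (intro mult_nonneg_nonneg) auto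
        moreover have "(\<rho> - 92/100) * (945/1000 - \<rho>) = (1865/1000 - \<rho>) * \<rho> - 8694/10000"
          by (simp add: field_simps)
        ultimately have "8694/10000 \<le> (1865/1000 - \<rho>) * \<rho>" by linarith
        then have "(8694/10000) / \<rho> \<le> 1865/1000 - \<rho>" using \<rho>0 by (subst pos_divide_le_eq) auto
        then show ?thesis by (subst pos_le_divide_eq) auto
      qed
      moreover have "ln (1 / \<rho>) = - ln \<rho>" using \<rho>0 by (simp add: ln_div)
      ultimately show ?thesis by linarith
    qed
    have l2: "ln (1 + (53/100)\<^sup>2 :: real) \<ge> 247/1000"
      using ln_approx_bounds[of "12809/10000" 2] by (simp add: power2_eq_square eval_nat_numeral)
    have at: "arctan (1 / (53/100)) \<ge> pi / 2 - 48874/100000"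
    proof -
      have "arctan (53/100) \<le> 48874/100000"
        using arctan_upper_bound[of "53/100" 1] by (simp add: eval_nat_numeral)
      then show ?thesis using arctan_inverse[of "53/100"] by (simp add: inverse_eq_divide)
    qed
    have pi: "314/100 < pi" "pi < 31417/10000" using pi_bounds by auto
    have p: "0 < p" "p < 383/10000" using Digamma_three_halves_bounds Digamma_three_halves_less by (auto simp: p_def)
    have Y: "q0 * 2 + q1 * (pi/2) + q2 * (4/3) + q3 * (3/8 * pi) \<le> 330/1000"
      unfolding q0_def q1_def q2_def q3_def using pi by simp
    have \<rho>pi: "\<rho> * pi \<le> (r + 7/8) * (31417/10000)" using \<rho> \<rho>0 pi r by (intro mult_mono) auto
    \<comment> \<open>The Digamma terms of \<open>b0\<close> and \<open>b1\<close> have opposite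
      signs and are merged before estimating, so that the small \<open>p\<close> multiplies a net
      factor of at most 0.38.\<close>
    have pterm: "p * (\<rho> * (pi/2) - (1 + 2 * r)) \<le> (383/10000) * (38/100)"
    proof (rule order.trans[OF mult_left_mono mult_right_mono])
      define S where "S = \<rho> * pi"
      have "(r + 7/8) * (31417/10000) = (31417/10000) * r + 219919/80000" by (simp add: field_simps)
      then have "S \<le> (31417/10000) * r + 219919/80000" using \<rho>pi by (simp add: S_def)
      then have "S / 2 - (1 + 2 * r) \<le> 38/100" using r by (simp add: field_simps)
      then show "\<rho> * (pi/2) - (1 + 2 * r) \<le> 38/100" by (simp add: S_def)
    qed (use p in auto)
    have r2: "r * ln 2 \<le> r * (6932/10000)" "\<rho> * pi * ln 2 \<ge> \<rho> * pi * (693/1000)"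
      using r \<rho>0 ln_2_bounds pi by (auto intro!: mult_left_mono)
    have b: "b0 * 2 + b1 * (pi/2) = 2 * ((119/200) * r + r * ln 2 + ln (9/5) - 1 + (1 + r) / (9/5) + ln 2 - ln pi / 2)
        + ((119/200) + 5/9) / 2 * (\<rho> * pi) - \<rho> * pi * ln 2 / 2 + p * (\<rho> * (pi/2) - (1 + 2 * r))"
      by (simp add: b0_def b1_def field_simps)
    define S where "S = \<rho> * pi"
    define ED where "ED = (1 + a) * ln (1 + a) + (1 - a) * ln (1 - a)"
    define At where "At = arctan (1 / (53/100 :: real))"
    define La where "La = ln (1 + (53/100)\<^sup>2 :: real)"
    define pt where "pt = p * (\<rho> * (pi/2) - (1 + 2 * r))"
    define rl where "rl = r * ln 2"
    define Sl where "Sl = S * ln 2"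
    have bb: "b0 * 2 + b1 * (pi/2) = (119/100) * r + 2 * rl + 2 * ln (9/5) - 2 + 10/9 + (10/9) * r + 2 * ln 2 - ln pi
        + (2071/3600) * S - (1/2) * Sl + pt"
      unfolding b by (simp add: S_def rl_def Sl_def pt_def field_simps)
    have "J = - 8 * ln \<rho> - 2 * ED + 4 - 2 * La + 4 - (212/100) * At + (b0 * 2 + b1 * (pi/2))
        + (q0 * 2 + q1 * (pi/2) + q2 * (4/3) + q3 * (3/8 * pi))"
      unfolding J_def ED_def La_def At_def by (simp add: field_simps)
    moreover have "1365/1000 \<le> ED" "247/1000 \<le> La" "pi / 2 - 48874/100000 \<le> At" "pt \<le> 14554/1000000"
      "rl \<le> (6932/10000) * r" "(693/1000) * S \<le> Sl"
      using e l2 at pterm r2 by (simp_all add: ED_def La_def At_def pt_def rl_def Sl_def S_def mult_ac)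
    moreover have "- ln \<rho> \<le> 9956/8694 - (10000/8694) * \<rho>" using l by (simp add: field_simps)
    ultimately have J1: "J \<le> 8 * (9956/8694) - (80000/8694) * \<rho> - 2730/1000 + 8 - 494/1000 - (106/100) * pi + (212/100) * (48874/100000)
        + (119/100) * r + (13864/10000) * r + 11758/10000 - 2 + 10/9 + (10/9) * r + 13864/10000 - 1144/1000
        + (2071/3600) * S - (693/2000) * S + 14554/1000000 + 330/1000"
      unfolding bb using Y ln_9_fifths_less ln_2_bounds ln_pi_bounds by linarith
    define T where "T = 18085/10000 - (1945/1000) * r"
    \<comment> \<open>The terms of \<open>J\<close> in \<open>S = \<rho> pi\<close> are moved to the
      side of \<open>S * T\<close>. The net factor is positive, so for them a lower bound for
      \<open>S\<close> suffices.\<close>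
    have "(r + 874/1000) * (314/100) * (15797/10000 - (1945/1000) * r) \<le> S * (T - (2071/3600 - 693/2000))"
      unfolding S_def T_def using r \<rho> pi by (intro mult_mono) auto
    moreover have "S * (T - (2071/3600 - 693/2000)) = S * T - (2071/3600) * S + (693/2000) * S"
      by (simp add: field_simps)
    moreover have "(r + 874/1000) * (314/100) * (15797/10000 - (1945/1000) * r) \<ge> 4335/1000 - (803/1000) * r"
    proof -
      define R where "R = r * r"
      have "R \<le> r * (695/10000)" unfolding R_def using r by (intro mult_left_mono) auto
      moreover have "(r + 874/1000) * (314/100) * (15797/10000 - (1945/1000) * r) =
          (874/1000) * (314/100) * (15797/10000) + (314/100) * (15797/10000) * r - (874/1000) * (314/100) * (1945/1000) * r
          - (314/100) * (1945/1000) * R"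
        by (simp add: R_def field_simps)
      ultimately show ?thesis using r by linarith
    qed
    ultimately have "J \<le> S * T" using J1 r \<rho> pi by linarith
    then show ?thesis by (simp add: S_def T_def mult_ac)
  qed
  then have "J / (pi * \<rho>) \<le> 18085/10000 - (1945/1000) * r"
    using \<rho>0 pi_gt_zero by (subst pos_divide_le_eq) auto
  with J show ?thesis by blast
qed

lemma infsum_of_real:
  "of_real (\<Sum>\<^sub>\<infinity>x\<in>A. f x) = (\<Sum>\<^sub>\<infinity>x\<in>A. of_real (f x) :: complex)"
proof (cases "f summable_on A")
  case True
  then show ?thesis
    by (metis has_sum_infsum has_sum_of_real_iff infsumI)
next
  case False
  then have "\<not> (\<lambda>x. of_real (f x) :: complex) summable_on A"
    using summable_on_bounded_linear[OF bounded_linear_Re] by fastforce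
  then show ?thesis using False by (simp add: infsum_not_exists)
qed

section \<open>The logarithmic derivative\<close>

text \<open>After folding, \<open>- I\<close> integrates \<open>cos \<theta>\<close> times the
  difference of \<open>ln |L|\<close> at the left and the right point. The result is stated with
  \<open>r / (r + 7/8)\<close>, which is at most \<open>r / \<rho>\<close>, so that the coefficient
  of \<open>ln q\<close> is free of \<rho> when \<rho> later approaches
  \<open>r + 7/8\<close>.\<close>

lemma integral_cos_ln_norm_L_le:
  assumes prim: "primitive_character q chi" and q: "q > 1"
    and r: "477/10000 \<le> r" "r \<le> 695/10000" and \<rho>: "r + 874/1000 \<le> \<rho>" "\<rho> < r + 7/8"
    and nz: "\<And>z. z \<in> sphere (of_real (1 + r)) \<rho> \<Longrightarrow> L_mellin chi z \<noteq> 0"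
    and I: "((\<lambda>\<theta>. cos \<theta> * ln (norm (L_mellin chi (of_real (1 + r) + \<rho> * cis \<theta>)))) has_integral I) {0..2 * pi}"
  shows "- I / (pi * \<rho>) \<le> (1/4 - (317/1000) * (r / (r + 7/8))) * ln q + (18085/10000 - (1945/1000) * r)"
proof -
  define L where "L \<theta> = ln (norm (L_mellin chi (of_real (1 + r) + \<rho> * cis \<theta>)))" for \<theta>
  define L' where "L' \<theta> = ln (norm (L_mellin chi (of_real (1 + r) - \<rho> * cis \<theta>)))" for \<theta>
  define k where "k = r / \<rho>"
  have \<rho>0: "\<rho> > 0" using \<rho> r by linarith
  have k: "0 < k" "k \<le> 737/10000" "\<rho> * k = r" "r / (r + 7/8) \<le> k"
  proof -
    show "0 < k" using r \<rho>0 by (simp add: k_def)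
    have "r \<le> (737/10000) * \<rho>" using r \<rho> by linarith
    then show "k \<le> 737/10000" using \<rho>0 by (simp add: k_def pos_divide_le_eq)
    show "\<rho> * k = r" using \<rho>0 by (simp add: k_def)
    show "r / (r + 7/8) \<le> k" unfolding k_def using r \<rho> \<rho>0 by (intro divide_left_mono) auto
  qed
  have cis_shift: "cis (\<theta> + pi) = - cis \<theta>" "cis (pi + \<theta>) = - cis \<theta>" for \<theta> by (simp_all add: complex_eq_iff)
  have "((\<lambda>\<theta>. cos \<theta> * L \<theta> + cos (\<theta> + pi) * L (\<theta> + pi)) has_integral I) {- (pi/2)..pi/2}"
  proof (rule integral_symmetric_half_period)
    have "cis (x + 2 * pi) = cis x" for x by (simp add: complex_eq_iff)
    then show "cos (x + 2 * pi) * L (x + 2 * pi) = cos x * L x" for x by (simp add: L_def)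
  qed (use I in \<open>simp add: L_def\<close>)
  moreover have "cos \<theta> * L \<theta> + cos (\<theta> + pi) * L (\<theta> + pi) = - (cos \<theta> * (L' \<theta> - L \<theta>))" for \<theta>
    by (simp add: L_def L'_def cis_shift algebra_simps)
  ultimately have "((\<lambda>\<theta>. - (cos \<theta> * (L' \<theta> - L \<theta>))) has_integral I) {- (pi/2)..pi/2}" by simp
  from has_integral_neg[OF this] have h: "((\<lambda>\<theta>. cos \<theta> * (L' \<theta> - L \<theta>)) has_integral - I) {- (pi/2)..pi/2}" by simp
  obtain J1 where J1: "((\<lambda>x. cos x * max (\<rho> * cos x - r) 0) has_integral J1) {- (pi/2)..pi/2}"
    "J1 \<le> \<rho> * (pi / 2 - 2 * k + (51/100) * k ^ 3)"
    using integral_cos_positive_part[OF \<rho>0 k(1)] k by auto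
  obtain J2 where J2: "((\<lambda>\<theta>. cos \<theta> * circle_majorant r \<rho> \<theta>) has_integral J2) {- (pi/2)..pi/2}"
    "J2 / (pi * \<rho>) \<le> 18085/10000 - (1945/1000) * r"
    using circle_bound_integral[OF r \<rho>] by blast
  define V where "V \<theta> = cos \<theta> * max (\<rho> * cos \<theta> - r) 0 * (ln q / 2) + cos \<theta> * circle_majorant r \<rho> \<theta>" for \<theta>
  have V: "(V has_integral J1 * (ln q / 2) + J2) {- (pi/2)..pi/2}"
    unfolding V_def by (intro has_integral_add has_integral_mult_left J1(1) J2(1))
  \<comment> \<open>the angles where the circle meets \<open>Re s = 1\<close> and the pointwise bound is not available\<close>
  define S where "S = {\<theta> \<in> {- (pi/2)..pi/2}. \<rho> * cos \<theta> = r}"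
  have "S \<subseteq> {arccos k, - arccos k}"
  proof
    fix \<theta> assume "\<theta> \<in> S"
    then have t: "- (pi/2) \<le> \<theta>" "\<theta> \<le> pi/2" "cos \<theta> = k" using \<rho>0 by (auto simp: S_def k_def field_simps)
    have "arccos (cos \<bar>\<theta>\<bar>) = \<bar>\<theta>\<bar>" using t pi_gt_zero by (intro arccos_cos) auto
    then show "\<theta> \<in> {arccos k, - arccos k}" using t by (auto simp: abs_if split: if_splits)
  qed
  then have S: "finite S" by (rule finite_subset) simp
  define h' where "h' \<theta> = (if \<theta> \<in> S then V \<theta> else cos \<theta> * (L' \<theta> - L \<theta>))" for \<theta>
  have "(h' has_integral - I) {- (pi/2)..pi/2}"
    by (rule has_integral_spike_finite[OF S _ h]) (simp add: h'_def)
  then have "- I \<le> J1 * (ln q / 2) + J2"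
  proof (rule has_integral_le[OF _ V])
    fix \<theta> assume \<theta>: "\<theta> \<in> {- (pi/2)..pi/2}"
    show "h' \<theta> \<le> V \<theta>"
    proof (cases "\<theta> \<in> S \<or> cos \<theta> = 0")
      case True
      then show ?thesis by (auto simp: h'_def V_def)
    next
      case False
      then have c: "cos \<theta> > 0" "\<rho> * cos \<theta> \<noteq> r"
        using \<theta> cos_ge_zero[of \<theta>] by (auto simp: S_def less_le)
      have "of_real (1 + r) - \<rho> * cis \<theta> \<in> sphere (of_real (1 + r)) \<rho>"
        using \<rho>0 by (simp add: dist_norm norm_mult)
      then have "L' \<theta> - L \<theta> \<le> max (\<rho> * cos \<theta> - r) 0 * (ln q / 2) + circle_weight r \<rho> (cos \<theta>)"
        unfolding L_def L'_def using r \<rho> \<rho>0 by (intro ln_norm_L_circle_diff_le prim q c nz) auto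
      also have "circle_weight r \<rho> (cos \<theta>) \<le> circle_majorant r \<rho> \<theta>"
        by (rule circle_weight_le[OF r \<rho> _ c(2)]) (use c in simp)
      finally have "cos \<theta> * (L' \<theta> - L \<theta>) \<le> cos \<theta> * (max (\<rho> * cos \<theta> - r) 0 * (ln q / 2) + circle_majorant r \<rho> \<theta>)"
        using c by (intro mult_left_mono) auto
      then show ?thesis using False by (simp add: h'_def V_def distrib_left mult.assoc)
    qed
  qed
  then have "- I / (pi * \<rho>) \<le> (J1 * (ln q / 2) + J2) / (pi * \<rho>)"
    using \<rho>0 by (intro divide_right_mono) auto
  also have "\<dots> = J1 / (pi * \<rho>) * (ln q / 2) + J2 / (pi * \<rho>)"
    by (simp add: add_divide_distrib)
  also have "J1 / (pi * \<rho>) * (ln q / 2) \<le> (1/2 - (634/1000) * (r / (r + 7/8))) * (ln q / 2)"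
  proof (intro mult_right_mono)
    have "J1 / (pi * \<rho>) \<le> \<rho> * (pi / 2 - 2 * k + (51/100) * k ^ 3) / (pi * \<rho>)"
      using J1(2) \<rho>0 by (intro divide_right_mono) auto
    also have "\<dots> = 1/2 - (2 * k - (51/100) * k ^ 3) / pi" using \<rho>0 by (simp add: field_simps)
    \<comment> \<open>\<open>2 / pi\<close> is about 0.6366; lowering it to 0.634 absorbs the cubic
      term because \<open>k <= 0.0737\<close>.\<close>
    also have "\<dots> \<le> 1/2 - (634/1000) * k"
    proof -
      have "k\<^sup>2 \<le> (737/10000)\<^sup>2" using k by (intro power_mono) auto
      then have "k * k\<^sup>2 \<le> k * (55/10000)" using k by (intro mult_left_mono) (auto simp: power2_eq_square)
      then have k3: "k ^ 3 \<le> (55/10000) * k" by (simp add: power3_eq_cube power2_eq_square mult_ac)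
      have "k * pi \<le> k * (31417/10000)" using k pi_bounds by (intro mult_left_mono) auto
      then have "(634/1000) * (k * pi) \<le> 2 * k - (51/100) * k ^ 3"
        using k3 k(1) by linarith
      then have "(634/1000) * k * pi \<le> 2 * k - (51/100) * k ^ 3" by (simp only: mult.assoc)
      then have "(634/1000) * k \<le> (2 * k - (51/100) * k ^ 3) / pi" by (simp add: pos_le_divide_eq)
      then show ?thesis by linarith
    qed
    also have "\<dots> \<le> 1/2 - (634/1000) * (r / (r + 7/8))"
      using k(4) by (intro diff_left_mono mult_left_mono) auto
    finally show "J1 / (pi * \<rho>) \<le> 1/2 - (634/1000) * (r / (r + 7/8))" .
  qed (use q in auto)
  also have "(1/2 - (634/1000) * (r / (r + 7/8))) * (ln q / 2) = (1/4 - (317/1000) * (r / (r + 7/8))) * ln q"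
    by (simp add: algebra_simps)
  also note add_left_mono[OF J2(2)]
  finally show ?thesis by simp
qed

text \<open>Every zero satisfies \<open>Re w <= 1 < 1 + r\<close>, so all terms of the Jensen sum
  are nonnegative and the sum is at least the term of \<beta>.\<close>

lemma L_log_deriv_le_radius:
  assumes prim: "primitive_character q chi" and q: "q > 1"
    and r: "477/10000 \<le> r" "r \<le> 695/10000" and \<rho>: "r + 874/1000 \<le> \<rho>" "\<rho> < r + 7/8"
    and nz: "\<And>z. z \<in> sphere (of_real (1 + r)) \<rho> \<Longrightarrow> L_mellin chi z \<noteq> 0"
    and \<beta>: "0 < \<beta>" "\<beta> < 1" "L_mellin chi (of_real \<beta>) = 0"
  shows "- Re (deriv (L_mellin chi) (of_real (1 + r)) / L_mellin chi (of_real (1 + r))) \<le>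
    - 1 / (1 + r - \<beta>) + (1 + r - \<beta>) / \<rho>\<^sup>2 + (1/4 - (317/1000) * (r / (r + 7/8))) * ln q
    + (18085/10000 - (1945/1000) * r)"
proof -
  define a where "a = complex_of_real (1 + r)"
  define U where "U = {s. Re s > 0}"
  define Z where "Z = {w \<in> cball a \<rho>. L_mellin chi w = 0}"
  define T where "T w = Re (1 / (a - w)) - Re (a - w) / \<rho>\<^sup>2" for w
  have \<rho>0: "\<rho> > 0" using \<rho> r by linarith
  have U: "open U" "connected U"
    by (auto simp: U_def open_halfspace_Re_gt intro!: convex_connected convex_halfspace_Re_gt)
  have sub: "cball a \<rho> \<subseteq> U"
    unfolding U_def using \<rho> by (intro cball_subset_halfspace_Re) (simp add: a_def)
  have hol: "L_mellin chi holomorphic_on U" unfolding U_def by (rule L_mellin_holomorphic[OF prim q])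
  have nz1: "L_mellin chi w \<noteq> 0" if "Re w > 1" for w
    by (rule abs_ln_norm_L_mellin_le(1)[OF prim q that])
  have a: "L_mellin chi a \<noteq> 0" using r by (intro nz1) (simp add: a_def)
  have left: "Re w \<le> Re a" if "L_mellin chi w = 0" for w
    using nz1[of w] that r by (force simp: a_def)
  obtain I where I: "((\<lambda>\<theta>. cos \<theta> * ln (norm (L_mellin chi (a + \<rho> * cis \<theta>)))) has_integral I) {0..2 * pi}"
    "I \<le> pi * \<rho> * (Re (deriv (L_mellin chi) a / L_mellin chi a) - (\<Sum>w\<in>Z. T w))"
    using jensen_cos_inequality[OF U sub \<rho>0 hol a] nz left unfolding a_def[symmetric] Z_def T_def by blast
  have fin: "finite Z"
    unfolding Z_def using r sub a by (intro finite_zeros_compact[OF hol U, of _ a]) (auto simp: U_def a_def)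
  have Tnn: "T w \<ge> 0" if "w \<in> Z" for w
    unfolding T_def using that left by (intro zero_term_nonneg) (auto simp: Z_def dist_norm)
  have Tb: "T (of_real \<beta>) = 1 / (1 + r - \<beta>) - (1 + r - \<beta>) / \<rho>\<^sup>2"
    using of_real_divide[of 1 "1 + r - \<beta>", where 'a = complex]
    unfolding T_def a_def by (metis Re_complex_of_real of_real_1 of_real_diff)
  have "(\<Sum>w\<in>Z. T w) \<ge> T (of_real \<beta>)"
  proof (cases "of_real \<beta> \<in> Z")
    case True
    then show ?thesis using fin Tnn by (intro member_le_sum) auto
  next
    \<comment> \<open>Here \<beta> lies outside the disc, so \<open>1 + r - \<beta> > \<rho>\<close>
      and its term is at most 0: the claim is weaker than the bound without any zero.\<close>
    case False
    then have "norm (a - of_real \<beta>) > \<rho>" using \<beta> by (auto simp: Z_def dist_norm)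
    moreover have "a - of_real \<beta> = of_real (1 + r - \<beta>)" by (simp add: a_def)
    ultimately have d: "1 + r - \<beta> > \<rho>" using \<beta> r by (simp only: norm_of_real)
    have "\<rho>\<^sup>2 \<le> (1 + r - \<beta>)\<^sup>2" using d \<rho>0 by (intro power_mono) auto
    then have "1 / (1 + r - \<beta>) \<le> (1 + r - \<beta>) / \<rho>\<^sup>2"
      using d \<rho>0 by (simp add: divide_simps power2_eq_square)
    then have "T (of_real \<beta>) \<le> 0" unfolding Tb by simp
    then show ?thesis using sum_nonneg[of Z T] Tnn by force
  qed
  moreover have "I / (pi * \<rho>) \<le> Re (deriv (L_mellin chi) a / L_mellin chi a) - (\<Sum>w\<in>Z. T w)"
    using I(2) \<rho>0 by (subst pos_divide_le_eq) (auto simp: mult_ac)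
  moreover have "- I / (pi * \<rho>) \<le> (1/4 - (317/1000) * (r / (r + 7/8))) * ln q + (18085/10000 - (1945/1000) * r)"
    by (rule integral_cos_ln_norm_L_le[OF prim q r \<rho> nz I(1)[unfolded a_def]])
  ultimately show ?thesis unfolding Tb a_def[symmetric] by simp
qed

text \<open>There may be zeros on the circle of radius \<open>r + 7/8\<close> itself, so it is approached from inside.\<close>

lemma L_log_deriv_le:
  assumes prim: "primitive_character q chi" and q: "q > 1"
    and r: "477/10000 \<le> r" "r \<le> 695/10000"
    and \<beta>: "0 < \<beta>" "\<beta> < 1" "L_mellin chi (of_real \<beta>) = 0"
  shows "- Re (deriv (L_mellin chi) (of_real (1 + r)) / L_mellin chi (of_real (1 + r))) \<le>
    - 1 / (1 + r - \<beta>) + (1 + r - \<beta>) / (r + 7/8)\<^sup>2 + (1/4 - (317/1000) * (r / (r + 7/8))) * ln q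
    + (18085/10000 - (1945/1000) * r)"
proof (rule ccontr)
  define X where "X = - Re (deriv (L_mellin chi) (of_real (1 + r)) / L_mellin chi (of_real (1 + r)))"
  define Y where "Y \<rho> = - 1 / (1 + r - \<beta>) + (1 + r - \<beta>) / \<rho>\<^sup>2 + (1/4 - (317/1000) * (r / (r + 7/8))) * ln q
    + (18085/10000 - (1945/1000) * r)" for \<rho>
  define R where "R = r + 7/8"
  assume "\<not> ?thesis"
  then have less: "Y R < X" by (simp add: X_def Y_def R_def)
  have R: "R > 0" using r by (simp add: R_def)
  have "(Y \<longlongrightarrow> Y R) (at_left R)"
    unfolding Y_def by (intro tendsto_intros) (use R in auto)
  then have "eventually (\<lambda>\<rho>. Y \<rho> < X) (at_left R)" using less by (rule order_tendstoD)
  then obtain b where b: "b < R" "\<And>y. b < y \<Longrightarrow> y < R \<Longrightarrow> Y y < X"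
    by (auto simp: eventually_at_left_field)
  define B where "B = (\<lambda>z. dist (of_real (1 + r)) z) ` {z \<in> cball (of_real (1 + r)) R. L_mellin chi z = 0}"
  have "finite {z \<in> cball (of_real (1 + r)) R. L_mellin chi z = 0}"
  proof (rule finite_zeros_compact[OF L_mellin_holomorphic[OF prim q]])
    show "open {s. Re s > 0}" "connected {s. Re s > 0}"
      by (auto simp: open_halfspace_Re_gt intro!: convex_connected convex_halfspace_Re_gt)
    show "cball (complex_of_real (1 + r)) R \<subseteq> {s. Re s > 0}"
      by (rule cball_subset_halfspace_Re) (simp add: R_def)
    show "L_mellin chi (of_real (1 + r)) \<noteq> 0"
      using r by (intro abs_ln_norm_L_mellin_le(1)[OF prim q]) simp
  qed (use r in auto)
  then have "finite B" by (simp add: B_def)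
  moreover have "infinite {max b (r + 874/1000)<..<R}" using b(1) by (simp add: R_def)
  ultimately obtain \<rho> where \<rho>: "\<rho> \<in> {max b (r + 874/1000)<..<R}" "\<rho> \<notin> B"
    by (meson finite_subset subsetI)
  have nz: "L_mellin chi z \<noteq> 0" if "z \<in> sphere (of_real (1 + r)) \<rho>" for z
    using \<rho> that by (auto simp: B_def image_iff)
  have "X \<le> Y \<rho>"
    unfolding X_def Y_def
    by (rule L_log_deriv_le_radius[OF prim q r _ _ nz \<beta>]) (use \<rho> in \<open>auto simp: R_def\<close>)
  moreover have "Y \<rho> < X" using \<rho> b(2) by auto
  ultimately show False by simp
qed

text \<open>The constants add up the contributions of L and zeta:
  \<open>1.2645 = 1.8085 - 0.544\<close> and \<open>1.489 = 1.945 - 0.456\<close>.\<close>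

lemma mangoldt_character_sum_le:
  assumes prim: "primitive_character q chi" and q: "q > 1"
    and r: "477/10000 \<le> r" "r \<le> 695/10000"
    and \<beta>: "0 < \<beta>" "\<beta> < 1" "L_mellin chi (of_real \<beta>) = 0"
  shows "(\<Sum>\<^sub>\<infinity>n\<in>{1::nat..}. mangoldt n * ((1 + Re (chi (int n))) / real n powr (1 + r))) \<le>
    1 / r - 1 / (1 + r - \<beta>) + (1 + r - \<beta>) / (r + 7/8)\<^sup>2 + (1/4 - (317/1000) * (r / (r + 7/8))) * ln q
    + (12645/10000 - (1489/1000) * r)"
proof -
  note char = primitive_imp_character[OF prim]
  define s where "s = complex_of_real (1 + r)"
  have s: "Re s > 1" using r by (simp add: s_def)
  interpret X: completely_multiplicative "\<lambda>n. chi (int n)"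
    by (rule completely_multiplicative_character[OF char])
  interpret O: completely_multiplicative "\<lambda>n. 1"
    by unfold_locales auto
  have pw: "complex_of_nat n powr s = of_real (real n powr (1 + r))" for n
    unfolding s_def by (metis of_nat_0_le_iff of_real_of_nat_eq powr_of_real)
  define A where "A = dseries (\<lambda>n. mangoldt n * chi (int n)) s"
  define A1 where "A1 = dseries (\<lambda>n. mangoldt n * 1) s"
  note sA = Infinite_Sum.abs_summable_summable[OF X.abs_summable_mangoldt[OF s]]
    and sA1 = Infinite_Sum.abs_summable_summable[OF O.abs_summable_mangoldt[OF s]]
  have "(\<Sum>\<^sub>\<infinity>n\<in>{1::nat..}. mangoldt n * ((1 + Re (chi (int n))) / real n powr (1 + r))) =
      (\<Sum>\<^sub>\<infinity>n\<in>{1::nat..}. Re (mangoldt n * 1 / of_nat n powr s + mangoldt n * chi (int n) / of_nat n powr s))"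
  proof (rule infsum_cong)
    fix n :: nat
    have "Re (mangoldt n * z / of_nat n powr s) = mangoldt n * Re z / real n powr (1 + r)" for z :: complex
    proof -
      have "mangoldt n * z / of_nat n powr s = of_real (mangoldt n / real n powr (1 + r)) * z"
        unfolding pw of_real_divide of_real_mangoldt by simp
      then have "Re (mangoldt n * z / of_nat n powr s) = Re (of_real (mangoldt n / real n powr (1 + r)) * z)"
        by (rule arg_cong)
      also have "\<dots> = mangoldt n * Re z / real n powr (1 + r)" by (simp only: times_complex.sel Re_complex_of_real Im_complex_of_real) simp
      finally show ?thesis .
    qed
    note this[of 1] this[of "chi (int n)"]
    then show "mangoldt n * ((1 + Re (chi (int n))) / real n powr (1 + r)) =
        Re (mangoldt n * 1 / of_nat n powr s + mangoldt n * chi (int n) / of_nat n powr s)"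
      by (simp add: add_divide_distrib distrib_left)
  qed
  also have "\<dots> = Re (\<Sum>\<^sub>\<infinity>n\<in>{1::nat..}. mangoldt n * 1 / of_nat n powr s + mangoldt n * chi (int n) / of_nat n powr s)"
    by (intro infsum_Re summable_on_add sA sA1)
  also have "\<dots> = Re A1 + Re A"
    unfolding A_def A1_def dseries_def by (simp only: infsum_add[OF sA1 sA] plus_complex.sel)
  finally have sum: "(\<Sum>\<^sub>\<infinity>n\<in>{1::nat..}. mangoldt n * ((1 + Re (chi (int n))) / real n powr (1 + r))) = Re A1 + Re A" .
  have "A = - (deriv (L_mellin chi) s / L_mellin chi s)"
  proof -
    define D where "D = dseries (\<lambda>n. chi (int n))"
    have "(D has_field_derivative - (A * D s)) (at s)"
      unfolding A_def D_def X.mangoldt_times_dseries[OF s] by (rule has_field_derivative_dseries[OF X.bounded s])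
    moreover have "D z = L_mellin chi z" if "z \<in> {z. Re z > 1}" for z
      using L_mellin_eq_series[OF prim q] that by (simp add: D_def)
    ultimately have "(L_mellin chi has_field_derivative - (A * L_mellin chi s)) (at s)"
      using has_field_derivative_transform_within_open[of D _ s "{z. Re z > 1}" "L_mellin chi"] s
      by (auto simp: open_halfspace_Re_gt)
    then have "deriv (L_mellin chi) s = - (A * L_mellin chi s)" by (rule DERIV_imp_deriv)
    moreover have "L_mellin chi s \<noteq> 0" by (rule abs_ln_norm_L_mellin_le(1)[OF prim q s])
    ultimately show ?thesis by simp
  qed
  then have ReA: "Re A \<le> - 1 / (1 + r - \<beta>) + (1 + r - \<beta>) / (r + 7/8)\<^sup>2 + (1/4 - (317/1000) * (r / (r + 7/8))) * ln q
      + (18085/10000 - (1945/1000) * r)"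
    using L_log_deriv_le[OF prim q r \<beta>] by (simp only: s_def uminus_complex.sel)
  have ReA1: "Re A1 \<le> 1 / r + (456/1000 * r - 544/1000)"
  proof -
    define W where "W = (\<Sum>\<^sub>\<infinity>n\<in>{1::nat..}. ln (real n) / real n powr (1 + r))"
    have r7: "0 < r" "r \<le> 7/100" using r by auto
    have D: "dseries (\<lambda>n. 1) s = of_real (zeta_real (1 + r))"
      unfolding dseries_def zeta_real_def infsum_of_real by (intro infsum_cong) (simp add: pw)
    have "dseries (\<lambda>n. of_real (ln n) * 1) s = complex_of_real W"
      unfolding W_def dseries_def infsum_of_real by (intro infsum_cong) (simp add: pw)
    then have "A1 * of_real (zeta_real (1 + r)) = of_real W"
      using O.mangoldt_times_dseries[OF s] D by (simp add: A1_def)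
    then have "Re (A1 * of_real (zeta_real (1 + r))) = W" by simp
    then have eq: "Re A1 * zeta_real (1 + r) = W" by simp
    have z: "zeta_real (1 + r) \<ge> 1 / r + 544/1000" by (rule zeta_real_ge[OF r7])
    have zp: "1 / r + 544/1000 > 0" using r7 by (intro add_pos_pos) auto
    have "W \<le> 1 / r\<^sup>2 + 16/100" unfolding W_def by (rule ln_div_powr_sum_le[OF r7])
    \<comment> \<open>0.456 is chosen so that \<open>0.456 - 0.544^2 = 0.160064\<close> covers the
      0.16 of \<open>ln_div_powr_sum_le\<close>.\<close>
    also have "\<dots> \<le> (1 / r + (456/1000 * r - 544/1000)) * (1 / r + 544/1000)"
    proof -
      have "(1 / r + (456/1000 * r - 544/1000)) * (1 / r + 544/1000) = 1 / r\<^sup>2 + 456/1000 - (544/1000) * (544/1000) + (456/1000) * (544/1000) * r"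
        using r7 by (simp add: field_simps power2_eq_square)
      then show ?thesis using r7 by simp
    qed
    also have "\<dots> \<le> (1 / r + (456/1000 * r - 544/1000)) * zeta_real (1 + r)"
    proof (intro mult_left_mono z)
      have "1 / r \<ge> 1 / (7/100)" using r7 by (intro divide_left_mono) auto
      then show "0 \<le> 1 / r + (456/1000 * r - 544/1000)" using r7 by simp
    qed
    finally have "Re A1 * zeta_real (1 + r) \<le> (1 / r + (456/1000 * r - 544/1000)) * zeta_real (1 + r)" unfolding eq .
    moreover have "zeta_real (1 + r) > 0" using z zp by linarith
    ultimately show ?thesis by (simp only: mult_le_cancel_right_pos)
  qed
  show ?thesis unfolding sum using ReA ReA1 by linarith
qed

theorem theorem2p1:
  fixes q :: nat and chi :: "int \<Rightarrow> complex" and \<beta>\<^sub>1 r \<phi> E \<sigma> R :: real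
  assumes "primitive_character q chi"
    and "chi \<noteq> principal_character q"
    and "0 < \<beta>\<^sub>1" and "\<beta>\<^sub>1 < 1"
    and "dirichlet_L (complex_of_real \<beta>\<^sub>1) chi = 0"
    and "(r, \<phi>, E) \<in> {(1.6 / (10 * ln 10), 0.22675, 1.1614),
                       (1.3 / (10 * ln 10), 0.23083, 1.1805),
                       (1.2 / (10 * ln 10), 0.23222, 1.1870),
                       (1.1 / (10 * ln 10), 0.23362, 1.1936)}"
    and "\<sigma> = 1 + r" and "R = r + 7 / 8"
  shows "(\<Sum>\<^sub>\<infinity>n\<in>{1::nat..}. mangoldt n * ((1 + Re (chi (int n))) / real n powr \<sigma>))
           \<le> 1 / r - 1 / (\<sigma> - \<beta>\<^sub>1) + (\<sigma> - \<beta>\<^sub>1) / R\<^sup>2 + \<phi> * ln (real q) + E"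
proof -
  note char = primitive_imp_character[OF assms(1)]
  \<comment> \<open>The only character modulo 1 is principal.\<close>
  have q: "q > 1"
    using character_modulus_pos[OF char] character_eq_principal[OF char] assms(2)
    by (cases "q = 1") auto
  have zero: "L_mellin chi (of_real \<beta>\<^sub>1) = 0"
    using dirichlet_L_eq_mellin[OF assms(1) q, of "of_real \<beta>\<^sub>1"] assms(3,5) by simp
  have ln10: "c / (10 * ln 10) > c / (23028/1000)" "c / (10 * ln 10) < c / (23025/1000)" if "c > 0" for c :: real
  proof -
    have "0 < 10 * ln (10::real)" "10 * ln (10::real) < 23028/1000" "10 * ln (10::real) > 23025/1000"
      using ln_10_bounds by linarith+
    then show "c / (10 * ln 10) > c / (23028/1000)" "c / (10 * ln 10) < c / (23025/1000)"
      using that by (intro divide_strict_left_mono mult_pos_pos; simp)+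
  qed
  \<comment> \<open>\<open>1.2645 - 1.489 r\<close> lies below \<open>E\<close> for each of the four triples\<close>
  have "477/10000 \<le> r \<and> r \<le> 695/10000 \<and> 1/4 - (317/1000) * (r / (r + 7/8)) \<le> \<phi> \<and> 12645/10000 - (1489/1000) * r \<le> E"
  proof -
    \<comment> \<open>By this monotonicity the comparison with \<phi> may be made at a rational
      lower bound \<open>x\<close> of \<open>r\<close>, obtained from the upper bound for
      \<open>ln 10\<close>.\<close>
    have frac: "x / (x + 7/8) \<le> r / (r + 7/8)" if "0 < x" "x \<le> r" for x
      using that by (simp add: divide_simps) (simp add: algebra_simps)
    have *: "1/4 - (317/1000) * (r / (r + 7/8)) \<le> \<phi>" if "0 < x" "x \<le> r" "1/4 - (317/1000) * (x / (x + 7/8)) \<le> \<phi>" for x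
    proof -
      have "1/4 - (317/1000) * v \<le> \<phi>" if "u \<le> v" "1/4 - (317/1000) * u \<le> \<phi>" for u v :: real
        using that by linarith
      from this[OF frac[OF that(1,2)] that(3)] show ?thesis .
    qed
    from assms(6) consider "r = 1.6 / (10 * ln 10)" "\<phi> = 0.22675" "E = 1.1614"
      | "r = 1.3 / (10 * ln 10)" "\<phi> = 0.23083" "E = 1.1805"
      | "r = 1.2 / (10 * ln 10)" "\<phi> = 0.23222" "E = 1.1870"
      | "r = 1.1 / (10 * ln 10)" "\<phi> = 0.23362" "E = 1.1936" by auto
    then show ?thesis
    proof cases
      case 1
      then have "69480/1000000 \<le> r" "r \<le> 695/10000" using ln10[of "1.6"] by simp_all
      then show ?thesis using 1(2,3) *[of "69480/1000000"] by simp
    next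
      case 2
      then have "56450/1000000 \<le> r" "r \<le> 695/10000" using ln10[of "1.3"] by simp_all
      then show ?thesis using 2(2,3) *[of "56450/1000000"] by simp
    next
      case 3
      then have "52110/1000000 \<le> r" "r \<le> 695/10000" using ln10[of "1.2"] by simp_all
      then show ?thesis using 3(2,3) *[of "52110/1000000"] by simp
    next
      case 4
      then have "47765/1000000 \<le> r" "r \<le> 695/10000" using ln10[of "1.1"] by simp_all
      then show ?thesis using 4(2,3) *[of "47765/1000000"] by simp
    qed
  qed
  then have r: "477/10000 \<le> r" "r \<le> 695/10000" and \<phi>: "1/4 - (317/1000) * (r / (r + 7/8)) \<le> \<phi>"
    and E: "12645/10000 - (1489/1000) * r \<le> E" by auto
  have "(1/4 - (317/1000) * (r / (r + 7/8))) * ln q \<le> \<phi> * ln q"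
    using \<phi> q by (intro mult_right_mono) auto
  then show ?thesis
    using mangoldt_character_sum_le[OF assms(1) q r assms(3,4) zero] E unfolding assms(7,8) by linarith
qed

end
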